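(* Let $Z$ be a compact topological space which is homeomorphic to a subset of either $S^2$ or $\mathbb{R}\mathrm{P}^2$, and let $\mathfrak{X}$ be a $Z$-valued switched Bebutov shift. If $\phi \in \mathfrak{X}$ is recurrent with respect to the shift semiflow on $\mathfrak{X}$, then there exists $\chi \in \mathfrak{X}$ which is preperiodic and satisfies $\chi(0)=\phi(0)$. If additionally $\phi$ is injective, then $\chi$ may be taken to be constant.
   Context: For a compact metrisable space $Z$, $C([0,\infty),Z)$ carries the compact-open topology (equivalently, the topology of uniform convergence on compact sets). For $\phi\in C([0,\infty),Z)$ and $\tau\ge 0$, the shift is $(\sigma^\tau\phi)(t)\coloneq\phi(\tau+t)$. A $Z$-valued Bebutov shift is a set $\mathfrak{X}\subseteq C([0,\infty),Z)$ which is compact in the compact-open topology and satisfies $\sigma^\tau\phi\in\mathfrak{X}$ for all $\phi\in\mathfrak{X}$, $\tau\ge0$; $(\sigma^\tau)_{\tau\ge0}$ is then a continuous semiflow on $\mathfrak{X}$ (the shift semiflow). It is a switched Bebutov shift if moreover: whenever $\phi_1,\phi_2\in\mathfrak{X}$ satisfy $\phi_1(\tau)=\phi_2(\tau)$ for some $\tau>0$, the function $\psi$ with $\psi(t)=\phi_1(t)$ for $t\in[0,\tau]$ and $\psi(t)=\phi_2(t)$ for $t\in[\tau,\infty)$ belongs to $\mathfrak{X}$. An element $\phi\in\mathfrak{X}$ is recurrent if there is a sequence $t_n\to\infty$ with $\sigma^{t_n}\phi\to\phi$ in the compact-open topology. A function $\chi$ is preperiodic if there exist $T\ge0$ and $p>0$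 with $\chi(t+p)=\chi(t)$ for all $t\ge T$. *)

theory Defs
  imports "HOL-Analysis.Analysis"
begin

definition S2 :: "(real^3) topology" where
  "S2 = top_of_set (sphere 0 1)"

text \<open>The real projective plane: the quotient of S^2 by the antipodal identification
  x ~ -x. Points are the antipodal pairs {x, -x}; a set of points is open iff its union
  (its preimage under the quotient map) is open in S^2.\<close>
definition RP2_points :: "(real^3) set set" where
  "RP2_points = {{x, -x} | x. x \<in> sphere 0 1}"

definition RP2_open :: "(real^3) set set \<Rightarrow> bool" where
  "RP2_open U \<longleftrightarrow> U \<subseteq> RP2_points \<and> openin S2 (\<Union>U)"

lemma istopology_RP2_open: "istopology RP2_open"
  unfolding istopology_def RP2_open_def
proof (rule conjI; intro allI impI)
  fix S T assume "S \<subseteq> RP2_points \<and> openin S2 (\<Union>S)" "T \<subseteq> RP2_points \<and> openin S2 (\<Union>T)"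
  moreover have "\<Union>(S \<inter> T) = \<Union>S \<inter> \<Union>T"
  proof
    show "\<Union>(S \<inter> T) \<subseteq> \<Union>S \<inter> \<Union>T" by blast
    show "\<Union>S \<inter> \<Union>T \<subseteq> \<Union>(S \<inter> T)"
    proof
      fix z assume z: "z \<in> \<Union>S \<inter> \<Union>T"
      then obtain a b where ab: "a \<in> S" "b \<in> T" "z \<in> a" "z \<in> b" by blast
      with \<open>S \<subseteq> RP2_points \<and> _\<close> \<open>T \<subseteq> RP2_points \<and> _\<close>
      obtain x y where "a = {x, -x}" "b = {y, -y}" unfolding RP2_points_def by blast
      with ab have "a = b" by auto
      with ab show "z \<in> \<Union>(S \<inter> T)" by blast
    qed
  qed
  ultimately show "(S \<inter> T) \<subseteq> RP2_points \<and> openin S2 (\<Union>(S \<inter> T))" by (metis le_infI1 openin_Int)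
next
  fix K assume "\<forall>S\<in>K. S \<subseteq> RP2_points \<and> openin S2 (\<Union>S)"
  show "\<Union>K \<subseteq> RP2_points \<and> openin S2 (\<Union>(\<Union>K))"
  proof (rule conjI)
    show "\<Union>K \<subseteq> RP2_points" using \<open>\<forall>S\<in>K. _\<close> by blast
    have "openin S2 (\<Union>S\<in>K. \<Union>S)" using \<open>\<forall>S\<in>K. _\<close> by (intro openin_Union) auto
    moreover have "(\<Union>S\<in>K. \<Union>S) = \<Union>(\<Union>K)" by blast
    ultimately show "openin S2 (\<Union>(\<Union>K))" by simp
  qed
qed

definition RP2 :: "(real^3) set topology" where
  "RP2 = topology RP2_open"

text \<open>An element of C([0,\<infinity>),Z) is represented as a function real \<Rightarrow> 'a that is continuous
  on [0,\<infinity>) (with the subspace topology) into Z, and takes the fixed value undefined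
  at negative times (so that each element of C([0,\<infinity>),Z) has exactly one representative).\<close>
definition Cpos :: "'a topology \<Rightarrow> (real \<Rightarrow> 'a) set" where
  "Cpos Z = {\<phi>. continuous_map (top_of_set {0..}) Z \<phi> \<and> (\<forall>t<0. \<phi> t = undefined)}"

definition compact_open :: "'a topology \<Rightarrow> (real \<Rightarrow> 'a) topology" where
  "compact_open Z = subtopology
     (topology_generated_by {{\<phi>. \<phi> ` K \<subseteq> U} | K U. compact K \<and> K \<subseteq> {0..} \<and> openin Z U})
     (Cpos Z)"

definition shift :: "real \<Rightarrow> (real \<Rightarrow> 'a) \<Rightarrow> (real \<Rightarrow> 'a)" where
  "shift \<tau> \<phi> = (\<lambda>t. if 0 \<le> t then \<phi> (\<tau> + t) else undefined)"

definition bebutov_shift :: "'a topology \<Rightarrow> (real \<Rightarrow> 'a) set \<Rightarrow> bool" where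
  "bebutov_shift Z X \<longleftrightarrow> X \<subseteq> Cpos Z \<and> compactin (compact_open Z) X \<and>
     (\<forall>\<phi>\<in>X. \<forall>\<tau>\<ge>0. shift \<tau> \<phi> \<in> X)"

definition concat_at :: "real \<Rightarrow> (real \<Rightarrow> 'a) \<Rightarrow> (real \<Rightarrow> 'a) \<Rightarrow> (real \<Rightarrow> 'a)" where
  "concat_at \<tau> \<phi>1 \<phi>2 = (\<lambda>t. if t < 0 then undefined else if t \<le> \<tau> then \<phi>1 t else \<phi>2 t)"

definition switched_bebutov_shift :: "'a topology \<Rightarrow> (real \<Rightarrow> 'a) set \<Rightarrow> bool" where
  "switched_bebutov_shift Z X \<longleftrightarrow> bebutov_shift Z X \<and>
     (\<forall>\<phi>1\<in>X. \<forall>\<phi>2\<in>X. \<forall>\<tau>>0. \<phi>1 \<tau> = \<phi>2 \<tau> \<longrightarrow> concat_at \<tau> \<phi>1 \<phi>2 \<in> X)"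

definition recurrent :: "'a topology \<Rightarrow> (real \<Rightarrow> 'a) \<Rightarrow> bool" where
  "recurrent Z \<phi> \<longleftrightarrow> (\<exists>t :: nat \<Rightarrow> real. filterlim t at_top sequentially \<and>
     limitin (compact_open Z) (\<lambda>n. shift (t n) \<phi>) \<phi> sequentially)"

definition preperiodic :: "(real \<Rightarrow> 'a) \<Rightarrow> bool" where
  "preperiodic \<psi> \<longleftrightarrow> (\<exists>T\<ge>0. \<exists>p>0. \<forall>t\<ge>T. \<psi> (t + p) = \<psi> t)"

end

theory Submission
  imports Defs "HOL-Complex_Analysis.Complex_Analysis"
begin

text \<open>Recurrence makes \<open>\<phi>\<close> extendible to arbitrarily negative times inside \<open>X\<close>, and backward extendible
  elements can be concatenated freely; so a self-intersection of \<open>\<phi>\<close> can be traversed forever, which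
  settles the non-injective case. If \<open>\<phi>\<close> is injective, it is transported to an injective recurrent curve
  in the plane (through a lift to the sphere in the projective case, and by a stereographic projection from
  a point off the curve). The key fact is that along every arc \<open>\<phi>[a,b]\<close> there are later
  pieces of \<open>\<phi>\<close> that stay close to the arc and run along some part of it in the opposite direction.
  Otherwise every return to the arc is parallel to it. Close up \<open>\<phi>\<close> between the arc and an
  adjacent return by two short chords, one at each end: the two loops have winding numbers that differ
  by that of the thin strip in between, and each later passage through the strip, being forward, changes the
  winding number around \<open>\<phi>(t)\<close> by the same sign. Hence \<open>\<phi>\<close> cannot come back to \<open>\<phi>(0)\<close>.
  Backward pieces that become ever closer to the arc produce in the limit an element of \<open>X\<close> which
  remains in \<open>\<phi>[a,b]\<close> forever: it either lingers there, or closes up to a loop with part of the arc.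
  Letting \<open>a, b \<rightarrow> 0\<close> gives the constant.\<close>

section \<open>Winding numbers of closed curves near an arc\<close>

text \<open>The curve is merely continuous: it has no tangents and, a priori, no sides. "Backward"
  is therefore expressed by the positions of the two ends of a piece that stays close to the arc,
  and "inside the strip" by a nonzero winding number. The obstacle is a piece that enters the strip
  and turns around inside it. An intermediate point \<open>s\<close> deals with this: a piece that
  reaches the middle from the end \<open>b\<close>, or leaves the middle for the end
  \<open>a\<close>, is backward for \<open>(s, b)\<close> or \<open>(a, s)\<close>. Hence three
  pairs of points have to be excluded at once. The return that bounds the strip must be adjacent to
  the arc because the two loops are compared across the middle chord, whose interior neither of them
  may meet. The plane enters through two facts: an arc does not separate it, and off a simple closed
  curve the winding number is 0 or one fixed sign. On the dynamical side the obstacle is that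
  switching is allowed at positive times only; arbitrarily long pasts remove this
  restriction.\<close>

lemma connected_compact_superset:
  fixes U :: "'a::euclidean_space set"
  assumes U: "open U" "connected U" and W: "compact W" "W \<subseteq> U"
  obtains K where "compact K" "connected K" "W \<subseteq> K" "K \<subseteq> U"
proof (cases "W = {}")
  case True
  then show ?thesis using that[of "{}"] by auto
next
  case False
  then obtain w where w: "w \<in> U" using W by blast
  \<comment> \<open>The set for a single point is a ball around it together with a path to the fixed
    point \<open>w\<close>. The common point \<open>w\<close> later makes the finite union
    connected.\<close>
  have "\<exists>C. compact C \<and> connected C \<and> w \<in> C \<and> C \<subseteq> U \<and> z \<in> interior C" if z: "z \<in> U" for z
  proof -
    obtain r where r: "r > 0" "cball z r \<subseteq> U"
      using U(1) z open_contains_cball by blast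
    have "path_connected U" using U by (simp add: connected_open_path_connected)
    then obtain g where g: "path g" "path_image g \<subseteq> U" "pathstart g = z" "pathfinish g = w"
      using z w unfolding path_connected_def by blast
    have "connected (cball z r \<union> path_image g)"
    proof (intro connected_Un connected_path_image)
      have "z \<in> cball z r \<inter> path_image g" using g r pathstart_in_path_image[of g] by auto
      then show "cball z r \<inter> path_image g \<noteq> {}" by blast
    qed (use g in auto)
    moreover have "ball z r \<subseteq> interior (cball z r \<union> path_image g)"
      by (rule interior_maximal) auto
    then have "z \<in> interior (cball z r \<union> path_image g)" using r by auto
    ultimately show ?thesis
      using g r pathfinish_in_path_image[of g]
      by (intro exI[of _ "cball z r \<union> path_image g"]) (auto simp: compact_Un compact_path_image)
  qed
  then obtain C where C: "\<And>z. z \<in> U \<Longrightarrow> compact (C z) \<and> connected (C z) \<and> w \<in> C z \<and> C z \<subseteq> U \<and> z \<in> interior (C z)"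
    by metis
  obtain D where D: "D \<subseteq> W" "finite D" "W \<subseteq> (\<Union>z\<in>D. interior (C z))"
    using compactE_image[OF W(1), of W "\<lambda>z. interior (C z)"] W(2) C by blast
  have CD: "\<And>z. z \<in> D \<Longrightarrow> compact (C z) \<and> connected (C z) \<and> w \<in> C z \<and> C z \<subseteq> U"
    using C D(1) W(2) by blast
  show ?thesis
  proof (rule that[of "\<Union>z\<in>D. C z"])
    show "compact (\<Union>z\<in>D. C z)" using D CD by (intro compact_UN) auto
    show "W \<subseteq> (\<Union>z\<in>D. C z)"
      using D(3) UN_mono[OF order_refl, of D "\<lambda>z. interior (C z)" C] interior_subset by (meson order_trans)
    show "(\<Union>z\<in>D. C z) \<subseteq> U" using CD by blast
    have "w \<in> \<Inter> (C ` D)" using CD by blast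
    then show "connected (\<Union>z\<in>D. C z)"
      using CD by (intro connected_Union) (blast, metis empty_iff)
  qed
qed

text \<open>Since \<open>A\<close> does not separate the plane, one compact connected set
  \<open>K\<close> off \<open>A\<close> joins all bounded points at distance at least
  \<open>\<epsilon>\<close> to points far out. A curve closer to \<open>A\<close> than
  \<open>K\<close> is misses \<open>K\<close>, so one \<open>\<eta>\<close> serves all curves and
  all \<open>z\<close>.\<close>

lemma winding_number_thin:
  fixes A :: "complex set"
  assumes A: "compact A" "A \<noteq> {}" "connected (- A)" and "\<epsilon> > 0"
  obtains \<eta> where "\<eta> > 0" 
    "\<And>\<gamma> z. \<lbrakk>path \<gamma>; pathfinish \<gamma> = pathstart \<gamma>; \<And>w. w \<in> path_image \<gamma> \<Longrightarrow> infdist w A < \<eta>; infdist z A \<ge> \<epsilon>\<rbrakk>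
       \<Longrightarrow> z \<notin> path_image \<gamma> \<and> winding_number \<gamma> z = 0"
proof -
  obtain R where R: "R > 0" "A \<subseteq> ball 0 R"
    using compact_imp_bounded[OF A(1)] bounded_subset_ballD by blast
  \<comment> \<open>From norm \<open>R'\<close> on, the distance from \<open>A\<close> is at least
    \<open>\<epsilon> + 1\<close>. So the curves stay in \<open>cball 0 R'\<close>, and the radius
    \<open>R' + 1\<close> of \<open>W\<close> leaves room for a point outside that ball.\<close>
  define R' where "R' = R + \<epsilon> + 1"
  define W where "W = (cball 0 (R' + 1) \<inter> {z. infdist z A \<ge> \<epsilon>})"
  have "closed {z. infdist z A \<ge> \<epsilon>}"
    by (intro closed_Collect_le continuous_intros)
  then have "compact W" unfolding W_def by (intro compact_Int_closed) auto
  moreover have "W \<subseteq> - A" unfolding W_def using \<open>\<epsilon> > 0\<close> by auto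
  ultimately obtain K where K: "compact K" "connected K" "W \<subseteq> K" "K \<subseteq> - A"
    using connected_compact_superset[of "-A" W] A compact_imp_closed by blast
  obtain d where d: "d > 0" "\<And>x y. x \<in> A \<Longrightarrow> y \<in> K \<Longrightarrow> d \<le> dist x y"
    using separate_compact_closed[of A K] A K compact_imp_closed by blast
  have far: "infdist z A \<ge> \<epsilon> + 1" if "norm z \<ge> R'" for z
  proof -
    obtain a where a: "a \<in> A" "infdist z A = dist z a"
      using infdist_attains_inf[of A z] A compact_imp_closed by blast
    have "norm a < R" using a R by auto
    then show ?thesis using a that unfolding R'_def dist_norm
      by (smt (verit) norm_triangle_ineq2)
  qed
  have dK: "infdist z A \<ge> d" if "z \<in> K" for z
    using infdist_attains_inf[of A z] A compact_imp_closed d that by (metis dist_commute)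
  show ?thesis
  proof (rule that[of "min d \<epsilon>"])
    show "min d \<epsilon> > 0" using d \<open>\<epsilon> > 0\<close> by auto
    fix \<gamma> z assume g: "path \<gamma>" "pathfinish \<gamma> = pathstart \<gamma>" 
      and n: "\<And>w. w \<in> path_image \<gamma> \<Longrightarrow> infdist w A < min d \<epsilon>" and z: "infdist z A \<ge> \<epsilon>"
    have zn: "z \<notin> path_image \<gamma>" using n z by force
    have sub: "path_image \<gamma> \<subseteq> cball 0 R'"
    proof
      fix w assume "w \<in> path_image \<gamma>"
      then have "infdist w A < \<epsilon> + 1" using n[of w] by auto
      then show "w \<in> cball 0 R'" using far[of w] by fastforce
    qed
    have out: "winding_number \<gamma> w = 0" if "norm w > R'" for w
      using winding_number_zero_outside[OF g(1) convex_cball g(2) _ sub] that by auto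
    have "winding_number \<gamma> z = 0"
    proof (cases "norm z > R'")
      case False
      then have zK: "z \<in> K" using z K unfolding W_def by auto
      define w where "w = complex_of_real (R' + 1)"
      have nw: "norm w = R' + 1" unfolding w_def norm_of_real R'_def using R \<open>\<epsilon> > 0\<close> by simp
      then have wK: "w \<in> K" using far[of w] K unfolding W_def by auto
      have "K \<inter> path_image \<gamma> = {}" using dK n by force
      then have "winding_number \<gamma> z = winding_number \<gamma> w"
        using winding_number_eq[OF g zK wK K(2)] by auto
      then show ?thesis using out nw by auto
    qed (use out in auto)
    with zn show "z \<notin> path_image \<gamma> \<and> winding_number \<gamma> z = 0" by blast
  qed
qed

section \<open>Closed curves composed of pieces of an injective curve\<close>

locale inj_curve =
  fixes \<phi> :: "real \<Rightarrow> complex"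
  assumes cont: "continuous_on {0..} \<phi>" and inj: "inj_on \<phi> {0..}"
begin

text \<open>Boundary of the strip between the pieces over \<open>[p,q]\<close> and
  \<open>[u,v]\<close>. The second piece is run from \<open>v\<close> to \<open>u\<close>, so that
  the chords join the like ends of two parallel pieces.\<close>

definition quad :: "real \<Rightarrow> real \<Rightarrow> real \<Rightarrow> real \<Rightarrow> real \<Rightarrow> complex" where
  "quad p q u v = subpath p q \<phi> +++ linepath (\<phi> q) (\<phi> v) +++ subpath v u \<phi> +++ linepath (\<phi> u) (\<phi> p)"

definition closeup :: "real \<Rightarrow> real \<Rightarrow> real \<Rightarrow> complex" where
  "closeup p u = subpath p u \<phi> +++ linepath (\<phi> u) (\<phi> p)"

lemma eq_iff: "0 \<le> s \<Longrightarrow> 0 \<le> t \<Longrightarrow> \<phi> s = \<phi> t \<longleftrightarrow> s = t"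
  using inj unfolding inj_on_def by auto

lemma image_subpath: "path_image (subpath p q \<phi>) = \<phi> ` closed_segment p q"
  by (simp add: path_image_subpath_gen)

lemma affine_image_closed_segment: "(\<lambda>x. (q - p) * x + p) ` {0..1} \<subseteq> closed_segment p (q::real)"
proof clarify
  fix x :: real assume "x \<in> {0..1}"
  then have "(q - p) * x + p = (1 - x) *\<^sub>R p + x *\<^sub>R q \<and> 0 \<le> x \<and> x \<le> 1"
    by (simp add: algebra_simps)
  then show "(q - p) * x + p \<in> closed_segment p q"
    unfolding closed_segment_def by blast
qed

lemma path_subpath_curve: "0 \<le> p \<Longrightarrow> 0 \<le> q \<Longrightarrow> path (subpath p q \<phi>)"
proof -
  assume "0 \<le> p" "0 \<le> q"
  then have "continuous_on (closed_segment p q) \<phi>"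
    by (intro continuous_on_subset[OF cont]) (auto simp: closed_segment_eq_real_ivl)
  moreover have "(\<lambda>x. (q - p) * x + p) ` {0..1} \<subseteq> closed_segment p q"
    by (rule affine_image_closed_segment)
  ultimately show ?thesis unfolding path_def subpath_def
    using continuous_on_compose2[of "closed_segment p q" \<phi> "{0..1}" "\<lambda>x. (q - p) * x + p"]
    by (simp add: continuous_intros)
qed

lemma arc_subpath_curve: "0 \<le> p \<Longrightarrow> 0 \<le> q \<Longrightarrow> p \<noteq> q \<Longrightarrow> arc (subpath p q \<phi>)"
proof -
  assume *: "0 \<le> p" "0 \<le> q" "p \<noteq> q"
  have "inj_on (subpath p q \<phi>) {0..1}"
  proof (rule inj_onI)
    fix x y assume xy: "x \<in> {0..1}" "y \<in> {0..1}" "subpath p q \<phi> x = subpath p q \<phi> y"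
    have nn: "0 \<le> (q - p) * t + p" if "t \<in> {0..1}" for t
    proof -
      have "(q - p) * t + p = q * t + p * (1 - t)" by (simp add: algebra_simps)
      also have "\<dots> \<ge> 0" using * that by simp
      finally show ?thesis .
    qed
    have "(q - p) * x + p = (q - p) * y + p"
      using xy eq_iff[OF nn[of x] nn[of y]] unfolding subpath_def by simp
    then show "x = y" using * by simp
  qed
  then show ?thesis using path_subpath_curve * by (simp add: arc_def)
qed

lemma connected_arc_compl: "0 \<le> p \<Longrightarrow> p \<le> q \<Longrightarrow> connected (- \<phi> ` {p..q})"
proof (cases "p = q")
  case True
  then show ?thesis by (simp add: connected_punctured_universe)
next
  case False
  assume "0 \<le> p" "p \<le> q"
  then show ?thesis using connected_arc_complement[OF arc_subpath_curve[of p q]] False image_subpath[of p q]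
    by (simp add: closed_segment_eq_real_ivl)
qed

lemma compact_arc: "0 \<le> p \<Longrightarrow> compact (\<phi> ` {p..q})"
  by (intro compact_continuous_image continuous_on_subset[OF cont]) auto

lemma winding_number_arc_combine:
  assumes "0 \<le> p" "0 \<le> q" "0 \<le> r" and z: "z \<notin> \<phi> ` {min p (min q r)..max p (max q r)}"
  shows "winding_number (subpath p q \<phi>) z + winding_number (subpath q r \<phi>) z = winding_number (subpath p r \<phi>) z"
proof (cases "p = q \<and> q = r")
  case True
  then have "\<phi> p \<noteq> z" using z by auto
  then show ?thesis using True by simp
next
  case False
  define m M where "m = min p (min q r)" and "M = max p (max q r)"
  have mM: "m < M" "0 \<le> m" "m \<le> p" "p \<le> M" "m \<le> q" "q \<le> M" "m \<le> r" "r \<le> M"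
    using False assms unfolding m_def M_def by auto
  define g where "g = subpath m M \<phi>"
  \<comment> \<open>All three pieces become subpaths of one path \<open>g\<close> on the unit
    interval, where the combination rule for subpaths applies; \<open>m < M\<close> because the
    three times are not all equal.\<close>
  have sub: "subpath x y \<phi> = subpath ((x - m)/(M - m)) ((y - m)/(M - m)) g" for x y
  proof
    fix t
    have "(M - m) * (((y - m) / (M - m) - (x - m) / (M - m)) * t + (x - m) / (M - m)) + m
       = ((M - m) * ((y - m) / (M - m)) - (M - m) * ((x - m) / (M - m))) * t + (M - m) * ((x - m) / (M - m)) + m"
      by (simp add: distrib_left right_diff_distrib left_diff_distrib mult.assoc)
    also have "\<dots> = (y - x) * t + x" using mM by simp
    finally show "subpath x y \<phi> t = subpath ((x - m)/(M - m)) ((y - m)/(M - m)) g t"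
      unfolding g_def subpath_def by simp
  qed
  have in01: "(x - m)/(M - m) \<in> {0..1}" if "m \<le> x" "x \<le> M" for x
    using mM that by (auto simp: field_simps)
  show ?thesis unfolding sub
  proof (rule winding_number_subpath_combine)
    show "path g" unfolding g_def using mM by (intro path_subpath_curve) auto
    show "z \<notin> path_image g" 
      using z mM by (simp add: g_def image_subpath m_def[symmetric] M_def[symmetric] closed_segment_eq_real_ivl)
  qed (use mM in01 in auto)
qed

end

text \<open>A closest pair among the points of \<open>A\<close> and \<open>B\<close> on the segment
  works: a further point of either set between the two would give a closer pair.\<close>

lemma segment_bridge:
  fixes A B :: "'a::euclidean_space set"
  assumes "compact A" "compact B" "x \<in> A" "y \<in> B" and disj: "A \<inter> B = {}"
  obtains x' y' where "x' \<in> A" "y' \<in> B" "closed_segment x' y' \<subseteq> closed_segment x y"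
    "closed_segment x' y' \<inter> A = {x'}" "closed_segment x' y' \<inter> B = {y'}"
proof -
  let ?S = "closed_segment x y"
  have "compact ((A \<inter> ?S) \<times> (B \<inter> ?S))"
    using assms by (intro compact_Times compact_Int) auto
  moreover have "(A \<inter> ?S) \<times> (B \<inter> ?S) \<noteq> {}" using assms by auto
  moreover have "continuous_on ((A \<inter> ?S) \<times> (B \<inter> ?S)) (\<lambda>p. dist (fst p) (snd p))"
    by (intro continuous_intros)
  ultimately obtain p where p: "p \<in> (A \<inter> ?S) \<times> (B \<inter> ?S)" 
    "\<And>q. q \<in> (A \<inter> ?S) \<times> (B \<inter> ?S) \<Longrightarrow> dist (fst p) (snd p) \<le> dist (fst q) (snd q)"
    using continuous_attains_inf[of "(A \<inter> ?S) \<times> (B \<inter> ?S)" "\<lambda>p. dist (fst p) (snd p)"] by blast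
  obtain x' y' where p': "p = (x', y')" by (cases p)
  have m: "x' \<in> A" "x' \<in> ?S" "y' \<in> B" "y' \<in> ?S" using p p' by auto
  have le: "dist x' y' \<le> dist z w" if "z \<in> A" "z \<in> ?S" "w \<in> B" "w \<in> ?S" for z w
    using p(2)[of "(z,w)"] that p' by auto
  have sub: "closed_segment x' y' \<subseteq> ?S" using m by (simp add: closed_segment_subset)
  have 1: "z = x'" if "z \<in> closed_segment x' y'" "z \<in> A" for z
  proof -
    have "dist x' y' = dist x' z + dist z y'"
      using that(1) by (simp flip: between_mem_segment add: between)
    moreover have "dist x' y' \<le> dist z y'" using le that sub m by blast
    ultimately have "dist x' z \<le> 0" by linarith
    then show ?thesis by simp
  qed
  have 2: "z = y'" if "z \<in> closed_segment x' y'" "z \<in> B" for z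
  proof -
    have "dist x' y' = dist x' z + dist z y'"
      using that(1) by (simp flip: between_mem_segment add: between)
    moreover have "dist x' y' \<le> dist x' z" using le that sub m by blast
    ultimately have "dist z y' \<le> 0" by linarith
    then show ?thesis by simp
  qed
  show ?thesis using that[of x' y'] m sub 1 2 by auto
qed

text \<open>The Jordan curve theorem in terms of winding numbers. The last clause holds because the
  image is the frontier of the inside; it provides inner test points near any chosen boundary
  point.\<close>

lemma simple_closed_winding_number:
  assumes "simple_path \<gamma>" "pathfinish \<gamma> = pathstart \<gamma>"
  shows "\<exists>c. (c = 1 \<or> c = -1) \<and> (\<forall>z. z \<notin> path_image \<gamma> \<longrightarrow> winding_number \<gamma> z = 0 \<or> winding_number \<gamma> z = c) \<and>
    (\<forall>z\<in>path_image \<gamma>. \<forall>e>0. \<exists>w\<in>ball z e. w \<notin> path_image \<gamma> \<and> winding_number \<gamma> w = c)"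
proof -
  obtain c where c: "c = 1 \<or> c = (-1::complex)" "\<And>z. z \<in> inside (path_image \<gamma>) \<Longrightarrow> winding_number \<gamma> z = c"
    using simple_closed_path_winding_number_inside[OF assms(1)] by metis
  have out: "winding_number \<gamma> z = 0" if "z \<in> outside (path_image \<gamma>)" for z
    using winding_number_zero_in_outside that assms simple_path_imp_path by blast
  have fr: "frontier (inside (path_image \<gamma>)) = path_image \<gamma>"
    using Jordan_inside_outside[OF assms] by blast
  show ?thesis
  proof (intro exI[of _ c] conjI allI impI ballI)
    show "c = 1 \<or> c = -1" by (rule c(1))
    show "winding_number \<gamma> z = 0 \<or> winding_number \<gamma> z = c" if "z \<notin> path_image \<gamma>" for z
      using that c out inside_Un_outside[of "path_image \<gamma>"] by blast
    fix z e assume "z \<in> path_image \<gamma>" "(e::real) > 0"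
    then have "z \<in> frontier (inside (path_image \<gamma>))" using fr by simp
    then have "\<exists>w\<in>inside (path_image \<gamma>). dist z w < e"
      unfolding frontier_straddle using \<open>e > 0\<close> by simp
    then obtain w where "w \<in> inside (path_image \<gamma>)" "dist z w < e" by blast
    then show "\<exists>w\<in>ball z e. w \<notin> path_image \<gamma> \<and> winding_number \<gamma> w = c"
      using c(2) IntI[of w "inside (path_image \<gamma>)" "path_image \<gamma>"] inside_no_overlap[of "path_image \<gamma>"]
      by (intro bexI[of _ w]) auto
  qed
qed

context inj_curve begin

lemma image_subpath_le: "p \<le> q \<Longrightarrow> path_image (subpath p q \<phi>) = \<phi> ` {p..q}"
  "p \<le> q \<Longrightarrow> path_image (subpath q p \<phi>) = \<phi> ` {p..q}"
  by (auto simp: image_subpath closed_segment_eq_real_ivl)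

lemma ends_quad [simp]: "pathstart (quad p q u v) = \<phi> p" "pathfinish (quad p q u v) = \<phi> p"
  by (auto simp: quad_def)

lemma ends_closeup [simp]: "pathstart (closeup p u) = \<phi> p" "pathfinish (closeup p u) = \<phi> p"
  by (auto simp: closeup_def)

lemma image_quad: "p \<le> q \<Longrightarrow> u \<le> v \<Longrightarrow> path_image (quad p q u v) =
  \<phi> ` {p..q} \<union> closed_segment (\<phi> q) (\<phi> v) \<union> \<phi> ` {u..v} \<union> closed_segment (\<phi> u) (\<phi> p)"
  unfolding quad_def by (simp add: path_image_join image_subpath_le Un_assoc)

lemma image_closeup: "p \<le> u \<Longrightarrow> path_image (closeup p u) = \<phi> ` {p..u} \<union> closed_segment (\<phi> u) (\<phi> p)"
  unfolding closeup_def by (simp add: path_image_join image_subpath_le Un_assoc)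

lemma path_quad: "0 \<le> p \<Longrightarrow> p \<le> q \<Longrightarrow> 0 \<le> u \<Longrightarrow> u \<le> v \<Longrightarrow> path (quad p q u v)"
  unfolding quad_def by (intro path_join_imp path_subpath_curve) auto

lemma path_closeup: "0 \<le> p \<Longrightarrow> 0 \<le> u \<Longrightarrow> path (closeup p u)"
  unfolding closeup_def by (intro path_join_imp path_subpath_curve) auto

lemma winding_number_quad:
  assumes "0 \<le> p" "p \<le> q" "0 \<le> u" "u \<le> v" "z \<notin> path_image (quad p q u v)"
  shows "winding_number (quad p q u v) z = winding_number (subpath p q \<phi>) z + winding_number (linepath (\<phi> q) (\<phi> v)) z
    + winding_number (subpath v u \<phi>) z + winding_number (linepath (\<phi> u) (\<phi> p)) z"
  using assms image_quad[of p q u v] unfolding quad_def 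
  by (simp add: winding_number_join path_subpath_curve path_image_join image_subpath_le)

lemma winding_number_closeup:
  assumes "0 \<le> p" "p \<le> u" "z \<notin> path_image (closeup p u)"
  shows "winding_number (closeup p u) z = winding_number (subpath p u \<phi>) z + winding_number (linepath (\<phi> u) (\<phi> p)) z"
  using assms image_closeup[of p u] unfolding closeup_def 
  by (simp add: winding_number_join path_subpath_curve path_image_join image_subpath_le)

lemma winding_number_linepath_swap: "z \<notin> closed_segment x y \<Longrightarrow> winding_number (linepath y x) z = - winding_number (linepath x y) z"
  using winding_number_reversepath[of "linepath x y" z] by simp

lemma winding_number_arc_swap: "0 \<le> p \<Longrightarrow> p \<le> q \<Longrightarrow> z \<notin> \<phi> ` {p..q} \<Longrightarrow> winding_number (subpath q p \<phi>) z = - winding_number (subpath p q \<phi>) z"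
  using winding_number_reversepath[of "subpath p q \<phi>" z] by (simp add: path_subpath_curve image_subpath_le reversepath_subpath)

lemma winding_number_arc_split:
  assumes "0 \<le> p" "p \<le> q" "q \<le> r" and z: "z \<notin> \<phi> ` {p..r}"
  shows "winding_number (subpath p q \<phi>) z + winding_number (subpath q r \<phi>) z = winding_number (subpath p r \<phi>) z"
    "winding_number (subpath r q \<phi>) z + winding_number (subpath q p \<phi>) z = winding_number (subpath r p \<phi>) z"
proof -
  have "min p (min q r) = p" "max p (max q r) = r" "min r (min q p) = p" "max r (max q p) = r"
    using assms by auto
  then show "winding_number (subpath p q \<phi>) z + winding_number (subpath q r \<phi>) z = winding_number (subpath p r \<phi>) z"
    "winding_number (subpath r q \<phi>) z + winding_number (subpath q p \<phi>) z = winding_number (subpath r p \<phi>) z"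
    using winding_number_arc_combine[of p q r z] winding_number_arc_combine[of r q p z] assms by auto
qed

text \<open>The cut between \<open>\<phi> m\<close> and \<open>\<phi> n\<close> is traversed once in
  each direction and cancels.\<close>

lemma winding_number_quad_split:
  assumes "0 \<le> p" "p \<le> m" "m \<le> q" "0 \<le> u" "u \<le> n" "n \<le> v"
    and z: "z \<notin> path_image (quad p m u n)" "z \<notin> path_image (quad m q n v)"
  shows "winding_number (quad p q u v) z = winding_number (quad p m u n) z + winding_number (quad m q n v) z"
proof -
  have zz: "z \<notin> \<phi> ` {p..m}" "z \<notin> \<phi> ` {m..q}" "z \<notin> \<phi> ` {u..n}" "z \<notin> \<phi> ` {n..v}"
    "z \<notin> closed_segment (\<phi> q) (\<phi> v)" "z \<notin> closed_segment (\<phi> u) (\<phi> p)" "z \<notin> closed_segment (\<phi> m) (\<phi> n)"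
    using z assms by (auto simp: image_quad)
  have pq: "z \<notin> \<phi> ` {p..q}" using zz(1,2) by force
  have uv: "z \<notin> \<phi> ` {u..v}" using zz(3,4) by force
  have "z \<notin> path_image (quad p q u v)" using assms zz pq uv by (simp add: image_quad)
  then show ?thesis
    using z assms winding_number_arc_split(1)[of p m q z, symmetric] winding_number_arc_split(2)[of u n v z, symmetric]
      winding_number_linepath_swap[of z "\<phi> m" "\<phi> n"] zz pq uv
    by (simp add: winding_number_quad)
qed

text \<open>The common piece from \<open>q\<close> to \<open>u\<close> cancels, which leaves the
  boundary of the strip.\<close>

lemma winding_number_closeup_diff:
  assumes "0 \<le> p" "p \<le> q" "q \<le> u" "u \<le> v"
    and z: "z \<notin> path_image (closeup p u)" "z \<notin> path_image (closeup q v)"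
  shows "winding_number (closeup p u) z - winding_number (closeup q v) z = winding_number (quad p q u v) z"
proof -
  have zz: "z \<notin> \<phi> ` {p..u}" "z \<notin> \<phi> ` {q..v}"
    "z \<notin> closed_segment (\<phi> v) (\<phi> q)" "z \<notin> closed_segment (\<phi> u) (\<phi> p)"
    using z assms by (auto simp: image_closeup)
  have uv: "z \<notin> \<phi> ` {u..v}" "z \<notin> \<phi> ` {p..q}" using zz assms by force+
  have "z \<notin> path_image (quad p q u v)" using assms zz uv by (simp add: image_quad closed_segment_commute)
  then show ?thesis
    using z assms winding_number_arc_split(1)[of p q u z, symmetric] winding_number_arc_split(1)[of q u v z, symmetric] winding_number_linepath_swap[of z "\<phi> v" "\<phi> q"] 
      winding_number_arc_swap[of u v z] zz uv
    by (simp add: winding_number_quad winding_number_closeup)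
qed

lemma simple_quad:
  assumes "0 \<le> p" "p < q" "q < u" "u < v"
    and "closed_segment (\<phi> q) (\<phi> v) \<inter> \<phi> ` {p..q} \<subseteq> {\<phi> q}" "closed_segment (\<phi> q) (\<phi> v) \<inter> \<phi> ` {u..v} \<subseteq> {\<phi> v}"
    and "closed_segment (\<phi> u) (\<phi> p) \<inter> \<phi> ` {p..q} \<subseteq> {\<phi> p}" "closed_segment (\<phi> u) (\<phi> p) \<inter> \<phi> ` {u..v} \<subseteq> {\<phi> u}"
    and "closed_segment (\<phi> q) (\<phi> v) \<inter> closed_segment (\<phi> u) (\<phi> p) = {}"
  shows "simple_path (quad p q u v)"
proof -
  have ne: "\<phi> q \<noteq> \<phi> v" "\<phi> u \<noteq> \<phi> p" using assms eq_iff by auto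
  have d: "\<phi> ` {p..q} \<inter> \<phi> ` {u..v} = {}" using assms eq_iff by auto
  have 1: "arc (subpath v u \<phi> +++ linepath (\<phi> u) (\<phi> p))"
  proof (rule arc_join)
    show "path_image (subpath v u \<phi>) \<inter> path_image (linepath (\<phi> u) (\<phi> p)) \<subseteq> {pathstart (linepath (\<phi> u) (\<phi> p))}"
      using assms(8) \<open>u < v\<close> by (simp add: image_subpath_le Int_commute)
  qed (use assms(1-4) ne in \<open>simp_all add: arc_subpath_curve arc_linepath\<close>)
  have 2: "arc (linepath (\<phi> q) (\<phi> v) +++ subpath v u \<phi> +++ linepath (\<phi> u) (\<phi> p))"
  proof (rule arc_join)
    have "closed_segment (\<phi> q) (\<phi> v) \<inter> (\<phi> ` {u..v} \<union> closed_segment (\<phi> u) (\<phi> p)) \<subseteq> {\<phi> v}"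
      using assms(6,9) by blast
    then show "path_image (linepath (\<phi> q) (\<phi> v)) \<inter> path_image (subpath v u \<phi> +++ linepath (\<phi> u) (\<phi> p))
      \<subseteq> {pathstart (subpath v u \<phi> +++ linepath (\<phi> u) (\<phi> p))}"
      using \<open>u < v\<close> by (simp add: image_subpath_le path_image_join)
  qed (use 1 assms(1-4) ne in \<open>simp_all add: arc_linepath\<close>)
  show ?thesis unfolding quad_def
  proof (rule simple_path_join_loop)
    have "\<phi> ` {p..q} \<inter> (closed_segment (\<phi> q) (\<phi> v) \<union> (\<phi> ` {u..v} \<union> closed_segment (\<phi> u) (\<phi> p))) \<subseteq> {\<phi> p, \<phi> q}"
      using assms(5,7) d by blast
    then show "path_image (subpath p q \<phi>) \<inter> path_image (linepath (\<phi> q) (\<phi> v) +++ subpath v u \<phi> +++ linepath (\<phi> u) (\<phi> p))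
      \<subseteq> {pathstart (subpath p q \<phi>), pathstart (linepath (\<phi> q) (\<phi> v) +++ subpath v u \<phi> +++ linepath (\<phi> u) (\<phi> p))}"
      using \<open>u < v\<close> \<open>p < q\<close> by (simp add: image_subpath_le path_image_join)
  qed (use 2 assms(1-4) in \<open>simp_all add: arc_subpath_curve\<close>)
qed

text \<open>Near \<open>\<phi> q\<close> the left loop does not wind, so at an inner point of the
  whole loop there the right loop contributes all of \<open>c\<close>; near \<open>\<phi> p\<close>
  the roles are exchanged. Thus both halves have the sign \<open>c\<close>.\<close>

lemma winding_number_quad_cut:
  assumes "0 \<le> p" "p \<le> m" "m \<le> q" "0 \<le> u" "u \<le> n" "n \<le> v" "\<rho> > 0"
    and s: "simple_path (quad p q u v)" "simple_path (quad p m u n)" "simple_path (quad m q n v)"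
    and L: "\<And>z. z \<in> ball (\<phi> q) \<rho> \<Longrightarrow> z \<notin> path_image (quad p m u n) \<and> winding_number (quad p m u n) z = 0"
    and R: "\<And>z. z \<in> ball (\<phi> p) \<rho> \<Longrightarrow> z \<notin> path_image (quad m q n v) \<and> winding_number (quad m q n v) z = 0"
  obtains c where "c = 1 \<or> c = (-1::complex)" 
    "\<And>z. z \<notin> path_image (quad p q u v) \<Longrightarrow> winding_number (quad p q u v) z = 0 \<or> winding_number (quad p q u v) z = c"
    "\<And>z. z \<in> closed_segment (\<phi> m) (\<phi> n) \<Longrightarrow> z \<notin> path_image (quad p q u v) \<Longrightarrow> winding_number (quad p q u v) z = c"
proof -
  let ?S = "quad p q u v" and ?L = "quad p m u n" and ?R = "quad m q n v" and ?J = "closed_segment (\<phi> m) (\<phi> n)"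
  have im: "path_image ?S = \<phi> ` {p..q} \<union> closed_segment (\<phi> q) (\<phi> v) \<union> \<phi> ` {u..v} \<union> closed_segment (\<phi> u) (\<phi> p)"
    "path_image ?L = \<phi> ` {p..m} \<union> ?J \<union> \<phi> ` {u..n} \<union> closed_segment (\<phi> u) (\<phi> p)"
    "path_image ?R = \<phi> ` {m..q} \<union> closed_segment (\<phi> q) (\<phi> v) \<union> \<phi> ` {n..v} \<union> ?J"
    using assms image_quad[of p q u v] image_quad[of p m u n] image_quad[of m q n v] 
      closed_segment_commute[of "\<phi> n" "\<phi> m"] by simp_all
  have pq: "\<phi> ` {p..q} = \<phi> ` {p..m} \<union> \<phi> ` {m..q}" 
    using assms by (metis image_Un ivl_disj_un_two_touch(4))
  have uv: "\<phi> ` {u..v} = \<phi> ` {u..n} \<union> \<phi> ` {n..v}" 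
    using assms by (metis image_Un ivl_disj_un_two_touch(4))
  have LR: "path_image ?L \<union> path_image ?R = path_image ?S \<union> ?J"
    unfolding im pq uv by blast
  have JLR: "?J \<subseteq> path_image ?L" "?J \<subseteq> path_image ?R" unfolding im by blast+
  have qp: "\<phi> q \<in> path_image ?S" "\<phi> p \<in> path_image ?S" using im assms by auto
  obtain c where c: "c = 1 \<or> c = (-1::complex)" 
    "\<forall>z. z \<notin> path_image ?S \<longrightarrow> winding_number ?S z = 0 \<or> winding_number ?S z = c"
    "\<forall>z\<in>path_image ?S. \<forall>e>0. \<exists>w\<in>ball z e. w \<notin> path_image ?S \<and> winding_number ?S w = c"
    using simple_closed_winding_number[OF s(1)] unfolding ends_quad by blast
  obtain cL where cL: "cL = 1 \<or> cL = (-1::complex)" 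
    "\<forall>z. z \<notin> path_image ?L \<longrightarrow> winding_number ?L z = 0 \<or> winding_number ?L z = cL"
    "\<forall>z\<in>path_image ?L. \<forall>e>0. \<exists>w\<in>ball z e. w \<notin> path_image ?L \<and> winding_number ?L w = cL"
    using simple_closed_winding_number[OF s(2)] unfolding ends_quad by blast
  obtain cR where cR: "cR = 1 \<or> cR = (-1::complex)" 
    "\<forall>z. z \<notin> path_image ?R \<longrightarrow> winding_number ?R z = 0 \<or> winding_number ?R z = cR"
    using simple_closed_winding_number[OF s(3)] unfolding ends_quad by blast
  have sum: "winding_number ?S z = winding_number ?L z + winding_number ?R z" 
    if "z \<notin> path_image ?L" "z \<notin> path_image ?R" for z
    using winding_number_quad_split assms that by blast
  have "cR = c"
  proof -
    obtain w where w: "w \<in> ball (\<phi> q) \<rho>" "w \<notin> path_image ?S" "winding_number ?S w = c"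
      using c(3) qp(1) \<open>\<rho> > 0\<close> by blast
    then have "w \<notin> path_image ?L" "w \<notin> path_image ?R" using L LR JLR by blast+
    then show ?thesis using sum[of w] w L[OF w(1)] cR(2)[rule_format, of w] c(1) by auto
  qed
  have "cL = c"
  proof -
    obtain w where w: "w \<in> ball (\<phi> p) \<rho>" "w \<notin> path_image ?S" "winding_number ?S w = c"
      using c(3) qp(2) \<open>\<rho> > 0\<close> by blast
    then have "w \<notin> path_image ?L" "w \<notin> path_image ?R" using R LR JLR by blast+
    then show ?thesis using sum[of w] w R[OF w(1)] cL(2)[rule_format, of w] c(1) by auto
  qed
  show ?thesis
  proof (rule that[OF c(1) c(2)[rule_format]])
    fix z assume z: "z \<in> ?J" "z \<notin> path_image ?S"
    have pS: "path ?S" using s simple_path_imp_path by blast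
    then have "closed (path_image ?S)" by (simp add: closed_path_image)
    then have "open (- path_image ?S)" by (simp add: open_Compl)
    then obtain d where "d > 0" "ball z d \<subseteq> - path_image ?S"
      using z by (metis ComplI open_contains_ball)
    then have d: "d > 0" "ball z d \<inter> path_image ?S = {}" by blast+
    \<comment> \<open>\<open>w\<close> is inside the left loop, next to \<open>z\<close>. The right
      loop adds 0 or \<open>c\<close>, so the whole loop has \<open>c\<close> or
      \<open>2 * c\<close> there, and only \<open>c\<close> is one of its values.\<close>
    obtain w where w: "w \<in> ball z d" "w \<notin> path_image ?L" "winding_number ?L w = cL"
      using cL(3) z JLR d by blast
    then have "w \<notin> path_image ?R" using d LR JLR by blast
    moreover have "w \<notin> path_image ?S" using d w by blast
    ultimately have "winding_number ?S w = c" using sum[of w] w c(1) c(2)[rule_format, of w] cR(2)[rule_format, of w] d \<open>cL = c\<close> \<open>cR = c\<close> by auto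
    moreover have "winding_number ?S z = winding_number ?S w"
      using winding_number_eq[OF pS, of z "ball z d" w] d w by auto
    ultimately show "winding_number ?S z = c" by simp
  qed auto
qed

end

section \<open>Passes along an arc of an injective curve\<close>

context inj_curve begin

text \<open>The part of the arc outside the times \<open>{c..d}\<close> lies within
  \<open>r / 2\<close> of \<open>\<phi> e\<close>. A curve that is close to the arc but avoids the
  \<open>r\<close>-ball about \<open>\<phi> e\<close> is therefore close to the piece over
  \<open>{c..d}\<close> alone, which omits \<open>\<phi> e\<close>, and
  \<open>winding_number_thin\<close> applies to that piece.\<close>

lemma winding_number_thin_away:
  assumes "0 \<le> a" "a \<le> c" "c \<le> d" "d \<le> b" and e: "0 \<le> e" "e \<notin> {c..d}" and "r > 0"
    and near: "\<And>t. t \<in> {a..b} \<Longrightarrow> t \<notin> {c..d} \<Longrightarrow> dist (\<phi> t) (\<phi> e) < r / 2"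
  obtains \<rho> \<eta> where "\<rho> > 0" "\<eta> > 0"
    "\<And>\<gamma> z. \<lbrakk>path \<gamma>; pathfinish \<gamma> = pathstart \<gamma>; \<And>w. w \<in> path_image \<gamma> \<Longrightarrow> infdist w (\<phi> ` {a..b}) < \<eta>;
       path_image \<gamma> \<inter> ball (\<phi> e) r = {}; z \<in> ball (\<phi> e) \<rho>\<rbrakk> \<Longrightarrow> z \<notin> path_image \<gamma> \<and> winding_number \<gamma> z = 0"
proof -
  define A where "A = \<phi> ` {c..d}"
  have A: "compact A" "A \<noteq> {}" "connected (- A)"
    unfolding A_def using assms compact_arc connected_arc_compl by auto
  have "\<phi> e \<notin> A" unfolding A_def using eq_iff e assms by auto
  then have pos: "infdist (\<phi> e) A > 0"
    using A infdist_pos_not_in_closed[of A "\<phi> e"] compact_imp_closed by blast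
  obtain \<eta> where \<eta>: "\<eta> > 0" 
    "\<And>\<gamma> z. \<lbrakk>path \<gamma>; pathfinish \<gamma> = pathstart \<gamma>; \<And>w. w \<in> path_image \<gamma> \<Longrightarrow> infdist w A < \<eta>; infdist z A \<ge> infdist (\<phi> e) A / 2\<rbrakk>
       \<Longrightarrow> z \<notin> path_image \<gamma> \<and> winding_number \<gamma> z = 0"
    using winding_number_thin[OF A, of "infdist (\<phi> e) A / 2"] pos by (metis half_gt_zero)
  show ?thesis
  proof (rule that[of "infdist (\<phi> e) A / 2" "min \<eta> (r/2)"])
    show "infdist (\<phi> e) A / 2 > 0" "min \<eta> (r/2) > 0" using pos \<eta> \<open>r > 0\<close> by auto
    fix \<gamma> z assume g: "path \<gamma>" "pathfinish \<gamma> = pathstart \<gamma>" "\<And>w. w \<in> path_image \<gamma> \<Longrightarrow> infdist w (\<phi> ` {a..b}) < min \<eta> (r/2)"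
       "path_image \<gamma> \<inter> ball (\<phi> e) r = {}" and z: "z \<in> ball (\<phi> e) (infdist (\<phi> e) A / 2)"
    have "infdist w A < \<eta>" if w: "w \<in> path_image \<gamma>" for w
    proof -
      have "closed (\<phi> ` {a..b})" "\<phi> ` {a..b} \<noteq> {}" using assms compact_arc compact_imp_closed by auto
      then obtain t where t: "t \<in> {a..b}" "infdist w (\<phi> ` {a..b}) = dist w (\<phi> t)"
        using infdist_attains_inf by blast
      then have lt: "dist w (\<phi> t) < \<eta>" "dist w (\<phi> t) < r / 2" using g(3)[OF w] by auto
      have "t \<in> {c..d}"
      proof (rule ccontr)
        assume "t \<notin> {c..d}"
        then have "dist (\<phi> t) (\<phi> e) < r / 2" using near t by blast
        then have "dist (\<phi> e) w < r" using lt(2) dist_triangle[of "\<phi> e" w "\<phi> t"] by (simp add: dist_commute)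
        then show False using g(4) w by auto
      qed
      then have "infdist w A \<le> dist w (\<phi> t)" unfolding A_def by (intro infdist_le) auto
      then show ?thesis using lt by simp
    qed
    moreover have "infdist z A \<ge> infdist (\<phi> e) A / 2"
      using infdist_triangle[of "\<phi> e" A z] z by simp
    ultimately show "z \<notin> path_image \<gamma> \<and> winding_number \<gamma> z = 0" using \<eta>(2) g by blast
  qed
qed

lemma continuity_at:
  assumes "0 \<le> e" "r > 0"
  obtains \<delta> where "\<delta> > 0" "\<And>t. 0 \<le> t \<Longrightarrow> \<bar>t - e\<bar> < \<delta> \<Longrightarrow> dist (\<phi> t) (\<phi> e) < r"
proof -
  have "\<exists>d>0. \<forall>t\<in>{0..}. dist t e < d \<longrightarrow> dist (\<phi> t) (\<phi> e) < r"
    using cont assms unfolding continuous_on_iff by simp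
  then show ?thesis using that by (auto simp: dist_real_def)
qed

end

text \<open>The situation to be refuted: no piece of the curve close to the arc between the times \<open>a\<close> and \<open>b\<close>
  runs from the end to the start, or between the middle and one end, against the direction of the arc.\<close>

locale no_back = inj_curve +
  fixes a s b \<eta>0 :: real
  assumes ord: "0 < a" "a < s" "s < b" and eta0: "\<eta>0 > 0"
    and nb: "\<And>x y u v. \<lbrakk>(x, y) \<in> {(a, b), (a, s), (s, b)}; 0 \<le> u; u \<le> v; 
      \<And>t. t \<in> {u..v} \<Longrightarrow> infdist (\<phi> t) (\<phi> ` {a..b}) < \<eta>0; dist (\<phi> u) (\<phi> y) < \<eta>0; dist (\<phi> v) (\<phi> x) < \<eta>0\<rbrakk> \<Longrightarrow> False"

text \<open>The radius \<open>r\<close> separates the three marked points, while a closed curve in the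
  \<open>\<eta>1\<close>-neighbourhood of the arc that avoids the \<open>r\<close>-ball about an end cannot wind around that end.\<close>

locale no_back_scales = no_back +
  fixes r \<rho> \<eta>1 :: real
  assumes r: "0 < r" "r \<le> \<eta>0" and eta1: "0 < \<eta>1" "\<eta>1 \<le> r" "\<eta>1 \<le> \<rho>"
    and sep: "r + \<eta>1 \<le> dist (\<phi> a) (\<phi> b)" "r + \<eta>1 \<le> dist (\<phi> a) (\<phi> s)" "r + \<eta>1 \<le> dist (\<phi> s) (\<phi> b)"
    and sep0: "\<And>t. 0 \<le> t \<Longrightarrow> t \<le> a \<Longrightarrow> \<eta>1 \<le> dist (\<phi> t) (\<phi> s)" "\<And>t. 0 \<le> t \<Longrightarrow> t \<le> a \<Longrightarrow> \<eta>1 \<le> dist (\<phi> t) (\<phi> b)"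
    and thin: "\<And>\<gamma> e z. \<lbrakk>e = a \<or> e = b; path \<gamma>; pathfinish \<gamma> = pathstart \<gamma>; \<And>w. w \<in> path_image \<gamma> \<Longrightarrow> infdist w (\<phi> ` {a..b}) < \<eta>1;
       path_image \<gamma> \<inter> ball (\<phi> e) r = {}; z \<in> ball (\<phi> e) \<rho>\<rbrakk> \<Longrightarrow> z \<notin> path_image \<gamma> \<and> winding_number \<gamma> z = 0"

lemma (in no_back) scales_exist: "\<exists>r \<rho> \<eta>1. no_back_scales \<phi> a s b \<eta>0 r \<rho> \<eta>1"
proof -
  have ne: "\<phi> a \<noteq> \<phi> b" "\<phi> a \<noteq> \<phi> s" "\<phi> s \<noteq> \<phi> b" using eq_iff ord by auto
  \<comment> \<open>Half of each mutual distance: then \<open>\<eta>1 \<le> r\<close> already gives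
    the separation by \<open>r + \<eta>1\<close>.\<close>
  define r where "r = Min {\<eta>0, dist (\<phi> a) (\<phi> b) / 2, dist (\<phi> a) (\<phi> s) / 2, dist (\<phi> s) (\<phi> b) / 2}"
  have r: "r > 0" "r \<le> \<eta>0" "r \<le> dist (\<phi> a) (\<phi> b) / 2" "r \<le> dist (\<phi> a) (\<phi> s) / 2" "r \<le> dist (\<phi> s) (\<phi> b) / 2"
    unfolding r_def using ne eta0 by auto
  have "\<phi> s \<notin> \<phi> ` {0..a}" "\<phi> b \<notin> \<phi> ` {0..a}" using ord eq_iff by auto
  moreover have cl: "closed (\<phi> ` {0..a})" "\<phi> ` {0..a} \<noteq> {}" using ord compact_arc compact_imp_closed by auto
  ultimately have pos: "infdist (\<phi> s) (\<phi> ` {0..a}) > 0" "infdist (\<phi> b) (\<phi> ` {0..a}) > 0"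
    using infdist_pos_not_in_closed by blast+
  have le: "infdist (\<phi> e) (\<phi> ` {0..a}) \<le> dist (\<phi> t) (\<phi> e)" if "0 \<le> t" "t \<le> a" for t e
    using that infdist_le[of "\<phi> t" "\<phi> ` {0..a}" "\<phi> e"] by (auto simp: dist_commute)
  obtain db where db: "db > 0" "\<And>t. 0 \<le> t \<Longrightarrow> \<bar>t - b\<bar> < db \<Longrightarrow> dist (\<phi> t) (\<phi> b) < r / 2"
    using continuity_at[of b "r/2"] ord r by auto
  obtain da where da: "da > 0" "\<And>t. 0 \<le> t \<Longrightarrow> \<bar>t - a\<bar> < da \<Longrightarrow> dist (\<phi> t) (\<phi> a) < r / 2"
    using continuity_at[of a "r/2"] ord r by auto
  \<comment> \<open>The arc is trimmed at each end by at most half of the continuity radius: the end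
    itself is cut off, and the removed part stays within \<open>r / 2\<close> of it.\<close>
  define d where "d = max a (b - db / 2)"
  define c where "c = min b (a + da / 2)"
  obtain \<rho>1 h1 where 1: "\<rho>1 > 0" "h1 > 0"
    "\<And>\<gamma> z. \<lbrakk>path \<gamma>; pathfinish \<gamma> = pathstart \<gamma>; \<And>w. w \<in> path_image \<gamma> \<Longrightarrow> infdist w (\<phi> ` {a..b}) < h1;
       path_image \<gamma> \<inter> ball (\<phi> b) r = {}; z \<in> ball (\<phi> b) \<rho>1\<rbrakk> \<Longrightarrow> z \<notin> path_image \<gamma> \<and> winding_number \<gamma> z = 0"
  proof (rule winding_number_thin_away[of a a d b b r])
    show "dist (\<phi> t) (\<phi> b) < r / 2" if "t \<in> {a..b}" "t \<notin> {a..d}" for t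
      using that db ord unfolding d_def by (intro db) auto
  qed (use ord r db in \<open>auto simp: d_def\<close>)
  obtain \<rho>2 h2 where 2: "\<rho>2 > 0" "h2 > 0"
    "\<And>\<gamma> z. \<lbrakk>path \<gamma>; pathfinish \<gamma> = pathstart \<gamma>; \<And>w. w \<in> path_image \<gamma> \<Longrightarrow> infdist w (\<phi> ` {a..b}) < h2;
       path_image \<gamma> \<inter> ball (\<phi> a) r = {}; z \<in> ball (\<phi> a) \<rho>2\<rbrakk> \<Longrightarrow> z \<notin> path_image \<gamma> \<and> winding_number \<gamma> z = 0"
  proof (rule winding_number_thin_away[of a c b b a r])
    show "dist (\<phi> t) (\<phi> a) < r / 2" if "t \<in> {a..b}" "t \<notin> {c..b}" for t
      using that da ord unfolding c_def by (intro da) auto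
  qed (use ord r da in \<open>auto simp: c_def\<close>)
  define S where "S = {r, \<rho>1, \<rho>2, h1, h2, infdist (\<phi> s) (\<phi> ` {0..a}), infdist (\<phi> b) (\<phi> ` {0..a})}"
  have S: "finite S" "S \<noteq> {}" "\<forall>x\<in>S. x > 0" unfolding S_def using r(1) 1(1,2) 2(1,2) pos by auto
  define \<eta>1 where "\<eta>1 = Min S"
  have "\<eta>1 > 0" unfolding \<eta>1_def using S Min_in by blast
  moreover have "\<eta>1 \<le> x" if "x \<in> S" for x unfolding \<eta>1_def using S that by simp
  ultimately have h: "\<eta>1 > 0" "\<eta>1 \<le> r" "\<eta>1 \<le> \<rho>1" "\<eta>1 \<le> \<rho>2" "\<eta>1 \<le> h1" "\<eta>1 \<le> h2"
    "\<eta>1 \<le> infdist (\<phi> s) (\<phi> ` {0..a})" "\<eta>1 \<le> infdist (\<phi> b) (\<phi> ` {0..a})"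
    unfolding S_def by blast+
  have "no_back_scales \<phi> a s b \<eta>0 r (min \<rho>1 \<rho>2) \<eta>1"
  proof (unfold_locales)
    show "z \<notin> path_image \<gamma> \<and> winding_number \<gamma> z = 0"
      if *: "e = a \<or> e = b" "path \<gamma>" "pathfinish \<gamma> = pathstart \<gamma>" "\<And>w. w \<in> path_image \<gamma> \<Longrightarrow> infdist w (\<phi> ` {a..b}) < \<eta>1"
       "path_image \<gamma> \<inter> ball (\<phi> e) r = {}" "z \<in> ball (\<phi> e) (min \<rho>1 \<rho>2)" for \<gamma> e z
    proof (cases "e = b")
      case True
      have "infdist w (\<phi> ` {a..b}) < h1" if "w \<in> path_image \<gamma>" for w using *(4)[OF that] h by linarith
      then show ?thesis using 1(3)[of \<gamma> z] * True by auto
    next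
      case False
      then have "e = a" using * by auto
      have "infdist w (\<phi> ` {a..b}) < h2" if "w \<in> path_image \<gamma>" for w using *(4)[OF that] h by linarith
      then show ?thesis using 2(3)[of \<gamma> z] * \<open>e = a\<close> by auto
    qed
    show "r + \<eta>1 \<le> dist (\<phi> a) (\<phi> b)" "r + \<eta>1 \<le> dist (\<phi> a) (\<phi> s)" "r + \<eta>1 \<le> dist (\<phi> s) (\<phi> b)"
      using r h by linarith+
    show "\<eta>1 \<le> dist (\<phi> t) (\<phi> s)" if "0 \<le> t" "t \<le> a" for t using le[OF that, of s] h by linarith
    show "\<eta>1 \<le> dist (\<phi> t) (\<phi> b)" if "0 \<le> t" "t \<le> a" for t using le[OF that, of b] h by linarith
  qed (use r h in auto)
  then show ?thesis by blast
qed

section \<open>Passes parallel to the arc and the strips they bound\<close>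

context no_back_scales begin

text \<open>A later return along the arc in the direction of the arc. By injectivity,
  \<open>b < u\<close> makes it disjoint from the arc.\<close>

definition pass :: "real \<Rightarrow> real \<Rightarrow> real \<Rightarrow> bool" where
  "pass \<eta> u v \<longleftrightarrow> b < u \<and> u \<le> v \<and> (\<forall>t\<in>{u..v}. infdist (\<phi> t) (\<phi> ` {a..b}) < \<eta>) \<and>
     dist (\<phi> u) (\<phi> a) < \<eta> \<and> dist (\<phi> v) (\<phi> b) < \<eta>"

text \<open>A short chord near \<open>z\<close> that meets the arc and the pass in its end points
  only, as the chords of a simple \<open>quad\<close> must.\<close>

definition gate :: "real \<Rightarrow> real \<Rightarrow> real \<Rightarrow> complex \<Rightarrow> real \<Rightarrow> real \<Rightarrow> bool" where
  "gate \<eta> u v z a0 u0 \<longleftrightarrow> a \<le> a0 \<and> a0 \<le> b \<and> u \<le> u0 \<and> u0 \<le> v \<and> closed_segment (\<phi> a0) (\<phi> u0) \<subseteq> ball z \<eta> \<and>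
     closed_segment (\<phi> a0) (\<phi> u0) \<inter> \<phi> ` {a..b} = {\<phi> a0} \<and> closed_segment (\<phi> a0) (\<phi> u0) \<inter> \<phi> ` {u..v} = {\<phi> u0}"

lemma gate_exists:
  assumes "b < u" "u \<le> v" "p \<in> {a..b}" "q \<in> {u..v}" "dist (\<phi> p) z < \<eta>" "dist (\<phi> q) z < \<eta>"
  shows "\<exists>a0 u0. gate \<eta> u v z a0 u0 \<and> closed_segment (\<phi> a0) (\<phi> u0) \<subseteq> closed_segment (\<phi> p) (\<phi> q)"
proof -
  have "\<phi> ` {a..b} \<inter> \<phi> ` {u..v} = {}" using assms eq_iff ord by auto
  moreover have "compact (\<phi> ` {a..b})" "compact (\<phi> ` {u..v})" "\<phi> p \<in> \<phi> ` {a..b}" "\<phi> q \<in> \<phi> ` {u..v}"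
    using assms ord by (auto intro!: compact_arc)
  ultimately obtain x y where xy: "x \<in> \<phi> ` {a..b}" "y \<in> \<phi> ` {u..v}" "closed_segment x y \<subseteq> closed_segment (\<phi> p) (\<phi> q)"
    "closed_segment x y \<inter> \<phi> ` {a..b} = {x}" "closed_segment x y \<inter> \<phi> ` {u..v} = {y}"
    using segment_bridge[of "\<phi> ` {a..b}" "\<phi> ` {u..v}" "\<phi> p" "\<phi> q"] by blast
  moreover have "closed_segment (\<phi> p) (\<phi> q) \<subseteq> ball z \<eta>"
    using assms by (intro closed_segment_subset) (auto simp: dist_commute)
  ultimately have sub: "closed_segment x y \<subseteq> ball z \<eta>" by blast
  obtain a0 u0 where "x = \<phi> a0" "y = \<phi> u0" "a0 \<in> {a..b}" "u0 \<in> {u..v}" using xy by blast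
  then show ?thesis unfolding gate_def using xy sub by (intro exI[of _ a0] exI[of _ u0]) simp
qed

lemma infdist_arc_zero: "t \<in> {a..b} \<Longrightarrow> infdist (\<phi> t) (\<phi> ` {a..b}) = 0"
  by (simp add: infdist_zero)

lemma infdist_arc_ball: "e \<in> {a..b} \<Longrightarrow> w \<in> ball (\<phi> e) \<eta> \<Longrightarrow> infdist w (\<phi> ` {a..b}) < \<eta>"
  using infdist_le[of "\<phi> e" "\<phi> ` {a..b}" w] by (auto simp: dist_commute)

lemma balls_disjoint: "\<eta> \<le> \<eta>1 \<Longrightarrow> x \<noteq> y \<Longrightarrow> x \<in> {a, s, b} \<Longrightarrow> y \<in> {a, s, b} \<Longrightarrow> ball (\<phi> x) \<eta> \<inter> ball (\<phi> y) r = {}"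
  using sep dist_triangle_less_add by (fastforce simp: dist_commute disjoint_iff)

text \<open>The chord at the middle cuts the strip into two loops, neither of which winds around the far end
  of the strip. This forces both of them to have the orientation of the strip, hence the chord to lie inside it.\<close>

lemma strip:
  assumes \<eta>: "0 < \<eta>" "\<eta> \<le> \<eta>1" and P: "pass \<eta> u v" and J: "gate \<eta> u v (\<phi> s) \<sigma> s'"
  obtains a0 b0 u0 v0 c where "gate \<eta> u v (\<phi> a) a0 u0" "gate \<eta> u v (\<phi> b) b0 v0"
    "a0 < \<sigma>" "\<sigma> < b0" "u0 < s'" "s' < v0" "c = 1 \<or> c = (-1::complex)"
    "\<And>w. w \<in> path_image (quad a0 b0 u0 v0) \<Longrightarrow> infdist w (\<phi> ` {a..b}) < \<eta>"
    "\<And>z. z \<notin> path_image (quad a0 b0 u0 v0) \<Longrightarrow> winding_number (quad a0 b0 u0 v0) z = 0 \<or> winding_number (quad a0 b0 u0 v0) z = c"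
    "\<And>z. z \<in> closed_segment (\<phi> \<sigma>) (\<phi> s') \<Longrightarrow> z \<noteq> \<phi> \<sigma> \<Longrightarrow> z \<noteq> \<phi> s' \<Longrightarrow> 
       z \<notin> path_image (quad a0 b0 u0 v0) \<and> winding_number (quad a0 b0 u0 v0) z = c"
proof -
  note P = P[unfolded pass_def]
  have sm: "\<eta> \<le> \<eta>0" "\<eta> \<le> r" "\<eta> \<le> \<rho>" using \<eta> r eta1 by auto
  obtain a0 u0 where l: "gate \<eta> u v (\<phi> a) a0 u0"
    using gate_exists[of u v a u "\<phi> a" \<eta>] P \<eta> ord by auto
  obtain b0 v0 where rt: "gate \<eta> u v (\<phi> b) b0 v0"
    using gate_exists[of u v b v "\<phi> b" \<eta>] P \<eta> ord by auto
  note L = l[unfolded gate_def] and R = rt[unfolded gate_def] and J' = J[unfolded gate_def]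
  have dl: "dist (\<phi> a0) (\<phi> a) < \<eta>" "dist (\<phi> u0) (\<phi> a) < \<eta>" 
    and dr: "dist (\<phi> b0) (\<phi> b) < \<eta>" "dist (\<phi> v0) (\<phi> b) < \<eta>" 
    and dj: "dist (\<phi> \<sigma>) (\<phi> s) < \<eta>" "dist (\<phi> s') (\<phi> s) < \<eta>" 
    using L R J' ends_in_segment by (metis dist_commute mem_ball subsetD)+
  have nA: "infdist (\<phi> t) (\<phi> ` {a..b}) < \<eta>0" if "t \<in> {a..b}" for t using infdist_arc_zero[OF that] eta0 by simp
  have nP: "infdist (\<phi> t) (\<phi> ` {a..b}) < \<eta>0" if "t \<in> {u..v}" for t using P that sm by fastforce
  \<comment> \<open>The four order relations have one reason: in the opposite order the arc or the
    pass would itself contain a forbidden piece, from \<open>s\<close> to \<open>a\<close> or from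
    \<open>b\<close> to \<open>s\<close>.\<close>
  have o1: "a0 < \<sigma>"
  proof (rule ccontr)
    assume "\<not> a0 < \<sigma>"
    then show False using nb[of a s \<sigma> a0] dl dj sm L J' nA ord by force
  qed
  have o2: "\<sigma> < b0"
  proof (rule ccontr)
    assume "\<not> \<sigma> < b0"
    then show False using nb[of s b b0 \<sigma>] dr dj sm R J' nA ord by force
  qed
  have o3: "u0 < s'"
  proof (rule ccontr)
    assume "\<not> u0 < s'"
    then show False using nb[of a s s' u0] dl dj sm L J' nP ord P by force
  qed
  have o4: "s' < v0"
  proof (rule ccontr)
    assume "\<not> s' < v0"
    then show False using nb[of s b v0 s'] dr dj sm R J' nP ord P by force
  qed
  define El where "El = closed_segment (\<phi> u0) (\<phi> a0)"
  define Er where "Er = closed_segment (\<phi> b0) (\<phi> v0)"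
  define JJ where "JJ = closed_segment (\<phi> \<sigma>) (\<phi> s')"
  have bl: "El \<subseteq> ball (\<phi> a) \<eta>" "Er \<subseteq> ball (\<phi> b) \<eta>" "JJ \<subseteq> ball (\<phi> s) \<eta>"
    using L R J' unfolding El_def Er_def JJ_def by (simp_all add: closed_segment_commute)
  have br: "ball (\<phi> a) \<eta> \<inter> ball (\<phi> b) r = {}" "ball (\<phi> s) \<eta> \<inter> ball (\<phi> b) r = {}"
    "ball (\<phi> s) \<eta> \<inter> ball (\<phi> a) r = {}" "ball (\<phi> b) \<eta> \<inter> ball (\<phi> a) r = {}"
    using balls_disjoint \<eta> ord by auto
  have sub: "ball x \<eta> \<subseteq> ball x r" for x :: complex using sm by auto
  have dis: "El \<inter> Er = {}" "JJ \<inter> El = {}" "Er \<inter> JJ = {}" "Er \<inter> El = {}"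
    using bl br sub[of "\<phi> a"] sub[of "\<phi> b"] by blast+
  have iab: "\<phi> ` {a0..b0} \<subseteq> \<phi> ` {a..b}" "\<phi> ` {a0..\<sigma>} \<subseteq> \<phi> ` {a..b}" "\<phi> ` {\<sigma>..b0} \<subseteq> \<phi> ` {a..b}"
    using L R J' by (intro image_mono; simp)+
  have iuv: "\<phi> ` {u0..v0} \<subseteq> \<phi> ` {u..v}" "\<phi> ` {u0..s'} \<subseteq> \<phi> ` {u..v}" "\<phi> ` {s'..v0} \<subseteq> \<phi> ` {u..v}"
    using L R J' by (intro image_mono; simp)+
  have seg: "El \<inter> \<phi> ` {a..b} = {\<phi> a0}" "El \<inter> \<phi> ` {u..v} = {\<phi> u0}"
    "Er \<inter> \<phi> ` {a..b} = {\<phi> b0}" "Er \<inter> \<phi> ` {u..v} = {\<phi> v0}"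
    "JJ \<inter> \<phi> ` {a..b} = {\<phi> \<sigma>}" "JJ \<inter> \<phi> ` {u..v} = {\<phi> s'}"
    using L R J' unfolding El_def Er_def JJ_def by (simp_all add: closed_segment_commute)
  have os: "0 \<le> a0" "0 \<le> \<sigma>" "\<sigma> < u0" "b0 < u0" "0 \<le> u0" "\<sigma> < s'" "b0 < s'" "0 \<le> s'" using L R J' P ord by auto
  have mono: "A \<inter> C \<subseteq> D" if "A \<inter> B = D" "C \<subseteq> B" for A B C D :: "complex set"
    using that by blast
  note X = mono[OF seg(3) iab(1)]
    mono[OF seg(3) iab(3)]
    mono[OF seg(4) iuv(1)]
    mono[OF seg(4) iuv(3)]
    mono[OF seg(1) iab(1)]
    mono[OF seg(1) iab(2)]
    mono[OF seg(2) iuv(1)]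
    mono[OF seg(2) iuv(2)]
    mono[OF seg(5) iab(2)]
    mono[OF seg(5) iab(3)]
    mono[OF seg(6) iuv(2)]
    mono[OF seg(6) iuv(3)]
  have JJ': "JJ = closed_segment (\<phi> s') (\<phi> \<sigma>)" unfolding JJ_def by (rule closed_segment_commute)
  have sS: "simple_path (quad a0 b0 u0 v0)"
    using o1 o2 o3 o4 by (intro simple_quad os X[unfolded El_def Er_def] dis[unfolded El_def Er_def]) linarith+
  have sL: "simple_path (quad a0 \<sigma> u0 s')"
    using o1 o2 o3 o4 by (intro simple_quad os X[unfolded El_def JJ_def] dis[unfolded El_def JJ_def]) linarith+
  have sR: "simple_path (quad \<sigma> b0 s' v0)"
    using o1 o2 o3 o4 by (intro simple_quad os X[unfolded Er_def JJ'] dis[unfolded Er_def JJ']) linarith+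
  have imS: "path_image (quad a0 b0 u0 v0) = \<phi> ` {a0..b0} \<union> Er \<union> \<phi> ` {u0..v0} \<union> El"
    using image_quad[of a0 b0 u0 v0] o1 o2 o3 o4 unfolding El_def Er_def by simp
  have imL: "path_image (quad a0 \<sigma> u0 s') = \<phi> ` {a0..\<sigma>} \<union> JJ \<union> \<phi> ` {u0..s'} \<union> El"
    using image_quad[of a0 \<sigma> u0 s'] o1 o2 o3 o4 unfolding El_def JJ_def by simp
  have imR: "path_image (quad \<sigma> b0 s' v0) = \<phi> ` {\<sigma>..b0} \<union> Er \<union> \<phi> ` {s'..v0} \<union> JJ"
    using image_quad[of \<sigma> b0 s' v0] o1 o2 o3 o4 closed_segment_commute[of "\<phi> s'" "\<phi> \<sigma>"] unfolding Er_def JJ_def by simp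
  have th: "infdist w (\<phi> ` {a..b}) < \<eta>" if "w \<in> \<phi> ` {a..b} \<union> Er \<union> JJ \<union> \<phi> ` {u..v} \<union> El" for w
    using that infdist_arc_zero P \<eta> infdist_arc_ball[of a w \<eta>] infdist_arc_ball[of b w \<eta>] infdist_arc_ball[of s w \<eta>] bl ord by fastforce
  have thS: "infdist w (\<phi> ` {a..b}) < \<eta>" if "w \<in> path_image (quad a0 b0 u0 v0)" for w
  proof -
    have "w \<in> \<phi> ` {a..b} \<union> Er \<union> JJ \<union> \<phi> ` {u..v} \<union> El" using that iab(1) iuv(1) unfolding imS Un_iff by (meson subsetD)
    then show ?thesis using th[of w] by blast
  qed
  have thL: "infdist w (\<phi> ` {a..b}) < \<eta>1" if "w \<in> path_image (quad a0 \<sigma> u0 s')" for w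
  proof -
    have "w \<in> \<phi> ` {a..b} \<union> Er \<union> JJ \<union> \<phi> ` {u..v} \<union> El" using that iab(2) iuv(2) unfolding imL Un_iff by (meson subsetD)
    then show ?thesis using th[of w] \<eta> by linarith
  qed
  have thR: "infdist w (\<phi> ` {a..b}) < \<eta>1" if "w \<in> path_image (quad \<sigma> b0 s' v0)" for w
  proof -
    have "w \<in> \<phi> ` {a..b} \<union> Er \<union> JJ \<union> \<phi> ` {u..v} \<union> El" using that iab(3) iuv(3) unfolding imR Un_iff by (meson subsetD)
    then show ?thesis using th[of w] \<eta> by linarith
  qed
  \<comment> \<open>The left half does not come near \<open>\<phi> b\<close> before its middle,
    since going on from there to the middle would be a backward piece. For the right half and
    \<open>\<phi> a\<close> the argument is symmetric.\<close>
  have avA: "\<phi> t \<notin> ball (\<phi> b) r" if "t \<in> {a0..\<sigma>}" for t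
  proof
    assume "\<phi> t \<in> ball (\<phi> b) r"
    then have "dist (\<phi> t) (\<phi> b) < \<eta>0" using r by (simp add: dist_commute)
    then show False using nb[of s b t \<sigma>] that dj sm nA L J' ord by force
  qed
  have avB: "\<phi> t \<notin> ball (\<phi> b) r" if "t \<in> {u0..s'}" for t
  proof
    assume "\<phi> t \<in> ball (\<phi> b) r"
    then have "dist (\<phi> t) (\<phi> b) < \<eta>0" using r by (simp add: dist_commute)
    then show False using nb[of s b t s'] that dj sm nP L J' ord P by force
  qed
  have avC: "\<phi> t \<notin> ball (\<phi> a) r" if "t \<in> {\<sigma>..b0}" for t
  proof
    assume "\<phi> t \<in> ball (\<phi> a) r"
    then have "dist (\<phi> t) (\<phi> a) < \<eta>0" using r by (simp add: dist_commute)
    then show False using nb[of a s \<sigma> t] that dj sm nA R J' ord by force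
  qed
  have avD: "\<phi> t \<notin> ball (\<phi> a) r" if "t \<in> {s'..v0}" for t
  proof
    assume "\<phi> t \<in> ball (\<phi> a) r"
    then have "dist (\<phi> t) (\<phi> a) < \<eta>0" using r by (simp add: dist_commute)
    then show False using nb[of a s s' t] that dj sm nP R J' ord P by force
  qed
  have avL: "path_image (quad a0 \<sigma> u0 s') \<inter> ball (\<phi> b) r = {}"
    unfolding imL using avA avB bl br by blast
  have avR: "path_image (quad \<sigma> b0 s' v0) \<inter> ball (\<phi> a) r = {}"
    unfolding imR using avC avD bl br by blast
  \<comment> \<open>The corners \<open>\<phi> a0\<close> and \<open>\<phi> b0\<close> are only near
    \<open>\<phi> a\<close> and \<open>\<phi> b\<close>. The radius is reduced by this error, which
    is below \<open>\<eta>1 \<le> \<rho>\<close>.\<close>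
  define \<rho>' where "\<rho>' = min (\<rho> - dist (\<phi> b0) (\<phi> b)) (\<rho> - dist (\<phi> a0) (\<phi> a))"
  have "\<rho>' > 0" unfolding \<rho>'_def using dl dr sm by auto
  have bsub: "ball (\<phi> b0) \<rho>' \<subseteq> ball (\<phi> b) \<rho>" "ball (\<phi> a0) \<rho>' \<subseteq> ball (\<phi> a) \<rho>"
    unfolding \<rho>'_def subset_iff mem_ball
    using dist_triangle[of "\<phi> b" _ "\<phi> b0"] dist_triangle[of "\<phi> a" _ "\<phi> a0"] by (smt (verit) dist_commute)+
  obtain c where c: "c = 1 \<or> c = (-1::complex)" 
    "\<And>z. z \<notin> path_image (quad a0 b0 u0 v0) \<Longrightarrow> winding_number (quad a0 b0 u0 v0) z = 0 \<or> winding_number (quad a0 b0 u0 v0) z = c"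
    "\<And>z. z \<in> closed_segment (\<phi> \<sigma>) (\<phi> s') \<Longrightarrow> z \<notin> path_image (quad a0 b0 u0 v0) \<Longrightarrow> winding_number (quad a0 b0 u0 v0) z = c"
  proof (rule winding_number_quad_cut[of a0 \<sigma> b0 u0 s' v0 \<rho>'])
    show "z \<notin> path_image (quad a0 \<sigma> u0 s') \<and> winding_number (quad a0 \<sigma> u0 s') z = 0" if "z \<in> ball (\<phi> b0) \<rho>'" for z
      using thin[of b "quad a0 \<sigma> u0 s'" z, OF _ simple_path_imp_path[OF sL] _ thL avL subsetD[OF bsub(1) that]] by simp
    show "z \<notin> path_image (quad \<sigma> b0 s' v0) \<and> winding_number (quad \<sigma> b0 s' v0) z = 0" if "z \<in> ball (\<phi> a0) \<rho>'" for z
      using thin[of a "quad \<sigma> b0 s' v0" z, OF _ simple_path_imp_path[OF sR] _ thR avR subsetD[OF bsub(2) that]] by simp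
  qed (use os o1 o2 o3 o4 sS sL sR \<open>\<rho>' > 0\<close> in auto)
  have "z \<notin> path_image (quad a0 b0 u0 v0)" if "z \<in> JJ" "z \<noteq> \<phi> \<sigma>" "z \<noteq> \<phi> s'" for z
  proof -
    have "z \<notin> \<phi> ` {a..b}" using IntI[OF that(1)] seg(5) that by (metis singletonD)
    moreover have "z \<notin> \<phi> ` {u..v}" using IntI[OF that(1)] seg(6) that by (metis singletonD)
    moreover have "z \<notin> El" "z \<notin> Er" using that(1) dis(2,3) by (metis IntI empty_iff)+
    ultimately show ?thesis using iab(1) iuv(1) unfolding imS Un_iff by (meson subsetD)
  qed
  then show ?thesis
    using that[OF l rt o1 o2 o3 o4 c(1) thS c(2)] c(3) unfolding JJ_def by blast
qed

end

section \<open>Following a property through alternating hits of two closed sets\<close>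

lemma closed_last_hit:
  fixes S :: "real set"
  assumes "closed S" "p \<in> S" "p \<le> q"
  obtains t where "p \<le> t" "t \<le> q" "t \<in> S" "\<And>t'. t < t' \<Longrightarrow> t' \<le> q \<Longrightarrow> t' \<notin> S"
proof -
  have "compact (S \<inter> {p..q})" using assms by (simp add: closed_Int_compact)
  moreover have "p \<in> S \<inter> {p..q}" using assms by simp
  ultimately obtain t where t: "t \<in> S \<inter> {p..q}" "\<forall>t'\<in>S \<inter> {p..q}. t' \<le> t"
    using compact_attains_sup[of "S \<inter> {p..q}"] by blast
  have "t' \<notin> S" if "t < t'" "t' \<le> q" for t'
  proof
    assume "t' \<in> S"
    then have "t' \<in> S \<inter> {p..q}" using that t(1) by simp
    from bspec[OF t(2) this] show False using that by simp
  qed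
  then show ?thesis using that[of t] t(1) by simp
qed

lemma closed_first_hit:
  fixes S :: "real set"
  assumes "closed S" "q \<in> S" "p \<le> q"
  obtains t where "p \<le> t" "t \<le> q" "t \<in> S" "\<And>t'. p \<le> t' \<Longrightarrow> t' < t \<Longrightarrow> t' \<notin> S"
proof -
  have "compact (S \<inter> {p..q})" using assms by (simp add: closed_Int_compact)
  moreover have "q \<in> S \<inter> {p..q}" using assms by simp
  ultimately obtain t where t: "t \<in> S \<inter> {p..q}" "\<forall>t'\<in>S \<inter> {p..q}. t \<le> t'"
    using compact_attains_inf[of "S \<inter> {p..q}"] by blast
  have "t' \<notin> S" if "p \<le> t'" "t' < t" for t'
  proof
    assume "t' \<in> S"
    then have "t' \<in> S \<inter> {p..q}" using that t(1) by simp
    from bspec[OF t(2) this] show False using that by simp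
  qed
  then show ?thesis using that[of t] t(1) by simp
qed

text \<open>One of two alternating states: the latest hit of \<open>A \<union> B\<close> was in
  \<open>B\<close>, and the property \<open>P\<close> that belongs to this state holds.\<close>

definition tracked :: "real set \<Rightarrow> real set \<Rightarrow> (real \<Rightarrow> bool) \<Rightarrow> real \<Rightarrow> real \<Rightarrow> bool" where
  "tracked A B P T0 t \<longleftrightarrow> (\<exists>p\<in>{T0..t}. p \<in> B \<and> {p..t} \<inter> A = {} \<and> P t)"

text \<open>If \<open>A\<close> is hit after \<open>t\<close>, then \<open>t\<close> lies in a gap
  between the last hit of \<open>B\<close> and the first hit of \<open>A\<close>. There
  \<open>gap\<close> exchanges \<open>P\<close> for \<open>Q\<close>, before the hit of
  \<open>A\<close> can affect \<open>P\<close>; \<open>Q\<close> then survives because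
  \<open>B\<close> is not hit.\<close>

lemma tracked_step:
  assumes cl: "closed A" "closed B"
    and c1: "\<And>p q. T0 \<le> p \<Longrightarrow> p \<le> q \<Longrightarrow> q \<le> T \<Longrightarrow> {p..q} \<inter> A = {} \<Longrightarrow> P p \<Longrightarrow> P q"
    and c2: "\<And>p q. T0 \<le> p \<Longrightarrow> p \<le> q \<Longrightarrow> q \<le> T \<Longrightarrow> {p..q} \<inter> B = {} \<Longrightarrow> Q p \<Longrightarrow> Q q"
    and gap: "\<And>p q t. T0 \<le> p \<Longrightarrow> p < t \<Longrightarrow> t < q \<Longrightarrow> q \<le> T \<Longrightarrow> p \<in> B \<Longrightarrow> q \<in> A \<Longrightarrow> {p<..<q} \<inter> (A \<union> B) = {} \<Longrightarrow> P t \<Longrightarrow> Q t"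
    and t: "t \<le> t'" "t' \<le> T" and T: "tracked A B P T0 t" and short: "{t..t'} \<inter> A = {} \<or> {t..t'} \<inter> B = {}"
  shows "tracked A B P T0 t' \<or> tracked B A Q T0 t'"
proof -
  obtain p where p: "T0 \<le> p" "p \<le> t" "p \<in> B" "{p..t} \<inter> A = {}" "P t"
    using T unfolding tracked_def by auto
  show ?thesis
  proof (cases "{t..t'} \<inter> A = {}")
    case True
    have "{p..t'} = {p..t} \<union> {t..t'}" using p t by auto
    then have "{p..t'} \<inter> A = {}" using p True by blast
    moreover have "P t'" using c1[of t t'] p t True by auto
    ultimately show ?thesis unfolding tracked_def using p t by auto
  next
    case False
    then obtain q0 where q0: "q0 \<in> A" "t \<le> q0" "q0 \<le> t'" by auto
    obtain q where q: "t \<le> q" "q \<le> q0" "q \<in> A" "\<And>x. t \<le> x \<Longrightarrow> x < q \<Longrightarrow> x \<notin> A"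
      using closed_first_hit[OF cl(1) q0(1,2)] by blast
    have noB: "{t..t'} \<inter> B = {}" using False short by blast
    obtain p' where p': "p \<le> p'" "p' \<le> t" "p' \<in> B" "\<And>x. p' < x \<Longrightarrow> x \<le> t \<Longrightarrow> x \<notin> B"
      using closed_last_hit[OF cl(2) p(3,2)] by blast
    have "p' \<noteq> t" using noB p' t by auto
    then have p't: "p' < t" using p' by simp
    have "q \<noteq> t" using p q by auto
    then have tq: "t < q" using q by simp
    have "x \<notin> A \<union> B" if "p' < x" "x < q" for x
    proof (cases "x \<le> t")
      case True
      then have "x \<in> {p..t}" using p' that by simp
      then show ?thesis using p(4) p'(4)[OF that(1) True] by blast
    next
      case False
      then show ?thesis using q noB that q0 by (auto simp: disjoint_iff)
    qed
    then have "{p'<..<q} \<inter> (A \<union> B) = {}" by auto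
    then have "Q t" using gap[of p' t q] p p' p't tq q q0 t by auto
    then have "Q t'" using c2[of t t'] noB p t by auto
    moreover have "{q..t'} \<subseteq> {t..t'}" using q by simp
    then have "{q..t'} \<inter> B = {}" using noB by blast
    ultimately show ?thesis unfolding tracked_def using p q q0 t by auto
  qed
qed

text \<open>Around each point, short intervals meet at most one of the disjoint closed sets, so
  \<open>tracked_step\<close> applies locally, and the interval induction \<open>Bolzano\<close>
  chains the steps.\<close>

lemma tracked_all:
  fixes A B :: "real set" and P Q :: "real \<Rightarrow> bool"
  assumes cl: "closed A" "closed B" "A \<inter> B = {}" and T0: "T0 \<le> T" "T0 \<in> B" "P T0"
    and c1: "\<And>p q. T0 \<le> p \<Longrightarrow> p \<le> q \<Longrightarrow> q \<le> T \<Longrightarrow> {p..q} \<inter> A = {} \<Longrightarrow> P p \<Longrightarrow> P q"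
    and c2: "\<And>p q. T0 \<le> p \<Longrightarrow> p \<le> q \<Longrightarrow> q \<le> T \<Longrightarrow> {p..q} \<inter> B = {} \<Longrightarrow> Q p \<Longrightarrow> Q q"
    and gap1: "\<And>p q t. T0 \<le> p \<Longrightarrow> p < t \<Longrightarrow> t < q \<Longrightarrow> q \<le> T \<Longrightarrow> p \<in> B \<Longrightarrow> q \<in> A \<Longrightarrow> {p<..<q} \<inter> (A \<union> B) = {} \<Longrightarrow> P t \<Longrightarrow> Q t"
    and gap2: "\<And>p q t. T0 \<le> p \<Longrightarrow> p < t \<Longrightarrow> t < q \<Longrightarrow> q \<le> T \<Longrightarrow> p \<in> A \<Longrightarrow> q \<in> B \<Longrightarrow> {p<..<q} \<inter> (A \<union> B) = {} \<Longrightarrow> Q t \<Longrightarrow> P t"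
  shows "P T \<or> Q T"
proof -
  define Inv where "Inv t \<longleftrightarrow> tracked A B P T0 t \<or> tracked B A Q T0 t" for t
  have step: "Inv t'" if "Inv t" "t \<le> t'" "t' \<le> T" "{t..t'} \<inter> A = {} \<or> {t..t'} \<inter> B = {}" for t t'
  proof (cases "tracked A B P T0 t")
    case True
    have "tracked A B P T0 t' \<or> tracked B A Q T0 t'"
    proof (rule tracked_step[of A B T0 T P Q t t'])
      show "P q" if "T0 \<le> p" "p \<le> q" "q \<le> T" "{p..q} \<inter> A = {}" "P p" for p q using that by (rule c1)
      show "Q q" if "T0 \<le> p" "p \<le> q" "q \<le> T" "{p..q} \<inter> B = {}" "Q p" for p q using that by (rule c2)
      show "Q x" if "T0 \<le> p" "p < x" "x < q" "q \<le> T" "p \<in> B" "q \<in> A" "{p<..<q} \<inter> (A \<union> B) = {}" "P x" for p q x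
        using that(1-6) that(7) that(8) by (rule gap1)
    qed (use cl that True in auto)
    then show ?thesis unfolding Inv_def .
  next
    case False
    then have tr: "tracked B A Q T0 t" using that unfolding Inv_def by blast
    have "tracked B A Q T0 t' \<or> tracked A B P T0 t'"
    proof (rule tracked_step[of B A T0 T Q P t t'])
      show "Q q" if "T0 \<le> p" "p \<le> q" "q \<le> T" "{p..q} \<inter> B = {}" "Q p" for p q using that by (rule c2)
      show "P q" if "T0 \<le> p" "p \<le> q" "q \<le> T" "{p..q} \<inter> A = {}" "P p" for p q using that by (rule c1)
      show "P x" if "T0 \<le> p" "p < x" "x < q" "q \<le> T" "p \<in> A" "q \<in> B" "{p<..<q} \<inter> (B \<union> A) = {}" "Q x" for p q x
        using that(1-6) that(7)[unfolded Un_commute[of B A]] that(8) by (rule gap2)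
    qed (use cl that tr in auto)
    then show ?thesis unfolding Inv_def by blast
  qed
  \<comment> \<open>The bounds are premises inside \<open>R\<close> because the induction ranges
    over all intervals of the line.\<close>
  define R where "R x y \<longleftrightarrow> (T0 \<le> x \<longrightarrow> y \<le> T \<longrightarrow> Inv x \<longrightarrow> Inv y)" for x y
  have "R T0 T"
    using \<open>T0 \<le> T\<close>
  proof (induction rule: Bolzano)
    case (trans x y z)
    then show ?case unfolding R_def by auto
  next
    case (local x)
    have "x \<in> - A \<or> x \<in> - B" using cl by blast
    then obtain S where S: "S = A \<or> S = B" "x \<in> - S" by blast
    then obtain d where d: "d > 0" "ball x d \<subseteq> - S"
      using cl open_contains_ball[of "- S"] by (metis open_Compl)
    have "R x' y" if "x' \<le> x \<and> x \<le> y \<and> y - x' < d" for x' y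
      unfolding R_def
    proof (intro impI)
      assume "y \<le> T" "Inv x'"
      have "{x'..y} \<subseteq> ball x d" using that by (auto simp: dist_real_def)
      then have "{x'..y} \<inter> S = {}" using d by blast
      then show "Inv y" using step[of x' y] \<open>y \<le> T\<close> \<open>Inv x'\<close> that S by auto
    qed
    note L = this
    show ?case by (intro exI[of _ d] conjI allI d(1)) (rule impI, rule L)
  qed
  moreover have "Inv T0" unfolding Inv_def tracked_def using T0 cl by auto
  ultimately show ?thesis using T0 unfolding Inv_def tracked_def R_def by auto
qed

section \<open>The pass adjacent to the arc at its middle\<close>

context no_back_scales begin

lemma winding_number_const_curve:
  assumes "path \<gamma>" "pathfinish \<gamma> = pathstart \<gamma>" "connected I" "I \<subseteq> {0..}" "\<phi> ` I \<inter> path_image \<gamma> = {}" "p \<in> I" "q \<in> I"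
  shows "winding_number \<gamma> (\<phi> p) = winding_number \<gamma> (\<phi> q)"
proof -
  have "connected (\<phi> ` I)" using assms cont by (intro connected_continuous_image continuous_on_subset[OF cont])
  then show ?thesis using winding_number_eq[of \<gamma> "\<phi> p" "\<phi> ` I" "\<phi> q"] assms by auto
qed

lemma closed_hits: "closed S \<Longrightarrow> 0 \<le> p \<Longrightarrow> closed {t \<in> {p..q}. \<phi> t \<in> S}"
  using continuous_closed_preimage[of "{p..q}" \<phi> S] continuous_on_subset[OF cont, of "{p..q}"]
  by (simp add: vimage_def Int_def conj_commute)

lemma thin_scale:
  assumes "\<epsilon> > 0"
  obtains \<eta> where "\<eta> > 0" 
    "\<And>\<gamma> z. \<lbrakk>path \<gamma>; pathfinish \<gamma> = pathstart \<gamma>; \<And>w. w \<in> path_image \<gamma> \<Longrightarrow> infdist w (\<phi> ` {a..b}) < \<eta>; infdist z (\<phi> ` {a..b}) \<ge> \<epsilon>\<rbrakk>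
       \<Longrightarrow> winding_number \<gamma> z = 0"
  using winding_number_thin[of "\<phi> ` {a..b}" \<epsilon>] compact_arc[of a b] connected_arc_compl[of a b] ord assms by (smt (verit) atLeastAtMost_iff empty_iff imageI)

text \<open>Recurrence yields some return of the curve along the arc. The first point of the curve on the middle chord
  lies in the strip bounded by this return; the piece of the curve in the strip through that point cannot turn
  back and is therefore the adjacent pass.\<close>

lemma adjacent_pass:
  assumes \<eta>: "0 < \<eta>" "\<eta> \<le> \<eta>1" and rec: "\<And>e M. e > 0 \<Longrightarrow> \<exists>t>M. \<forall>\<tau>\<in>{0..M}. dist (\<phi> (t + \<tau>)) (\<phi> \<tau>) < e"
  shows "\<exists>u v \<sigma> s'. pass \<eta> u v \<and> gate \<eta> u v (\<phi> s) \<sigma> s' \<and> closed_segment (\<phi> \<sigma>) (\<phi> s') \<inter> \<phi> ` {0..v} \<subseteq> {\<phi> \<sigma>, \<phi> s'}"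
proof -
  obtain h where h: "h > 0" 
    "\<And>\<gamma> z. \<lbrakk>path \<gamma>; pathfinish \<gamma> = pathstart \<gamma>; \<And>w. w \<in> path_image \<gamma> \<Longrightarrow> infdist w (\<phi> ` {a..b}) < h; infdist z (\<phi> ` {a..b}) \<ge> \<eta>\<rbrakk>
       \<Longrightarrow> winding_number \<gamma> z = 0" using thin_scale \<eta> by blast
  \<comment> \<open>At scale \<open>k\<close> the strip is so thin that it winds only around points
    closer than \<open>\<eta>\<close> to the arc.\<close>
  define k where "k = min h \<eta>"
  have k: "k > 0" "k \<le> h" "k \<le> \<eta>" "k \<le> \<eta>1" unfolding k_def using h \<eta> by auto
  obtain t1 where t1: "t1 > b" "\<And>\<tau>. 0 \<le> \<tau> \<Longrightarrow> \<tau> \<le> b \<Longrightarrow> dist (\<phi> (t1 + \<tau>)) (\<phi> \<tau>) < k"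
    using rec[of k b] k by auto
  define u1 v1 where "u1 = t1 + a" and "v1 = t1 + b"
  have P1: "pass k u1 v1"
  proof -
    have "infdist (\<phi> t) (\<phi> ` {a..b}) < k" if "t \<in> {u1..v1}" for t
    proof -
      have "t - t1 \<in> {a..b}" using that unfolding u1_def v1_def by simp
      then have "infdist (\<phi> t) (\<phi> ` {a..b}) \<le> dist (\<phi> t) (\<phi> (t - t1))" "dist (\<phi> t) (\<phi> (t - t1)) < k"
        using t1(2)[of "t - t1"] ord by (auto intro: infdist_le)
      then show ?thesis by linarith
    qed
    moreover have "dist (\<phi> u1) (\<phi> a) < k" "dist (\<phi> v1) (\<phi> b) < k" 
      using t1(2)[of a] t1(2)[of b] ord unfolding u1_def v1_def by linarith+
    ultimately show ?thesis unfolding pass_def using t1 ord unfolding u1_def v1_def by simp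
  qed
  obtain \<sigma> s1 where G1: "gate k u1 v1 (\<phi> s) \<sigma> s1"
    using gate_exists[of u1 v1 s "t1 + s" "\<phi> s" k] t1 t1(2)[of s] ord k unfolding u1_def v1_def by auto
  obtain a0 b0 u0 v0 c where S: "gate k u1 v1 (\<phi> a) a0 u0" "gate k u1 v1 (\<phi> b) b0 v0"
    "a0 < \<sigma>" "\<sigma> < b0" "u0 < s1" "s1 < v0" "c = 1 \<or> c = (-1::complex)"
    "\<And>w. w \<in> path_image (quad a0 b0 u0 v0) \<Longrightarrow> infdist w (\<phi> ` {a..b}) < k"
    "\<And>z. z \<notin> path_image (quad a0 b0 u0 v0) \<Longrightarrow> winding_number (quad a0 b0 u0 v0) z = 0 \<or> winding_number (quad a0 b0 u0 v0) z = c"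
    "\<And>z. z \<in> closed_segment (\<phi> \<sigma>) (\<phi> s1) \<Longrightarrow> z \<noteq> \<phi> \<sigma> \<Longrightarrow> z \<noteq> \<phi> s1 \<Longrightarrow> 
       z \<notin> path_image (quad a0 b0 u0 v0) \<and> winding_number (quad a0 b0 u0 v0) z = c"
    by (rule strip[OF k(1,4) P1 G1]) (rule that)
  note L = S(1)[unfolded gate_def] and R = S(2)[unfolded gate_def] and J = G1[unfolded gate_def]
  let ?J = "closed_segment (\<phi> \<sigma>) (\<phi> s1)"
  \<comment> \<open>The curve up to time \<open>v1\<close> without the interior of the arc. The
    chord is shortened to its first meeting \<open>\<phi> s2\<close> with \<open>C\<close>, seen
    from \<open>\<phi> \<sigma>\<close>, so that nothing of the curve up to \<open>v1\<close> lies
    across it any more.\<close>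
  define C where "C = \<phi> ` ({0..a} \<union> {b..v1})"
  have cC: "compact C" unfolding C_def image_Un using ord compact_arc by (intro compact_Un) auto
  have \<sigma>C: "\<phi> \<sigma> \<notin> C" unfolding C_def using S(3,4) L R eq_iff ord by auto
  have "\<phi> s1 \<in> C" unfolding C_def using J P1 unfolding pass_def by auto
  then have br: "\<phi> s1 \<in> ?J \<inter> C" "compact (?J \<inter> C)" "{\<phi> \<sigma>} \<inter> (?J \<inter> C) = {}" 
    using cC \<sigma>C by (simp_all add: compact_Int)
  obtain x y where xy: "x \<in> {\<phi> \<sigma>}" "y \<in> ?J \<inter> C" "closed_segment x y \<subseteq> ?J" "closed_segment x y \<inter> (?J \<inter> C) = {y}"
    by (rule segment_bridge[OF finite_imp_compact br(2) singletonI br(1) br(3)]) (rule finite.emptyI finite.insertI | rule that)+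
  then have y: "y \<in> ?J \<inter> C" "closed_segment (\<phi> \<sigma>) y \<subseteq> ?J" "closed_segment (\<phi> \<sigma>) y \<inter> (?J \<inter> C) = {y}"
    by simp_all
  then obtain s2 where s2: "y = \<phi> s2" "s2 \<in> {0..a} \<union> {b..v1}" unfolding C_def by blast
  have dJ: "dist w (\<phi> s) < k" if "w \<in> ?J" for w using J that by (auto simp: dist_commute)
  have ds2: "dist (\<phi> s2) (\<phi> s) < k" using dJ y s2 by blast
  \<comment> \<open>Times up to \<open>a\<close> are excluded by \<open>sep0\<close>: there the
    curve is not close enough to \<open>\<phi> s\<close>.\<close>
  have s2b: "b \<le> s2" "s2 \<le> v1" 
    using s2 ds2 sep0(1)[of s2] k by auto
  have JC: "closed_segment (\<phi> \<sigma>) (\<phi> s2) \<inter> C = {\<phi> s2}" using y s2 by blast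
  have k0: "k \<le> \<eta>0" using k eta1 r by linarith
  \<comment> \<open>If \<open>s2\<close> precedes the known pass, then \<open>\<phi> s2\<close> is
    inside the strip, and the new pass is the stretch of the curve between the last boundary hit
    before \<open>s2\<close> and the first one after it. These exist since the curve is on the
    boundary at the times \<open>b0\<close> and \<open>u0\<close>.\<close>
  have "\<exists>u2 v2. pass \<eta> u2 v2 \<and> u2 \<le> s2 \<and> s2 \<le> v2 \<and> v2 \<le> v1"
  proof (cases "u1 \<le> s2")
    case True
    have "pass \<eta> u1 v1" using P1 k unfolding pass_def by fastforce
    then show ?thesis using True s2b by blast
  next
    case False
    let ?S = "quad a0 b0 u0 v0"
    have o: "0 \<le> a0" "a0 \<le> b0" "b0 \<le> b" "0 \<le> u0" "u0 \<le> v0" "u1 \<le> u0" using S(3-6) L R J P1 ord unfolding pass_def by auto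
    have pS: "path ?S" "pathfinish ?S = pathstart ?S" using path_quad[OF o(1,2,4,5)] by auto
    have imS: "path_image ?S = \<phi> ` {a0..b0} \<union> closed_segment (\<phi> b0) (\<phi> v0) \<union> \<phi> ` {u0..v0} \<union> closed_segment (\<phi> a0) (\<phi> u0)"
      using image_quad[OF o(2,5)] by (simp add: closed_segment_commute)
    have cS: "closed (path_image ?S)" using pS by (simp add: closed_path_image)
    have ne: "\<phi> s2 \<noteq> \<phi> \<sigma>" "\<phi> s2 \<noteq> \<phi> s1" using False J s2b S(4) R ord eq_iff[of s2 \<sigma>] eq_iff[of s2 s1] P1 unfolding pass_def by auto
    have s2S: "\<phi> s2 \<notin> path_image ?S" "winding_number ?S (\<phi> s2) = c" using S(10)[of "\<phi> s2"] y s2 ne by auto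
    obtain u2 where u2: "b0 \<le> u2" "u2 \<le> s2" "u2 \<in> {t \<in> {b0..s2}. \<phi> t \<in> path_image ?S}" 
      "\<And>t. u2 < t \<Longrightarrow> t \<le> s2 \<Longrightarrow> t \<notin> {t \<in> {b0..s2}. \<phi> t \<in> path_image ?S}"
      using closed_last_hit[OF closed_hits[OF cS, of b0 s2], of b0 s2] o s2b imS by auto
    obtain v2 where v2: "s2 \<le> v2" "v2 \<le> u0" "v2 \<in> {t \<in> {s2..u0}. \<phi> t \<in> path_image ?S}" 
      "\<And>t. s2 \<le> t \<Longrightarrow> t < v2 \<Longrightarrow> t \<notin> {t \<in> {s2..u0}. \<phi> t \<in> path_image ?S}"
      using closed_first_hit[OF closed_hits[OF cS, of s2 u0], of u0 s2] o s2b ord imS False by auto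
    have lt: "u2 < s2" "s2 < v2" using u2 v2 s2S(1) by (auto simp: order.strict_iff_order)
    have off: "\<phi> t \<notin> path_image ?S" if "u2 < t" "t < v2" for t
      using u2 v2 that by (cases "t \<le> s2") auto
    have wc: "winding_number ?S (\<phi> t) = c" if "u2 < t" "t < v2" for t
    proof -
      have "{u2<..<v2} \<subseteq> {0..}" using u2(1) o by auto
      moreover have "\<phi> ` {u2<..<v2} \<inter> path_image ?S = {}" using off by auto
      ultimately show ?thesis
        using winding_number_const_curve[OF pS, of "{u2<..<v2}" t s2] that lt s2S by simp
    qed
    have "infdist (\<phi> t) (\<phi> ` {a..b}) < \<eta>" if "t \<in> {u2..v2}" for t
    proof (cases "u2 < t \<and> t < v2")
      case True
      have "winding_number ?S (\<phi> t) \<noteq> 0" using wc True S(7) by auto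
      moreover have "infdist w (\<phi> ` {a..b}) < h" if "w \<in> path_image ?S" for w using S(8)[OF that] k by linarith
      ultimately show ?thesis using h(2)[OF pS, of "\<phi> t"] by force
    next
      case False
      then have "\<phi> t \<in> path_image ?S" using that u2 v2 by auto
      then show ?thesis using S(8) k by force
    qed
    note inf = this
    have inf0: "infdist (\<phi> t) (\<phi> ` {a..b}) < \<eta>0" if "t \<in> {u2..v2}" for t 
      using inf[OF that] \<eta> eta1 r by linarith
    \<comment> \<open>By injectivity the two sides of the strip made of \<open>\<phi>\<close> can be
      met only at a corner, so entry and exit are on the chords.\<close>
    have u2E: "\<phi> u2 \<in> closed_segment (\<phi> a0) (\<phi> u0) \<union> closed_segment (\<phi> b0) (\<phi> v0)"
    proof -
      have "\<phi> u2 \<notin> \<phi> ` {u0..v0}" using u2 False o eq_iff by auto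
      moreover have "\<phi> u2 \<in> closed_segment (\<phi> b0) (\<phi> v0)" if "\<phi> u2 \<in> \<phi> ` {a0..b0}"
      proof -
        have "u2 = b0" using that u2 o eq_iff by auto
        then show ?thesis by simp
      qed
      ultimately show ?thesis using u2(3) imS by blast
    qed
    have v2E: "\<phi> v2 \<in> closed_segment (\<phi> a0) (\<phi> u0) \<union> closed_segment (\<phi> b0) (\<phi> v0)"
    proof -
      have "\<phi> v2 \<notin> \<phi> ` {a0..b0}" using lt s2b o eq_iff by auto
      moreover have "\<phi> v2 \<in> closed_segment (\<phi> a0) (\<phi> u0)" if "\<phi> v2 \<in> \<phi> ` {u0..v0}"
      proof -
        have "v2 = u0" using that v2 lt s2b ord o eq_iff by auto
        then show ?thesis by simp
      qed
      ultimately show ?thesis using v2(3) imS by blast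
    qed
    \<comment> \<open>Entry through the right chord would give a backward piece from
      \<open>b\<close> to \<open>s\<close>, exit through the left chord one from \<open>s\<close> to
      \<open>a\<close>.\<close>
    have u2a: "\<phi> u2 \<in> closed_segment (\<phi> a0) (\<phi> u0)"
    proof (rule ccontr)
      assume "\<not> ?thesis"
      then have "\<phi> u2 \<in> ball (\<phi> b) k" using u2E R by blast
      then show False using nb[of s b u2 s2] u2 lt o k0 ds2 inf0 by (auto simp: dist_commute)
    qed
    have v2b: "\<phi> v2 \<in> closed_segment (\<phi> b0) (\<phi> v0)"
    proof (rule ccontr)
      assume "\<not> ?thesis"
      then have "\<phi> v2 \<in> ball (\<phi> a) k" using v2E L by blast
      then show False using nb[of a s s2 v2] s2b ord u2 lt o k0 ds2 inf0 by (auto simp: dist_commute)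
    qed
    have "b < u2"
    proof (rule ccontr)
      assume "\<not> b < u2"
      then have "\<phi> u2 \<in> \<phi> ` {a..b}" using u2 o L by auto
      then have "\<phi> u2 = \<phi> a0" using u2a L by blast
      then show False using u2 o eq_iff[of u2 a0] S(3,4) by auto
    qed
    moreover have "dist (\<phi> u2) (\<phi> a) < \<eta>"
    proof -
      have "\<phi> u2 \<in> ball (\<phi> a) k" using u2a L by blast
      then show ?thesis using k by (simp add: dist_commute)
    qed
    moreover have "dist (\<phi> v2) (\<phi> b) < \<eta>"
    proof -
      have "\<phi> v2 \<in> ball (\<phi> b) k" using v2b R by blast
      then show ?thesis using k by (simp add: dist_commute)
    qed
    ultimately have "pass \<eta> u2 v2" unfolding pass_def using inf lt by auto
    moreover have "v2 \<le> v1" using v2 L by linarith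
    ultimately show ?thesis using lt by (intro exI[of _ u2] exI[of _ v2]) auto
  qed
  then obtain u2 v2 where P2: "pass \<eta> u2 v2" "u2 \<le> s2" "s2 \<le> v2" "v2 \<le> v1" by blast
  have sub: "\<phi> ` {u2..v2} \<subseteq> C" unfolding C_def using P2 unfolding pass_def by (intro image_mono) auto
  have "gate \<eta> u2 v2 (\<phi> s) \<sigma> s2"
  proof -
    have "closed_segment (\<phi> \<sigma>) (\<phi> s2) \<subseteq> ball (\<phi> s) \<eta>"
      using y(2) s2 J subset_ball[of k \<eta> "\<phi> s"] k by blast
    moreover have "closed_segment (\<phi> \<sigma>) (\<phi> s2) \<inter> \<phi> ` {a..b} = {\<phi> \<sigma>}" using y(2) s2 J by fastforce
    moreover have "\<phi> s2 \<in> \<phi> ` {u2..v2}" using P2 by auto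
    then have "closed_segment (\<phi> \<sigma>) (\<phi> s2) \<inter> \<phi> ` {u2..v2} = {\<phi> s2}" using JC sub by blast
    ultimately show ?thesis unfolding gate_def using J P2 by auto
  qed
  moreover have "closed_segment (\<phi> \<sigma>) (\<phi> s2) \<inter> \<phi> ` {0..v2} \<subseteq> {\<phi> \<sigma>, \<phi> s2}"
  proof -
    have "\<phi> ` {0..v2} \<subseteq> C \<union> \<phi> ` {a..b}" unfolding C_def image_Un[symmetric] using P2(4) by (intro image_mono) auto
    moreover have "closed_segment (\<phi> \<sigma>) (\<phi> s2) \<inter> \<phi> ` {a..b} \<subseteq> {\<phi> \<sigma>}" using y(2) s2 J by fastforce
    ultimately show ?thesis using JC by blast
  qed
  ultimately show ?thesis using P2 by blast
qed

end

lemma connected_semiopen_segment: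
  fixes x y :: "'a::euclidean_space"
  shows "connected (closed_segment x y - {x})"
proof (cases "x = y")
  case False
  have "connected (open_segment x y)" by (simp add: convex_connected convex_open_segment)
  then show ?thesis
  proof (rule connected_intermediate_closure)
    show "open_segment x y \<subseteq> closed_segment x y - {x}" by (auto simp: open_segment_def)
    show "closed_segment x y - {x} \<subseteq> closure (open_segment x y)" using False by (simp add: closure_open_segment Diff_subset)
  qed
qed simp

text \<open>Here \<open>k1\<close> at \<open>\<phi> v0\<close> exceeds
  \<open>k2\<close> at \<open>\<phi> 0\<close> by \<open>c\<close>. After the time \<open>v0\<close>, \<open>k1\<close> can change only at the left chord \<open>El\<close> and \<open>k2\<close> only at the
  right chord \<open>Er\<close>; following \<open>k1\<close> after hits of \<open>Er\<close> and \<open>k2\<close> after hits of \<open>El\<close>, the tracked number never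
  moves back towards its initial value.\<close>

lemma (in no_back_scales) not_recurrent:
  assumes rec: "\<And>e M. e > 0 \<Longrightarrow> \<exists>t>M. \<forall>\<tau>\<in>{0..M}. dist (\<phi> (t + \<tau>)) (\<phi> \<tau>) < e"
    and far: "infdist (\<phi> 0) (\<phi> ` {a..b}) \<ge> \<eta>0"
  shows False
proof -
  obtain h where h: "h > 0" 
    "\<And>\<gamma> z. \<lbrakk>path \<gamma>; pathfinish \<gamma> = pathstart \<gamma>; \<And>w. w \<in> path_image \<gamma> \<Longrightarrow> infdist w (\<phi> ` {a..b}) < h; infdist z (\<phi> ` {a..b}) \<ge> \<eta>0\<rbrakk>
       \<Longrightarrow> winding_number \<gamma> z = 0" using thin_scale eta0 by blast
  \<comment> \<open>With \<open>\<eta> \<le> h\<close> the strip does not wind around points at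
    distance at least \<open>\<eta>0\<close> from the arc, in particular not around
    \<open>\<phi> 0\<close>.\<close>
  define \<eta> where "\<eta> = min h \<eta>1"
  have \<eta>: "0 < \<eta>" "\<eta> \<le> \<eta>1" "\<eta> \<le> h" "\<eta> \<le> \<eta>0" "\<eta> \<le> r" unfolding \<eta>_def using h eta1 r by auto
  obtain u v \<sigma> s' where P: "pass \<eta> u v" and G: "gate \<eta> u v (\<phi> s) \<sigma> s'" 
    and adj: "closed_segment (\<phi> \<sigma>) (\<phi> s') \<inter> \<phi> ` {0..v} \<subseteq> {\<phi> \<sigma>, \<phi> s'}"
    using adjacent_pass[OF \<eta>(1,2) rec] by blast
  obtain a0 b0 u0 v0 c where S: "gate \<eta> u v (\<phi> a) a0 u0" "gate \<eta> u v (\<phi> b) b0 v0"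
    "a0 < \<sigma>" "\<sigma> < b0" "u0 < s'" "s' < v0" "c = 1 \<or> c = (-1::complex)"
    "\<And>w. w \<in> path_image (quad a0 b0 u0 v0) \<Longrightarrow> infdist w (\<phi> ` {a..b}) < \<eta>"
    "\<And>z. z \<notin> path_image (quad a0 b0 u0 v0) \<Longrightarrow> winding_number (quad a0 b0 u0 v0) z = 0 \<or> winding_number (quad a0 b0 u0 v0) z = c"
    "\<And>z. z \<in> closed_segment (\<phi> \<sigma>) (\<phi> s') \<Longrightarrow> z \<noteq> \<phi> \<sigma> \<Longrightarrow> z \<noteq> \<phi> s' \<Longrightarrow> 
       z \<notin> path_image (quad a0 b0 u0 v0) \<and> winding_number (quad a0 b0 u0 v0) z = c"
    by (rule strip[OF \<eta>(1,2) P G]) (rule that)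
  note L = S(1)[unfolded gate_def] and R = S(2)[unfolded gate_def] and J = G[unfolded gate_def] and P' = P[unfolded pass_def]
  have o: "0 < a0" "a0 < b0" "b0 \<le> b" "b < u0" "u0 < v0" "0 \<le> \<sigma>" "\<sigma> \<le> b" "b < s'" "v0 \<le> v" "u \<le> u0"
    using S(3-6) L R J P' ord by linarith+
  define El where "El = closed_segment (\<phi> u0) (\<phi> a0)"
  define Er where "Er = closed_segment (\<phi> v0) (\<phi> b0)"
  let ?J = "closed_segment (\<phi> \<sigma>) (\<phi> s')" and ?S = "quad a0 b0 u0 v0" and ?G1 = "closeup a0 u0" and ?G2 = "closeup b0 v0"
  have El: "El \<subseteq> ball (\<phi> a) \<eta>" and Er: "Er \<subseteq> ball (\<phi> b) \<eta>" and Jb: "?J \<subseteq> ball (\<phi> s) \<eta>"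
    using L R J unfolding El_def Er_def by (simp_all add: closed_segment_commute)
  have ballr: "ball x \<eta> \<subseteq> ball x r" for x :: complex using \<eta> by auto
  have dis: "El \<inter> Er = {}" "?J \<inter> El = {}" "?J \<inter> Er = {}"
  proof -
    have "ball (\<phi> a) \<eta> \<inter> ball (\<phi> b) r = {}" "ball (\<phi> s) \<eta> \<inter> ball (\<phi> a) r = {}" "ball (\<phi> s) \<eta> \<inter> ball (\<phi> b) r = {}"
      using balls_disjoint \<eta> ord by simp_all
    moreover have "Er \<subseteq> ball (\<phi> b) r" "El \<subseteq> ball (\<phi> a) r" using Er El ballr by (meson order_trans)+
    moreover have dj: "U \<inter> V = {}" if "A \<inter> B = {}" "U \<subseteq> A" "V \<subseteq> B" for U V A B :: "complex set" using that by blast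
    ultimately show "El \<inter> Er = {}" "?J \<inter> El = {}" "?J \<inter> Er = {}" using El Jb by (meson dj)+
  qed
  have clE: "closed El" "closed Er" unfolding El_def Er_def by auto
  have imS: "path_image ?S = \<phi> ` {a0..b0} \<union> Er \<union> \<phi> ` {u0..v0} \<union> El"
    using image_quad[of a0 b0 u0 v0] o unfolding El_def Er_def by (simp add: closed_segment_commute)
  have im1: "path_image ?G1 = \<phi> ` {a0..u0} \<union> El" using image_closeup[of a0 u0] o unfolding El_def by simp
  have im2: "path_image ?G2 = \<phi> ` {b0..v0} \<union> Er" using image_closeup[of b0 v0] o unfolding Er_def by simp
  have pS: "path ?S" "pathfinish ?S = pathstart ?S" using path_quad[of a0 b0 u0 v0] o by auto
  have p1: "path ?G1" "pathfinish ?G1 = pathstart ?G1" using path_closeup[of a0 u0] o by auto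
  have p2: "path ?G2" "pathfinish ?G2 = pathstart ?G2" using path_closeup[of b0 v0] o by auto
  define k1 k2 where "k1 = winding_number ?G1" and "k2 = winding_number ?G2"
  have diff: "k1 z = k2 z + winding_number ?S z" if "z \<notin> path_image ?G1" "z \<notin> path_image ?G2" for z
    using winding_number_closeup_diff[of a0 b0 u0 v0 z] that o unfolding k1_def k2_def by (simp add: algebra_simps)
  have nA: "infdist (\<phi> t) (\<phi> ` {a..b}) < \<eta>0" if "t \<in> {a..b}" for t using infdist_arc_zero[OF that] eta0 by simp
  have nP: "infdist (\<phi> t) (\<phi> ` {a..b}) < \<eta>0" if "t \<in> {u..v}" for t using P' that \<eta> by fastforce
  have dj: "dist (\<phi> \<sigma>) (\<phi> s) < \<eta>0" "dist (\<phi> s') (\<phi> s) < \<eta>0" 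
    using J ends_in_segment \<eta> by (metis dist_commute mem_ball subsetD order_less_le_trans)+
  \<comment> \<open>Up to time \<open>a\<close> the curve is away from \<open>\<phi> b\<close> by
    \<open>sep0\<close>; between \<open>a\<close> and \<open>\<sigma>\<close> a visit to
    \<open>Er\<close> would start a backward piece from \<open>b\<close> to
    \<open>s\<close>.\<close>
  have offEr: "\<phi> t \<notin> Er" if "0 \<le> t" "t \<le> \<sigma>" for t
  proof
    assume "\<phi> t \<in> Er"
    then have d: "dist (\<phi> t) (\<phi> b) < \<eta>" using Er by (auto simp: dist_commute)
    show False
    proof (cases "t \<le> a")
      case True
      then show ?thesis using sep0(2)[of t] d that \<eta> by linarith
    next
      case False
      then show ?thesis using nb[of s b t \<sigma>] d dj \<eta> nA that o by force
    qed
  qed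
  have offEl: "\<phi> t \<notin> El" if "s' \<le> t" "t \<le> v0" for t
  proof
    assume "\<phi> t \<in> El"
    then have d: "dist (\<phi> t) (\<phi> a) < \<eta>" using El by (auto simp: dist_commute)
    then show False using nb[of a s s' t] d dj \<eta> nP that o ord S(5) by force
  qed
  \<comment> \<open>The comparison follows \<open>\<phi>\<close> from time 0 to
    \<open>\<sigma>\<close> with \<open>k2\<close>, crosses the middle chord, and follows
    \<open>\<phi>\<close> from \<open>s'\<close> to \<open>v0\<close> with
    \<open>k1\<close>.\<close>
  have A1: "k2 (\<phi> \<sigma>) = k2 (\<phi> 0)"
  proof -
    have "\<phi> t \<notin> path_image ?G2" if "t \<in> {0..\<sigma>}" for t
      using that offEr[of t] S(4) o eq_iff unfolding im2 by auto
    then show ?thesis unfolding k2_def using winding_number_const_curve[OF p2, of "{0..\<sigma>}" \<sigma> 0] o by fastforce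
  qed
  have A4: "k1 (\<phi> v0) = k1 (\<phi> s')"
  proof -
    have "\<phi> t \<notin> path_image ?G1" if "t \<in> {s'..v0}" for t
      using that offEl[of t] S(5) o eq_iff unfolding im1 by auto
    moreover have "{s'..v0} \<subseteq> {0..}" using o ord by auto
    ultimately show ?thesis unfolding k1_def using winding_number_const_curve[OF p1, of "{s'..v0}" v0 s'] S(6) by fastforce
  qed
  have ne: "\<phi> \<sigma> \<noteq> \<phi> s'" using eq_iff[of \<sigma> s'] o ord by auto
  \<comment> \<open>The change from \<open>k2\<close> to \<open>k1\<close> is made in the interior
    of the chord, since \<open>?G1\<close> passes through \<open>\<phi> \<sigma>\<close> and
    \<open>?G2\<close> through \<open>\<phi> s'\<close>. There the strip has winding number
    \<open>c\<close>.\<close>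
  define z0 where "z0 = midpoint (\<phi> \<sigma>) (\<phi> s')"
  have z0: "z0 \<in> ?J" "z0 \<noteq> \<phi> \<sigma>" "z0 \<noteq> \<phi> s'" unfolding z0_def using ne by (auto simp: midpoint_eq_endpoint)
  have cJ: "connected (?J - {\<phi> \<sigma>})" "connected (?J - {\<phi> s'})"
    using connected_semiopen_segment[of "\<phi> \<sigma>" "\<phi> s'"] connected_semiopen_segment[of "\<phi> s'" "\<phi> \<sigma>"]
    by (simp_all add: closed_segment_commute)
  have sub0: "\<phi> ` {a0..u0} \<subseteq> \<phi> ` {0..v}" "\<phi> ` {b0..v0} \<subseteq> \<phi> ` {0..v}" using o by (intro image_mono; auto)+
  have off1: "z \<notin> path_image ?G1" if "z \<in> ?J - {\<phi> \<sigma>}" for z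
  proof -
    have nin: "\<phi> s' \<notin> \<phi> ` {a0..u0}" using S(5) o eq_iff ord by auto
    have "z \<notin> \<phi> ` {a0..u0}"
    proof
      assume z: "z \<in> \<phi> ` {a0..u0}"
      then have "z \<in> \<phi> ` {0..v}" by (rule subsetD[OF sub0(1)])
      then have "z \<in> {\<phi> \<sigma>, \<phi> s'}" using adj that by (meson DiffD1 IntI subsetD)
      then show False using z that nin by blast
    qed
    moreover have "z \<notin> El" using that dis(2) by blast
    ultimately show ?thesis unfolding im1 by simp
  qed
  have off2: "z \<notin> path_image ?G2" if "z \<in> ?J - {\<phi> s'}" for z
  proof -
    have nin: "\<phi> \<sigma> \<notin> \<phi> ` {b0..v0}" using S(4) o eq_iff ord by auto
    have "z \<notin> \<phi> ` {b0..v0}"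
    proof
      assume z: "z \<in> \<phi> ` {b0..v0}"
      then have "z \<in> \<phi> ` {0..v}" by (rule subsetD[OF sub0(2)])
      then have "z \<in> {\<phi> \<sigma>, \<phi> s'}" using adj that by (meson DiffD1 IntI subsetD)
      then show False using z that nin by blast
    qed
    moreover have "z \<notin> Er" using that dis(3) by blast
    ultimately show ?thesis unfolding im2 by simp
  qed
  have A2: "k2 z0 = k2 (\<phi> \<sigma>)" unfolding k2_def
    using winding_number_eq[OF p2, of z0 "?J - {\<phi> s'}" "\<phi> \<sigma>"] cJ off2 z0 ne by auto
  have A3: "k1 (\<phi> s') = k1 z0" unfolding k1_def
    using winding_number_eq[OF p1, of "\<phi> s'" "?J - {\<phi> \<sigma>}" z0] cJ off1 z0 ne by auto
  have A: "k1 (\<phi> v0) = k2 (\<phi> 0) + c"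
    using diff[of z0] off1[of z0] off2[of z0] z0 S(10)[of z0] A1 A2 A3 A4 by auto
  define n0 where "n0 = k2 (\<phi> 0)"
  have ne\<eta>: "\<phi> 0 \<notin> El" "\<phi> 0 \<notin> Er"
    using far infdist_arc_ball[of a "\<phi> 0" \<eta>] infdist_arc_ball[of b "\<phi> 0" \<eta>] El Er \<eta> ord by force+
  have z12: "\<phi> 0 \<notin> path_image ?G1" "\<phi> 0 \<notin> path_image ?G2"
    unfolding im1 im2 using ne\<eta> o eq_iff ord by auto
  have thS: "infdist w (\<phi> ` {a..b}) < h" if "w \<in> path_image ?S" for w using S(8)[OF that] \<eta> by linarith
  have k10: "k1 (\<phi> 0) = n0"
    using diff[OF z12] h(2)[OF pS thS far] unfolding n0_def by simp
  have "open (- (path_image ?G1 \<union> path_image ?G2))"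
    using p1 p2 by (intro open_Compl closed_Un closed_path_image)
  then obtain d where d: "d > 0" "ball (\<phi> 0) d \<subseteq> - (path_image ?G1 \<union> path_image ?G2)"
    using z12 by (metis ComplI UnE open_contains_ball)
  obtain T where T: "T > v0" "\<And>\<tau>. 0 \<le> \<tau> \<Longrightarrow> \<tau> \<le> v0 \<Longrightarrow> dist (\<phi> (T + \<tau>)) (\<phi> \<tau>) < d"
    using rec[OF d(1), of v0] by auto
  have Tb: "\<phi> T \<in> ball (\<phi> 0) d" using T(2)[of 0] o ord by (simp add: dist_commute)
  have kT: "k1 (\<phi> T) = n0" "k2 (\<phi> T) = n0"
  proof -
    have "k1 (\<phi> T) = k1 (\<phi> 0)" unfolding k1_def 
      using winding_number_eq[OF p1, of "\<phi> T" "ball (\<phi> 0) d" "\<phi> 0"] Tb d by auto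
    then show "k1 (\<phi> T) = n0" using k10 by simp
    have "k2 (\<phi> T) = k2 (\<phi> 0)" unfolding k2_def 
      using winding_number_eq[OF p2, of "\<phi> T" "ball (\<phi> 0) d" "\<phi> 0"] Tb d by auto
    then show "k2 (\<phi> T) = n0" unfolding n0_def .
  qed
  define A B where "A = {t \<in> {v0..T}. \<phi> t \<in> El}" and "B = {t \<in> {v0..T}. \<phi> t \<in> Er}"
  \<comment> \<open>A positive number of steps \<open>c\<close> away from \<open>n0\<close>.
    Counting steps treats both signs of \<open>c\<close> alike.\<close>
  define pos where "pos x \<longleftrightarrow> (\<exists>m::nat. x = n0 + of_nat (Suc m) * c)" for x
  have pos_add: "pos (x + c)" if "pos x" for x
  proof -
    obtain m :: nat where "x = n0 + of_nat (Suc m) * c" using \<open>pos x\<close> unfolding pos_def by blast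
    then have "x + c = n0 + of_nat (Suc (Suc m)) * c" by (simp add: algebra_simps)
    then show ?thesis unfolding pos_def by blast
  qed
  have v00: "0 \<le> v0" using o ord by simp
  have off1': "\<phi> t \<notin> path_image ?G1" if "v0 \<le> t" "t \<le> T" "t \<notin> A" for t
    using that o eq_iff ord unfolding im1 A_def by auto
  have vB: "v0 \<in> B" unfolding B_def Er_def using T by auto
  have off2': "\<phi> t \<notin> path_image ?G2" if "v0 \<le> t" "t \<le> T" "t \<notin> B" for t
  proof -
    have "t \<noteq> v0" using that vB by blast
    then show ?thesis using that o eq_iff ord unfolding im2 B_def by auto
  qed
  have offS: "\<phi> t \<notin> path_image ?S" if "v0 \<le> t" "t \<le> T" "t \<notin> A" "t \<notin> B" for t
  proof -
    have "\<phi> t \<notin> El" "\<phi> t \<notin> Er" using that unfolding A_def B_def by auto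
    moreover have "t \<noteq> v0" using that vB by blast
    then have "\<phi> t \<notin> \<phi> ` {a0..b0}" "\<phi> t \<notin> \<phi> ` {u0..v0}" using that o eq_iff ord by auto
    ultimately show ?thesis unfolding imS by blast
  qed
  have "pos (k1 (\<phi> T)) \<or> pos (k2 (\<phi> T))"
  proof (rule tracked_all[of A B v0 T "\<lambda>t. pos (k1 (\<phi> t))" "\<lambda>t. pos (k2 (\<phi> t))"])
    show "closed A" "closed B" unfolding A_def B_def using closed_hits clE v00 by auto
    show "A \<inter> B = {}" unfolding A_def B_def using dis by blast
    show "v0 \<le> T" using T by simp
    show "v0 \<in> B" by (rule vB)
    show "pos (k1 (\<phi> v0))" unfolding pos_def using A by (intro exI[of _ 0]) (simp add: n0_def)
  next
    fix p q assume *: "v0 \<le> p" "p \<le> q" "q \<le> T" "{p..q} \<inter> A = {}" "pos (k1 (\<phi> p))"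
    have "\<phi> t \<notin> path_image ?G1" if "t \<in> {p..q}" for t
      using off1'[of t] that * by fastforce
    then have "k1 (\<phi> p) = k1 (\<phi> q)" unfolding k1_def
      using winding_number_const_curve[OF p1, of "{p..q}" p q] * v00 by fastforce
    then show "pos (k1 (\<phi> q))" using * by simp
  next
    fix p q assume *: "v0 \<le> p" "p \<le> q" "q \<le> T" "{p..q} \<inter> B = {}" "pos (k2 (\<phi> p))"
    have "\<phi> t \<notin> path_image ?G2" if "t \<in> {p..q}" for t
      using off2'[of t] that * by fastforce
    then have "k2 (\<phi> p) = k2 (\<phi> q)" unfolding k2_def
      using winding_number_const_curve[OF p2, of "{p..q}" p q] * v00 by fastforce
    then show "pos (k2 (\<phi> q))" using * by simp
  next
    \<comment> \<open>A gap from \<open>Er\<close> to \<open>El\<close>: inside the strip it would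
      be a backward piece from \<open>b\<close> to \<open>a\<close>. So it lies outside, where the
      two numbers agree.\<close>
    fix p q t assume *: "v0 \<le> p" "p < t" "t < q" "q \<le> T" "p \<in> B" "q \<in> A" "{p<..<q} \<inter> (A \<union> B) = {}" "pos (k1 (\<phi> t))"
    have off: "\<phi> x \<notin> path_image ?S" if "x \<in> {p<..<q}" for x 
      using offS[of x] that * by fastforce
    have "winding_number ?S (\<phi> t) = 0"
    proof (rule ccontr)
      assume w: "winding_number ?S (\<phi> t) \<noteq> 0"
      have inf: "infdist (\<phi> x) (\<phi> ` {a..b}) < \<eta>0" if "x \<in> {p..q}" for x
      proof (cases "x \<in> {p<..<q}")
        case True
        have "winding_number ?S (\<phi> t) = winding_number ?S (\<phi> x)"
          using winding_number_const_curve[OF pS, of "{p<..<q}" t x] off True * v00 by fastforce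
        then have "\<not> \<eta>0 \<le> infdist (\<phi> x) (\<phi> ` {a..b})" using h(2)[OF pS thS, of "\<phi> x"] w by auto
        then show ?thesis by simp
      next
        case False
        then have "x = p \<or> x = q" using that by auto
        then have "\<phi> x \<in> ball (\<phi> a) \<eta> \<union> ball (\<phi> b) \<eta>" using * El Er unfolding A_def B_def by blast
        then show ?thesis using infdist_arc_ball[of a "\<phi> x" \<eta>] infdist_arc_ball[of b "\<phi> x" \<eta>] \<eta> ord by fastforce
      qed
      have "\<phi> p \<in> ball (\<phi> b) \<eta>" "\<phi> q \<in> ball (\<phi> a) \<eta>" using * El Er unfolding A_def B_def by blast+
      then have "dist (\<phi> p) (\<phi> b) < \<eta>0" "dist (\<phi> q) (\<phi> a) < \<eta>0" using \<eta> by (auto simp: dist_commute)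
      then show False using nb[of a b p q] inf * v00 by simp
    qed
    moreover have "\<phi> t \<notin> path_image ?G1" "\<phi> t \<notin> path_image ?G2" using * off1'[of t] off2'[of t] by fastforce+
    ultimately show "pos (k2 (\<phi> t))" using diff[of "\<phi> t"] * by simp
  next
    \<comment> \<open>A gap from \<open>El\<close> to \<open>Er\<close> may run inside the strip;
      then \<open>k1\<close> is one further step \<open>c\<close> ahead of
      \<open>k2\<close>.\<close>
    fix p q t assume *: "v0 \<le> p" "p < t" "t < q" "q \<le> T" "p \<in> A" "q \<in> B" "{p<..<q} \<inter> (A \<union> B) = {}" "pos (k2 (\<phi> t))"
    have "t \<notin> A" "t \<notin> B" using * by fastforce+
    then have "\<phi> t \<notin> path_image ?G1" "\<phi> t \<notin> path_image ?G2" "\<phi> t \<notin> path_image ?S" 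
      using * off1'[of t] off2'[of t] offS[of t] by simp_all
    then show "pos (k1 (\<phi> t))" using diff[of "\<phi> t"] S(9)[of "\<phi> t"] * pos_add by auto
  qed
  then have "pos n0" using kT by simp
  then obtain m :: nat where "of_nat (Suc m) * c = 0" unfolding pos_def by auto
  then show False using S(7) by (auto simp del: of_nat_Suc)
qed

text \<open>Only the pairs formed by \<open>a\<close>, \<open>b\<close> and one point between them
  are tested. If each fails at some scale, the least of these scales realises the situation of
  \<open>no_back\<close>.\<close>

theorem backward_pass:
  fixes \<phi> :: "real \<Rightarrow> complex"
  assumes "continuous_on {0..} \<phi>" "inj_on \<phi> {0..}"
    and rec: "\<And>e M. e > 0 \<Longrightarrow> \<exists>t>M. \<forall>\<tau>\<in>{0..M}. dist (\<phi> (t + \<tau>)) (\<phi> \<tau>) < e"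
    and ab: "0 < a" "a < b"
  shows "\<exists>x y. a \<le> x \<and> x < y \<and> y \<le> b \<and>
    (\<forall>\<eta>>0. \<exists>u v. 0 \<le> u \<and> u \<le> v \<and> (\<forall>t\<in>{u..v}. infdist (\<phi> t) (\<phi> ` {a..b}) < \<eta>) \<and> 
       dist (\<phi> u) (\<phi> y) < \<eta> \<and> dist (\<phi> v) (\<phi> x) < \<eta>)"
proof (rule ccontr)
  assume contra: "\<not> ?thesis"
  interpret inj_curve \<phi> by unfold_locales (fact assms)+
  define s where "s = (a + b) / 2"
  have s: "a < s" "s < b" unfolding s_def using ab by auto
  define bad where "bad x y \<eta> \<longleftrightarrow> (\<exists>u v. 0 \<le> u \<and> u \<le> v \<and> (\<forall>t\<in>{u..v}. infdist (\<phi> t) (\<phi> ` {a..b}) < \<eta>) \<and> 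
       dist (\<phi> u) (\<phi> y) < \<eta> \<and> dist (\<phi> v) (\<phi> x) < \<eta>)" for x y \<eta>
  have ex: "\<exists>\<eta>>0. \<not> bad x y \<eta>" if "a \<le> x" "x < y" "y \<le> b" for x y
    using contra that unfolding bad_def by blast
  have mono: "bad x y \<eta>'" if "bad x y \<eta>" "\<eta> \<le> \<eta>'" for x y \<eta> \<eta>'
    using that unfolding bad_def by (meson order_less_le_trans)
  obtain e1 where e1: "e1 > 0" "\<not> bad a b e1" using ex[of a b] ab by auto
  obtain e2 where e2: "e2 > 0" "\<not> bad a s e2" using ex[of a s] s by auto
  obtain e3 where e3: "e3 > 0" "\<not> bad s b e3" using ex[of s b] s by auto
  have "closed (\<phi> ` {a..b})" "\<phi> ` {a..b} \<noteq> {}" "\<phi> 0 \<notin> \<phi> ` {a..b}" 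
    using compact_imp_closed[OF compact_arc[of a b]] ab eq_iff by auto
  then have e4: "infdist (\<phi> 0) (\<phi> ` {a..b}) > 0" using infdist_pos_not_in_closed by blast
  \<comment> \<open>The last entry provides the distance of \<open>\<phi> 0\<close> from the arc
    that \<open>not_recurrent\<close> asks for; it is positive because \<open>0 < a\<close>.\<close>
  define \<eta>0 where "\<eta>0 = min (min e1 e2) (min e3 (infdist (\<phi> 0) (\<phi> ` {a..b})))"
  have \<eta>0: "\<eta>0 > 0" "\<eta>0 \<le> e1" "\<eta>0 \<le> e2" "\<eta>0 \<le> e3" "\<eta>0 \<le> infdist (\<phi> 0) (\<phi> ` {a..b})"
    unfolding \<eta>0_def using e1 e2 e3 e4 by auto
  interpret no_back \<phi> a s b \<eta>0
  proof
    fix x y u v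
    assume *: "(x, y) \<in> {(a, b), (a, s), (s, b)}" "0 \<le> u" "u \<le> v"
      "\<And>t. t \<in> {u..v} \<Longrightarrow> infdist (\<phi> t) (\<phi> ` {a..b}) < \<eta>0" "dist (\<phi> u) (\<phi> y) < \<eta>0" "dist (\<phi> v) (\<phi> x) < \<eta>0"
    have "bad x y \<eta>0" unfolding bad_def using *(2-6) by blast
    then show False using *(1) e1 e2 e3 mono \<eta>0 by auto
  qed (use ab s \<eta>0 in auto)
  obtain r \<rho> \<eta>1 where "no_back_scales \<phi> a s b \<eta>0 r \<rho> \<eta>1" using scales_exist by blast
  then show False using no_back_scales.not_recurrent rec \<eta>0(5) by blast
qed

section \<open>Families of curves closed under switching\<close>

text \<open>Recurrence in metric form, uniform on compact time intervals. A single \<open>M\<close>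
  bounds both the window and the return time, since either may be enlarged.\<close>

definition returns :: "(real \<Rightarrow> 'a::metric_space) \<Rightarrow> bool" where
  "returns f \<longleftrightarrow> (\<forall>e>0. \<forall>M. \<exists>t>M. \<forall>\<tau>\<in>{0..M}. dist (f (t + \<tau>)) (f \<tau>) < e)"

lemma returns_seq:
  assumes "returns f"
  obtains t :: "nat \<Rightarrow> real" where "\<And>n. t n > real n" 
    "\<And>n \<tau>. 0 \<le> \<tau> \<Longrightarrow> \<tau> \<le> real n \<Longrightarrow> dist (f (t n + \<tau>)) (f \<tau>) < inverse (real (Suc n))"
proof -
  have "\<exists>t>real n. \<forall>\<tau>\<in>{0..real n}. dist (f (t + \<tau>)) (f \<tau>) < inverse (real (Suc n))" for n
    using assms unfolding returns_def by simp
  then obtain t where "\<And>n. t n > real n \<and> (\<forall>\<tau>\<in>{0..real n}. dist (f (t n + \<tau>)) (f \<tau>) < inverse (real (Suc n)))"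
    by metis
  then show ?thesis using that[of t] by auto
qed

text \<open>Continuous convergence along a filter. Cluster points along filters replace convergent subsequences, so
  that metrisability of the compact-open topology is not needed.\<close>

definition conv_along :: "(nat \<Rightarrow> real \<Rightarrow> 'a::topological_space) \<Rightarrow> (real \<Rightarrow> 'a) \<Rightarrow> nat filter \<Rightarrow> bool" where
  "conv_along f g F \<longleftrightarrow> (\<forall>F'\<le>F. \<forall>\<tau> l. (\<forall>n. 0 \<le> \<tau> n) \<longrightarrow> (\<tau> \<longlongrightarrow> l) F' \<longrightarrow> ((\<lambda>n. f n (\<tau> n)) \<longlongrightarrow> g l) F')"

lemma conv_along_at: "conv_along f g F \<Longrightarrow> 0 \<le> t \<Longrightarrow> ((\<lambda>n. f n t) \<longlongrightarrow> g t) F"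
  unfolding conv_along_def by (auto dest!: spec[of _ F] spec[of _ "\<lambda>_. t"])

lemma conv_along_seq: "conv_along f g F \<Longrightarrow> (\<And>n. 0 \<le> \<tau> n) \<Longrightarrow> (\<tau> \<longlongrightarrow> l) F \<Longrightarrow> ((\<lambda>n. f n (\<tau> n)) \<longlongrightarrow> g l) F"
  unfolding conv_along_def by blast

lemma conv_along_mono: "conv_along f g F \<Longrightarrow> F' \<le> F \<Longrightarrow> conv_along f g F'"
  unfolding conv_along_def using order_trans by blast

text \<open>The properties of a switched shift whose points have been embedded in a metric space.
  They are phrased through values at nonnegative times, with compactness as existence of cluster
  points along filters.\<close>

locale switching =
  fixes Y :: "(real \<Rightarrow> 'a::metric_space) set"
  assumes cont: "f \<in> Y \<Longrightarrow> continuous_on {0..} f"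
    and shift: "f \<in> Y \<Longrightarrow> 0 \<le> \<tau> \<Longrightarrow> \<exists>g\<in>Y. \<forall>t\<ge>0. g t = f (\<tau> + t)"
    and switch: "f \<in> Y \<Longrightarrow> g \<in> Y \<Longrightarrow> 0 < \<tau> \<Longrightarrow> f \<tau> = g \<tau> \<Longrightarrow>
      \<exists>h\<in>Y. (\<forall>t. 0 \<le> t \<and> t \<le> \<tau> \<longrightarrow> h t = f t) \<and> (\<forall>t\<ge>\<tau>. h t = g t)"
    and cluster: "(\<And>n. fs n \<in> Y) \<Longrightarrow> F \<noteq> bot \<Longrightarrow> \<exists>k\<in>Y. \<exists>F'\<le>F. F' \<noteq> bot \<and> conv_along fs k F'"
begin

text \<open>The switching axiom needs a positive time and the same time for both functions. Pasts of
  any prescribed length allow the two clocks to be aligned and a switch at time 0 to be moved to a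
  positive time.\<close>

definition backward_ext :: "(real \<Rightarrow> 'a) \<Rightarrow> bool" where
  "backward_ext f \<longleftrightarrow> f \<in> Y \<and> (\<forall>s\<ge>0. \<exists>g\<in>Y. \<forall>t\<ge>0. g (s + t) = f t)"

lemma backward_ext_shift:
  assumes "backward_ext f" "0 \<le> \<tau>"
  obtains g where "backward_ext g" "\<And>t. 0 \<le> t \<Longrightarrow> g t = f (\<tau> + t)"
proof -
  have "f \<in> Y" using assms(1) unfolding backward_ext_def by blast
  then obtain g where g: "g \<in> Y" "\<forall>t\<ge>0. g t = f (\<tau> + t)" using shift[OF _ assms(2)] by blast
  have "\<exists>k\<in>Y. \<forall>t\<ge>0. k (s + t) = g t" if s: "s \<ge> 0" for s
  proof -
    obtain h where h: "h \<in> Y" "\<forall>t\<ge>0. h (s + t) = f t" using assms s unfolding backward_ext_def by blast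
    obtain k where k: "k \<in> Y" "\<forall>t\<ge>0. k t = h (\<tau> + t)" using shift h(1) assms(2) by blast
    have "k (s + t) = g t" if "t \<ge> 0" for t
    proof -
      have "k (s + t) = h (s + (\<tau> + t))" using k(2) s that by (simp add: add.left_commute)
      then show ?thesis using h(2) g(2) that assms(2) by simp
    qed
    then show ?thesis using k(1) by blast
  qed
  then show ?thesis using that[of g] g unfolding backward_ext_def by blast
qed

lemma backward_ext_join:
  assumes "backward_ext f" "backward_ext g" "0 \<le> \<tau>" "0 \<le> c" "f \<tau> = g c"
  obtains h where "backward_ext h" "\<And>t. 0 \<le> t \<Longrightarrow> t \<le> \<tau> \<Longrightarrow> h t = f t" "\<And>t. 0 \<le> t \<Longrightarrow> h (\<tau> + t) = g (c + t)"
proof -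
  obtain g' where g': "backward_ext g'" "\<And>t. 0 \<le> t \<Longrightarrow> g' t = g (c + t)" using backward_ext_shift assms by blast
  \<comment> \<open>Both functions receive pasts that put \<open>f \<tau> = g c\<close> at the
    common time \<open>s + \<tau> > 0\<close>. The values after time \<open>s\<close> are the same
    for every \<open>s\<close>, so these functions are also the pasts of the joined one.\<close>
  have ex: "\<exists>k\<in>Y. (\<forall>t. 0 \<le> t \<and> t \<le> \<tau> \<longrightarrow> k (s + t) = f t) \<and> (\<forall>t\<ge>0. k (s + (\<tau> + t)) = g (c + t))" if s: "s > 0" for s
  proof -
    obtain f1 where f1: "f1 \<in> Y" "\<forall>t\<ge>0. f1 (s + t) = f t" using assms s unfolding backward_ext_def by (meson less_imp_le)
    have "0 \<le> s + \<tau>" using s assms by simp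
    then obtain g1 where g1: "g1 \<in> Y" "\<forall>t\<ge>0. g1 (s + \<tau> + t) = g' t" using g'(1) unfolding backward_ext_def by blast
    have "f1 (s + \<tau>) = g1 (s + \<tau>)" using f1(2) g1(2) assms g'(2)[of 0] by (metis add.right_neutral order_refl)
    then obtain k where k: "k \<in> Y" "\<forall>t. 0 \<le> t \<and> t \<le> s + \<tau> \<longrightarrow> k t = f1 t" "\<forall>t\<ge>s + \<tau>. k t = g1 t"
      using switch[OF f1(1) g1(1), of "s + \<tau>"] s assms by auto
    show ?thesis
    proof (intro bexI[of _ k] conjI allI impI)
      show "k (s + t) = f t" if "0 \<le> t \<and> t \<le> \<tau>" for t using k(2) f1(2) that s by simp
      show "k (s + (\<tau> + t)) = g (c + t)" if "t \<ge> 0" for t 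
        using k(3)[rule_format, of "s + \<tau> + t"] g1(2) g'(2)[of t] that by (simp add: add.assoc)
    qed (rule k(1))
  qed
  obtain k where k: "k \<in> Y" "\<forall>t. 0 \<le> t \<and> t \<le> \<tau> \<longrightarrow> k (1 + t) = f t" "\<forall>t\<ge>0. k (1 + (\<tau> + t)) = g (c + t)"
    using ex[of 1] by auto
  obtain h where h: "h \<in> Y" "\<forall>t\<ge>0. h t = k (1 + t)" using shift[OF k(1), of 1] by auto
  have h1: "h t = f t" if "0 \<le> t" "t \<le> \<tau>" for t using h k that by simp
  have h2: "h (\<tau> + t) = g (c + t)" if "0 \<le> t" for t using h k that assms by simp
  have "\<exists>k\<in>Y. \<forall>t\<ge>0. k (s + t) = h t" if s: "s \<ge> 0" for s
  proof (cases "s = 0")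
    case True
    then show ?thesis using h(1) by (intro bexI[of _ h]) auto
  next
    case False
    then obtain k' where k': "k' \<in> Y" "\<forall>t. 0 \<le> t \<and> t \<le> \<tau> \<longrightarrow> k' (s + t) = f t" "\<forall>t\<ge>0. k' (s + (\<tau> + t)) = g (c + t)"
      using ex[of s] s by auto
    have "k' (s + t) = h t" if "t \<ge> 0" for t
    proof (cases "t \<le> \<tau>")
      case True
      then show ?thesis using k'(2) h1 that by simp
    next
      case False
      then show ?thesis using k'(3)[rule_format, of "t - \<tau>"] h2[of "t - \<tau>"] by simp
    qed
    then show ?thesis using k'(1) by blast
  qed
  then have "backward_ext h" unfolding backward_ext_def using h(1) by blast
  then show ?thesis using that h1 h2 by blast
qed

text \<open>The pasts of the \<open>f n\<close> have a cluster point along a still finer filter;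
  after time \<open>s\<close> it agrees with \<open>g\<close> by uniqueness of limits.\<close>

lemma backward_ext_cluster:
  assumes f: "\<And>n. backward_ext (f n)" and "F \<noteq> bot"
  obtains g F' where "backward_ext g" "F' \<le> F" "F' \<noteq> bot" "conv_along f g F'"
proof -
  obtain g F1 where g: "g \<in> Y" "F1 \<le> F" "F1 \<noteq> bot" "conv_along f g F1"
    using cluster[of f F] assms unfolding backward_ext_def by blast
  have "\<exists>k\<in>Y. \<forall>t\<ge>0. k (s + t) = g t" if s: "s \<ge> 0" for s
  proof -
    have "\<exists>h. \<forall>n. h n \<in> Y \<and> (\<forall>t\<ge>0. h n (s + t) = f n t)"
      using f s unfolding backward_ext_def by (intro choice) blast
    then obtain h where h: "\<And>n. h n \<in> Y" "\<And>n t. t \<ge> 0 \<Longrightarrow> h n (s + t) = f n t" by blast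
    obtain k F2 where k: "k \<in> Y" "F2 \<le> F1" "F2 \<noteq> bot" "conv_along h k F2"
      using cluster[of h F1] h(1) g(3) by blast
    have "k (s + t) = g t" if t: "t \<ge> 0" for t
    proof -
      have "((\<lambda>n. h n (s + t)) \<longlongrightarrow> k (s + t)) F2" using conv_along_at[OF k(4)] s t by simp
      moreover have "((\<lambda>n. h n (s + t)) \<longlongrightarrow> g t) F2"
        using conv_along_at[OF conv_along_mono[OF g(4) k(2)] t] h(2)[OF t] by simp
      ultimately show ?thesis using k(3) tendsto_unique by blast
    qed
    then show ?thesis using k(1) by blast
  qed
  then have "backward_ext g" unfolding backward_ext_def using g(1) by blast
  then show ?thesis using that g by blast
qed

text \<open>Started a time \<open>s\<close> before ever better returns, \<open>f\<close> gives
  functions whose continuations after \<open>s\<close> tend to \<open>f\<close>; a cluster point of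
  them continues exactly as \<open>f\<close>.\<close>

lemma returns_backward_ext:
  assumes "f \<in> Y" "returns f"
  shows "backward_ext f"
proof -
  obtain T where T: "\<And>n. T n > real n" 
    "\<And>n \<tau>. 0 \<le> \<tau> \<Longrightarrow> \<tau> \<le> real n \<Longrightarrow> dist (f (T n + \<tau>)) (f \<tau>) < inverse (real (Suc n))"
    using returns_seq[OF assms(2)] by blast
  have "\<exists>k\<in>Y. \<forall>t\<ge>0. k (s + t) = f t" if s: "s \<ge> 0" for s
  proof -
    \<comment> \<open>\<open>max 0\<close> keeps the shift admissible for the finitely many
      \<open>n\<close> with \<open>T n < s\<close>.\<close>
    have "\<exists>h. \<forall>n. h n \<in> Y \<and> (\<forall>t\<ge>0. h n t = f (max 0 (T n - s) + t))"
    proof (intro choice allI)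
      fix n
      show "\<exists>y. y \<in> Y \<and> (\<forall>t\<ge>0. y t = f (max 0 (T n - s) + t))"
        using shift[OF assms(1), of "max 0 (T n - s)"] by auto
    qed
    then obtain h where h: "\<And>n. h n \<in> Y" "\<And>n t. t \<ge> 0 \<Longrightarrow> h n t = f (max 0 (T n - s) + t)" by blast
    obtain k F where k: "k \<in> Y" "F \<le> sequentially" "F \<noteq> bot" "conv_along h k F"
      using cluster[of h sequentially] h(1) by auto
    have "k (s + t) = f t" if t: "t \<ge> 0" for t
    proof -
      have "((\<lambda>n. h n (s + t)) \<longlongrightarrow> k (s + t)) F" using conv_along_at[OF k(4)] s t by simp
      moreover have "(\<lambda>n. h n (s + t)) \<longlonglongrightarrow> f t"
      proof (rule metric_tendsto_imp_tendsto[OF LIMSEQ_inverse_real_of_nat])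
        have "\<forall>\<^sub>F n in sequentially. real n \<ge> max s t"
          using filterlim_real_sequentially unfolding filterlim_at_top by blast
        then show "\<forall>\<^sub>F n in sequentially. dist (h n (s + t)) (f t) \<le> dist (inverse (real (Suc n))) 0"
        proof eventually_elim
          case (elim n)
          then have "max 0 (T n - s) = T n - s" using T(1)[of n] by simp
          then have "h n (s + t) = f (T n + t)" using h(2)[of "s + t" n] s t by simp
          then show ?case using T(2)[of t n] t elim by simp
        qed
      qed
      then have "((\<lambda>n. h n (s + t)) \<longlongrightarrow> f t) F" using k(2) tendsto_mono by blast
      ultimately show ?thesis using k(3) tendsto_unique by blast
    qed
    then show ?thesis using k(1) by blast
  qed
  then show ?thesis unfolding backward_ext_def using assms by blast
qed

text \<open>Here \<open>p * frac (t / p)\<close> is \<open>t\<close> modulo \<open>p\<close>.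
  Repeated joining gives any finite number of periods, and a cluster point gives the endless
  repetition.\<close>

lemma backward_ext_loop:
  assumes f: "backward_ext f" and p: "p > 0" "f p = f 0"
  obtains g where "backward_ext g" "\<And>t. 0 \<le> t \<Longrightarrow> g t = f (p * frac (t / p))"
proof -
  define P where "P t = f (p * frac (t / p))" for t
  have Pf: "P t = f t" if "0 \<le> t" "t \<le> p" for t
  proof (cases "t = p")
    case True
    then show ?thesis unfolding P_def using p by simp
  next
    case False
    then have "frac (t / p) = t / p" using that p by (simp add: frac_eq)
    then show ?thesis unfolding P_def using p by simp
  qed
  have Pp: "P (p + t) = P t" for t
  proof -
    have "(p + t) / p = t / p + 1" using p by (simp add: add_divide_distrib)
    then show ?thesis unfolding P_def by (simp add: frac_1_eq)
  qed
  have "\<exists>g. backward_ext g \<and> (\<forall>t. 0 \<le> t \<and> t \<le> real n * p \<longrightarrow> g t = P t) \<and> g 0 = f 0" for n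
  proof (induction n)
    case 0
    then show ?case using f Pf[of 0] p by (intro exI[of _ f]) auto
  next
    case (Suc n)
    then obtain g where g: "backward_ext g" "\<forall>t. 0 \<le> t \<and> t \<le> real n * p \<longrightarrow> g t = P t" "g 0 = f 0" by blast
    obtain h where h: "backward_ext h" "\<And>t. 0 \<le> t \<Longrightarrow> t \<le> p \<Longrightarrow> h t = f t" "\<And>t. 0 \<le> t \<Longrightarrow> h (p + t) = g (0 + t)"
      using backward_ext_join[OF f g(1), of p 0] p g(3) by auto
    have "h t = P t" if "0 \<le> t" "t \<le> real (Suc n) * p" for t
    proof (cases "t \<le> p")
      case True
      then show ?thesis using h(2) Pf that by simp
    next
      case False
      then have "h t = g (t - p)" using h(3)[of "t - p"] by simp
      also have "\<dots> = P (t - p)" using g(2) False that by (simp add: algebra_simps)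
      also have "\<dots> = P t" using Pp[of "t - p"] by simp
      finally show ?thesis .
    qed
    moreover have "h 0 = f 0" using h(2)[of 0] p by simp
    ultimately show ?case using h by (intro exI[of _ h]) blast
  qed
  then have "\<exists>g. \<forall>n. backward_ext (g n) \<and> (\<forall>t. 0 \<le> t \<and> t \<le> real n * p \<longrightarrow> g n t = P t)"
    by (intro choice) blast
  then obtain g where g: "\<And>n. backward_ext (g n)" "\<And>n t. 0 \<le> t \<Longrightarrow> t \<le> real n * p \<Longrightarrow> g n t = P t" by blast
  obtain h F where h: "backward_ext h" "F \<le> sequentially" "F \<noteq> bot" "conv_along g h F"
    using backward_ext_cluster[of g sequentially] g(1) by auto
  have "h t = P t" if t: "0 \<le> t" for t
  proof -
    have "\<forall>\<^sub>F n in sequentially. real n \<ge> t / p"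
      using filterlim_real_sequentially unfolding filterlim_at_top by blast
    then have "\<forall>\<^sub>F n in sequentially. g n t = P t"
      by eventually_elim (use g(2) t p in \<open>simp add: field_simps\<close>)
    then have "(\<lambda>n. g n t) \<longlonglongrightarrow> P t" by (rule tendsto_eventually)
    then have "((\<lambda>n. g n t) \<longlongrightarrow> P t) F" using h(2) tendsto_mono by blast
    then show ?thesis using conv_along_at[OF h(4) t] h(3) tendsto_unique by blast
  qed
  then show ?thesis using that h(1) unfolding P_def by blast
qed

lemma noninjective_preperiodic:
  assumes f: "backward_ext f" and t: "0 \<le> t1" "t1 < t2" "f t1 = f t2"
  obtains g T p where "g \<in> Y" "g 0 = f 0" "0 \<le> T" "0 < p" "\<And>t. T \<le> t \<Longrightarrow> g (t + p) = g t"
proof -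
  obtain f1 where f1: "backward_ext f1" "\<And>t. 0 \<le> t \<Longrightarrow> f1 t = f (t1 + t)" using backward_ext_shift[OF f t(1)] by blast
  define p where "p = t2 - t1"
  have p: "p > 0" "f1 p = f1 0" using t f1 unfolding p_def by auto
  obtain g where g: "backward_ext g" "\<And>t. 0 \<le> t \<Longrightarrow> g t = f1 (p * frac (t / p))" using backward_ext_loop[OF f1(1) p] by blast
  obtain h where h: "backward_ext h" "\<And>t. 0 \<le> t \<Longrightarrow> t \<le> t1 \<Longrightarrow> h t = f t" "\<And>t. 0 \<le> t \<Longrightarrow> h (t1 + t) = g (0 + t)"
    using backward_ext_join[OF f g(1), of t1 0] t f1(2)[of 0] g(2)[of 0] by auto
  have "h (t + p) = h t" if "t1 \<le> t" for t
  proof -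
    have "(t - t1 + p) / p = (t - t1) / p + 1" using p by (simp add: add_divide_distrib)
    then have "g (t - t1 + p) = g (t - t1)" using g(2) that p by (simp add: frac_1_eq)
    then show ?thesis using h(3)[of "t - t1"] h(3)[of "t - t1 + p"] that p by (simp add: algebra_simps)
  qed
  then show ?thesis using that[of h t1 p] h t p unfolding backward_ext_def by simp
qed


lemma backward_ext_in: "backward_ext f \<Longrightarrow> f \<in> Y"
  unfolding backward_ext_def by blast

end

text \<open>The points \<open>w n\<close> need not converge along \<open>F\<close>. Instead
  \<open>p\<close> lies in the closed image of every compact neighbourhood of \<open>A\<close>, and
  preimages of \<open>p\<close> in shrinking neighbourhoods accumulate at a point of
  \<open>A\<close>.\<close>

lemma limit_near_compact:
  fixes G :: "'c::heine_borel \<Rightarrow> 'a::metric_space"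
  assumes G: "continuous_on UNIV G" and A: "compact A" "A \<noteq> {}" and "F \<noteq> bot" "F \<le> sequentially"
    and near: "\<forall>\<^sub>F n in F. infdist (w n) A < inverse (real (Suc n))" and lim: "((\<lambda>n. G (w n)) \<longlongrightarrow> p) F"
  shows "p \<in> G ` A"
proof -
  have "\<exists>z. infdist z A \<le> inverse (real (Suc m)) \<and> G z = p" for m
  proof -
    define K where "K = {z. infdist z A \<le> inverse (real (Suc m))}"
    have "compact K" unfolding K_def using compact_infdist_le[OF A(2,1)] by simp
    then have "closed (G ` K)" using G by (intro compact_imp_closed compact_continuous_image continuous_on_subset[OF G]) auto
    moreover have "\<forall>\<^sub>F n in F. n \<ge> m" using assms(5) eventually_ge_at_top filter_leD by blast
    with near have "\<forall>\<^sub>F n in F. G (w n) \<in> G ` K"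
    proof eventually_elim
      case (elim n)
      then have "inverse (real (Suc n)) \<le> inverse (real (Suc m))" by (simp add: le_imp_inverse_le)
      then have "w n \<in> K" unfolding K_def using elim(1) by (intro CollectI) linarith
      then show ?case by blast
    qed
    ultimately have "p \<in> G ` K" by (rule Lim_in_closed_set[OF _ _ assms(4) lim])
    then show ?thesis unfolding K_def by blast
  qed
  then obtain z where z: "\<And>m. infdist (z m) A \<le> inverse (real (Suc m))" "\<And>m. G (z m) = p" by metis
  have "compact {z. infdist z A \<le> 1}" using compact_infdist_le[OF A(2,1)] by simp
  moreover have "z m \<in> {z. infdist z A \<le> 1}" for m
    using z(1)[of m] le_imp_inverse_le[of 1 "real (Suc m)"] by simp
  ultimately obtain l r where l: "strict_mono (r :: nat \<Rightarrow> nat)" "(z \<circ> r) \<longlonglongrightarrow> l"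
    unfolding compact_def by blast
  have "(\<lambda>m. infdist ((z \<circ> r) m) A) \<longlonglongrightarrow> infdist l A"
    using l(2) by (intro tendsto_infdist)
  moreover have "(\<lambda>m. infdist ((z \<circ> r) m) A) \<longlonglongrightarrow> 0"
  proof (rule tendsto_sandwich[OF _ _ tendsto_const])
    show "((\<lambda>m. inverse (real (Suc (r m)))) \<longlonglongrightarrow> 0)"
      using LIMSEQ_subseq_LIMSEQ[OF LIMSEQ_inverse_real_of_nat l(1)] by (simp add: o_def)
  qed (use z in \<open>auto simp: infdist_nonneg\<close>)
  ultimately have "infdist l A = 0" using LIMSEQ_unique by blast
  then have "l \<in> A" using in_closed_iff_infdist_zero[of A l] A compact_imp_closed by blast
  moreover have "(\<lambda>m. G ((z \<circ> r) m)) \<longlonglongrightarrow> G l"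
    by (rule continuous_on_tendsto_compose[OF G l(2)]) simp_all
  then have "G l = p" using z(2) LIMSEQ_unique[OF _ tendsto_const[of p]] by (simp add: o_def)
  ultimately show ?thesis by blast
qed

lemma real_seq_dichotomy:
  fixes L :: "nat \<Rightarrow> real"
  assumes "\<And>n. 0 \<le> L n"
  obtains r where "strict_mono (r :: nat \<Rightarrow> nat)" "filterlim (L \<circ> r) at_top sequentially"
  | r l where "strict_mono (r :: nat \<Rightarrow> nat)" "(L \<circ> r) \<longlonglongrightarrow> l"
proof (cases "filterlim L at_top sequentially")
  case True
  then show ?thesis using that(1)[of id] by (simp add: strict_mono_id)
next
  case False
  then obtain M where "\<not> (\<forall>\<^sub>F n in sequentially. M \<le> L n)" unfolding filterlim_at_top by blast
  then have "\<exists>n>N. L n < M" for N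
    unfolding eventually_sequentially by (metis less_le_not_le linorder_not_less lessI order_trans)
  then have "infinite {n. L n < M}" unfolding infinite_nat_iff_unbounded by blast
  then obtain r :: "nat \<Rightarrow> nat" where r: "strict_mono r" "\<And>n. r n \<in> {n. L n < M}"
    using infinite_enumerate by blast
  have "(L \<circ> r) n \<in> {0..M}" for n using r(2)[of n] assms[of "r n"] by simp
  then obtain l r' where "strict_mono (r' :: nat \<Rightarrow> nat)" "((L \<circ> r) \<circ> r') \<longlonglongrightarrow> l"
    using compact_Icc[of 0 M] unfolding compact_def by blast
  then show ?thesis using that(2)[of "r \<circ> r'" l] r(1) by (simp add: strict_mono_o o_assoc)
qed

section \<open>Limits of backward pieces and the constant element\<close>

context switching begin

text \<open>The durations of the backward pieces decide. If they tend to infinity along a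
  subsequence, the cluster point \<open>g\<close> itself stays in the arc. If they converge to
  \<open>l\<close>, then \<open>g\<close> leads from \<open>f y\<close> to \<open>f x\<close> in
  time \<open>l\<close>, and \<open>f\<close> leads back from time \<open>x\<close> to time
  \<open>y\<close>.\<close>

lemma stays_in_arc:
  fixes G :: "complex \<Rightarrow> 'a" and \<psi> :: "real \<Rightarrow> complex"
  assumes f: "backward_ext f" "inj_on f {0..}" and G: "continuous_on UNIV G" and \<psi>: "continuous_on {0..} \<psi>" 
    and eq: "\<And>t. 0 \<le> t \<Longrightarrow> G (\<psi> t) = f t" and ab: "0 < a" "a \<le> x" "x < y" "y \<le> b"
    and passes: "\<And>\<eta>. \<eta> > 0 \<Longrightarrow> \<exists>u v. 0 \<le> u \<and> u \<le> v \<and> (\<forall>t\<in>{u..v}. infdist (\<psi> t) (\<psi> ` {a..b}) < \<eta>) \<and> 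
       dist (\<psi> u) (\<psi> y) < \<eta> \<and> dist (\<psi> v) (\<psi> x) < \<eta>"
  obtains g where "g \<in> Y" "\<And>t. 0 \<le> t \<Longrightarrow> g t \<in> f ` {a..b}"
proof -
  define A where "A = \<psi> ` {a..b}"
  have A: "compact A" "A \<noteq> {}" unfolding A_def using ab 
    by (auto intro!: compact_continuous_image continuous_on_subset[OF \<psi>])
  have GA: "G ` A = f ` {a..b}" unfolding A_def image_image using eq ab by (intro image_cong) auto
  have "\<exists>u v. 0 \<le> u \<and> u \<le> v \<and> (\<forall>t\<in>{u..v}. infdist (\<psi> t) A < inverse (real (Suc n))) \<and> 
       dist (\<psi> u) (\<psi> y) < inverse (real (Suc n)) \<and> dist (\<psi> v) (\<psi> x) < inverse (real (Suc n))" for n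
    unfolding A_def by (rule passes) simp
  then obtain u0 v0 where uv0: "\<And>n. 0 \<le> u0 n" "\<And>n. u0 n \<le> v0 n" "\<And>n t. u0 n \<le> t \<Longrightarrow> t \<le> v0 n \<Longrightarrow> infdist (\<psi> t) A < inverse (real (Suc n))"
    "\<And>n. dist (\<psi> (u0 n)) (\<psi> y) < inverse (real (Suc n))" "\<And>n. dist (\<psi> (v0 n)) (\<psi> x) < inverse (real (Suc n))"
    by (metis atLeastAtMost_iff)
  obtain r where r: "strict_mono (r :: nat \<Rightarrow> nat)" 
    "filterlim ((\<lambda>n. v0 n - u0 n) \<circ> r) at_top sequentially \<or> (\<exists>l. ((\<lambda>n. v0 n - u0 n) \<circ> r) \<longlonglongrightarrow> l)"
    using real_seq_dichotomy[of "\<lambda>n. v0 n - u0 n"] uv0(2) by (metis diff_ge_0_iff_ge)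
  define u v L where "u = u0 \<circ> r" and "v = v0 \<circ> r" and "L n = v n - u n" for n
  have le: "inverse (real (Suc (r n))) \<le> inverse (real (Suc n))" for n
    using seq_suble[OF r(1), of n] by (simp add: le_imp_inverse_le)
  have uv: "\<And>n. 0 \<le> u n" "\<And>n. u n \<le> v n" 
    unfolding u_def v_def using uv0(1,2) by auto
  have near: "infdist (\<psi> t) A < inverse (real (Suc n))" if "u n \<le> t" "t \<le> v n" for n t
    by (rule order_less_le_trans[OF uv0(3) le]) (use that in \<open>simp_all add: u_def v_def\<close>)
  have du: "dist (\<psi> (u n)) (\<psi> y) < inverse (real (Suc n))" for n
    using order_less_le_trans[OF uv0(4) le[of n]] unfolding u_def o_def .
  have dv: "dist (\<psi> (v n)) (\<psi> x) < inverse (real (Suc n))" for n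
    using order_less_le_trans[OF uv0(5) le[of n]] unfolding v_def o_def .
  have tend: "(\<lambda>n. f (w n)) \<longlonglongrightarrow> f z" if w: "\<And>n. 0 \<le> w n" "0 \<le> z" "\<And>n. dist (\<psi> (w n)) (\<psi> z) < inverse (real (Suc n))" for w z
  proof -
    have "(\<lambda>n. \<psi> (w n)) \<longlonglongrightarrow> \<psi> z"
      by (rule metric_tendsto_imp_tendsto[OF LIMSEQ_inverse_real_of_nat]) (use w in \<open>auto intro!: always_eventually less_imp_le\<close>)
    then have "(\<lambda>n. G (\<psi> (w n))) \<longlonglongrightarrow> G (\<psi> z)"
      by (rule continuous_on_tendsto_compose[OF G]) simp_all
    then show ?thesis using eq w by simp
  qed
  have Ldich: "filterlim L at_top sequentially \<or> (\<exists>l. L \<longlonglongrightarrow> l)"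
    using r(2) unfolding L_def u_def v_def o_def by simp
  have "\<exists>h. \<forall>n. backward_ext (h n) \<and> (\<forall>t\<ge>0. h n t = f (u n + t))"
    using backward_ext_shift[OF f(1)] uv(1) by (intro choice allI) metis
  then obtain h where h: "\<And>n. backward_ext (h n)" "\<And>n t. 0 \<le> t \<Longrightarrow> h n t = f (u n + t)" by blast
  obtain g F where g: "backward_ext g" "F \<le> sequentially" "F \<noteq> bot" "conv_along h g F"
    using backward_ext_cluster[of h sequentially] h(1) by auto
  have K: "g t \<in> f ` {a..b}" if "0 \<le> t" "\<forall>\<^sub>F n in sequentially. t \<le> L n" for t
  proof -
    have "\<forall>\<^sub>F n in F. t \<le> L n" using that(2) g(2) filter_leD by blast
    then have "\<forall>\<^sub>F n in F. infdist (\<psi> (u n + t)) A < inverse (real (Suc n))"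
    proof eventually_elim
      case (elim n)
      then show ?case using near[of n "u n + t"] that(1) unfolding L_def by simp
    qed
    moreover have "((\<lambda>n. G (\<psi> (u n + t))) \<longlongrightarrow> g t) F"
      using conv_along_at[OF g(4) that(1)] h(2) uv(1) that(1) eq by simp
    ultimately have "g t \<in> G ` A" by (rule limit_near_compact[OF G A g(3,2)])
    then show ?thesis using GA by simp
  qed
  show ?thesis
  proof (cases "filterlim L at_top sequentially")
    case True
    then have "\<forall>\<^sub>F n in sequentially. t \<le> L n" for t unfolding filterlim_at_top by blast
    then show ?thesis using that[of g] K backward_ext_in[OF g(1)] by blast
  next
    case False
    then obtain l where l: "L \<longlonglongrightarrow> l" using Ldich by blast
    have L0: "0 \<le> L n" for n unfolding L_def using uv(2)[of n] by simp
    have l0: "0 \<le> l" using L0 l LIMSEQ_le_const by blast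
    have "((\<lambda>n. h n (L n)) \<longlongrightarrow> g l) F"
      by (rule conv_along_seq[OF g(4) L0 tendsto_mono[OF g(2) l]])
    moreover have "h n (L n) = f (v n)" for n using h(2)[OF L0] unfolding L_def by simp
    ultimately have "((\<lambda>n. f (v n)) \<longlongrightarrow> g l) F" by simp
    moreover have "0 \<le> v n" for n using uv[of n] by linarith
    then have "((\<lambda>n. f (v n)) \<longlongrightarrow> f x) F"
      using tendsto_mono[OF g(2) tend[of v x]] dv ab by simp
    ultimately have gl: "g l = f x" using tendsto_unique[OF g(3)] by blast
    have "((\<lambda>n. h n 0) \<longlongrightarrow> g 0) F" using conv_along_at[OF g(4)] by simp
    moreover have "h n 0 = f (u n)" for n using h(2)[of 0] by simp
    ultimately have "((\<lambda>n. f (u n)) \<longlongrightarrow> g 0) F" by simp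
    moreover have "((\<lambda>n. f (u n)) \<longlongrightarrow> f y) F"
      using tendsto_mono[OF g(2) tend[of u y]] du uv(1) ab by simp
    ultimately have gy: "g 0 = f y" using tendsto_unique[OF g(3)] by blast
    \<comment> \<open>For \<open>t < l\<close> the pieces eventually last longer than
      \<open>t\<close>. This may fail at \<open>t = l\<close>, where the known value
      \<open>g l = f x\<close> is used.\<close>
    have gin: "g t \<in> f ` {a..b}" if t: "0 \<le> t" "t \<le> l" for t
    proof (cases "t = l")
      case True
      then show ?thesis using gl ab by auto
    next
      case False
      then have "\<forall>\<^sub>F n in sequentially. t < L n" using t l by (intro order_tendstoD(1)[OF l]) auto
      then show ?thesis using K[OF t(1)] by (simp add: eventually_mono)
    qed
    obtain k where k: "backward_ext k" "\<And>t. 0 \<le> t \<Longrightarrow> t \<le> l \<Longrightarrow> k t = g t" "\<And>t. 0 \<le> t \<Longrightarrow> k (l + t) = f (x + t)"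
      using backward_ext_join[OF g(1) f(1) l0, of x] gl ab by auto
    \<comment> \<open>Positive by \<open>x < y\<close>, whatever the value of
      \<open>l \<ge> 0\<close>.\<close>
    define p where "p = l + (y - x)"
    have p: "p > 0" unfolding p_def using l0 ab by simp
    have "k p = k 0" unfolding p_def using k(2)[of 0] k(3)[of "y - x"] gy l0 ab by simp
    then obtain m where m: "backward_ext m" "\<And>t. 0 \<le> t \<Longrightarrow> m t = k (p * frac (t / p))" using backward_ext_loop[OF k(1) p] by blast
    have kin: "k t \<in> f ` {a..b}" if "0 \<le> t" "t \<le> p" for t
    proof (cases "t \<le> l")
      case True
      then show ?thesis using k(2) gin that by simp
    next
      case False
      then have "k t = f (x + (t - l))" using k(3)[of "t - l"] by simp
      then show ?thesis using that False ab unfolding p_def by auto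
    qed
    have "m t \<in> f ` {a..b}" if "0 \<le> t" for t
    proof -
      have "frac (t / p) \<le> 1" using frac_lt_1 less_imp_le by blast
      then have "p * frac (t / p) \<le> p" using p by (simp add: mult_left_le)
      then show ?thesis using m(2)[OF that] kin p by simp
    qed
    then show ?thesis using that[of m] backward_ext_in[OF m(1)] by blast
  qed
qed

theorem injective_constant:
  fixes G :: "complex \<Rightarrow> 'a" and \<psi> :: "real \<Rightarrow> complex"
  assumes f: "f \<in> Y" "returns f" "inj_on f {0..}" and G: "continuous_on UNIV G" 
    and \<psi>: "continuous_on {0..} \<psi>" "returns \<psi>" and eq: "\<And>t. 0 \<le> t \<Longrightarrow> G (\<psi> t) = f t"
  obtains g where "g \<in> Y" "\<And>t. 0 \<le> t \<Longrightarrow> g t = f 0"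
proof -
  have inj: "inj_on \<psi> {0..}"
  proof (rule inj_onI)
    fix s t :: real assume "s \<in> {0..}" "t \<in> {0..}" "\<psi> s = \<psi> t"
    then show "s = t" using eq[of s] eq[of t] f(3) unfolding inj_on_def by auto
  qed
  have bf: "backward_ext f" using returns_backward_ext f by blast
  have ex: "\<exists>g\<in>Y. \<forall>t\<ge>0. g t \<in> f ` {a..b}" if ab: "0 < a" "a < b" for a b
  proof -
    obtain x y where xy: "a \<le> x" "x < y" "y \<le> b" 
      "\<forall>\<eta>>0. \<exists>u v. 0 \<le> u \<and> u \<le> v \<and> (\<forall>t\<in>{u..v}. infdist (\<psi> t) (\<psi> ` {a..b}) < \<eta>) \<and> 
         dist (\<psi> u) (\<psi> y) < \<eta> \<and> dist (\<psi> v) (\<psi> x) < \<eta>"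
      using backward_pass[OF \<psi>(1) inj _ ab] \<psi>(2) unfolding returns_def by blast
    obtain g where "g \<in> Y" "\<And>t. 0 \<le> t \<Longrightarrow> g t \<in> f ` {a..b}"
      using stays_in_arc[OF bf f(3) G \<psi>(1) eq ab(1) xy(1-3)] xy(4) by blast
    then show ?thesis by blast
  qed
  \<comment> \<open>The arcs over \<open>[d n / 2, d n]\<close> shrink to time 0 but start at a
    positive time, as \<open>backward_pass\<close> requires.\<close>
  define d where "d n = inverse (real (Suc n))" for n
  have d: "d n > 0" "d \<longlonglongrightarrow> 0" for n unfolding d_def using LIMSEQ_inverse_real_of_nat by auto
  have "\<exists>h. \<forall>n. h n \<in> Y \<and> (\<forall>t\<ge>0. h n t \<in> f ` {d n / 2..d n})"
  proof (intro choice allI)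
    fix n
    show "\<exists>y. y \<in> Y \<and> (\<forall>t\<ge>0. y t \<in> f ` {d n / 2..d n})"
      using ex[of "d n / 2" "d n"] d(1)[of n] by auto
  qed
  then obtain h where h: "\<And>n. h n \<in> Y" "\<And>n t. 0 \<le> t \<Longrightarrow> h n t \<in> f ` {d n / 2..d n}" by blast
  obtain g F where g: "g \<in> Y" "F \<le> sequentially" "F \<noteq> bot" "conv_along h g F"
    using cluster[of h sequentially] h(1) by auto
  have "g t = f 0" if t: "0 \<le> t" for t
  proof -
    have "\<exists>c. c \<in> {d n / 2..d n} \<and> h n t = f c" for n using h(2)[OF t] by blast
    then obtain c where c: "\<And>n. c n \<in> {d n / 2..d n}" "\<And>n. h n t = f (c n)" by metis
    have c0: "0 \<le> c n" "c n \<le> d n" for n using c(1)[of n] d(1)[of n] by auto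
    have "c \<longlonglongrightarrow> 0" by (rule tendsto_sandwich[OF _ _ tendsto_const d(2)]) (use c0 in auto)
    then have "(\<lambda>n. f (c n)) \<longlonglongrightarrow> f 0"
      using continuous_on_tendsto_compose[OF cont[OF f(1)], of c 0 sequentially] c0 by simp
    then have "((\<lambda>n. h n t) \<longlongrightarrow> f 0) F" using c(2) g(2) tendsto_mono by auto
    then show ?thesis using conv_along_at[OF g(4) t] g(3) tendsto_unique by blast
  qed
  then show ?thesis using that g(1) by blast
qed

end

section \<open>Coordinates on the sphere and the projective plane\<close>

text \<open>Each time interval \<open>{0..n}\<close> has a compact image homeomorphic to an
  interval, hence without interior in the sphere; Baire's theorem leaves a point uncovered.\<close>

lemma sphere_not_covered:
  fixes f :: "real \<Rightarrow> real^3"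
  assumes f: "continuous_on {0..} f" "inj_on f {0..}" "\<And>t. 0 \<le> t \<Longrightarrow> f t \<in> sphere 0 1"
  obtains q where "q \<in> sphere 0 1" "q \<notin> f ` {0..}"
proof -
  define G where "G n = sphere 0 1 - f ` {0..real n}" for n
  have cpt: "compact (f ` {0..real n})" for n
    using f(1) by (intro compact_continuous_image continuous_on_subset[OF f(1)]) auto
  have "f ` {0..real n} \<subseteq> sphere 0 1" for n using f(3) by force
  then have op: "openin (top_of_set (sphere 0 1)) (G n)" for n
    unfolding G_def by (intro openin_diff closed_subset compact_imp_closed[OF cpt]) auto
  have dense: "sphere 0 1 \<subseteq> closure (G n)" for n
  proof (rule ccontr)
    assume neg: "\<not> ?thesis"
    define U where "U = sphere 0 1 \<inter> - closure (G n)"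
    have U: "U \<noteq> {}" "openin (top_of_set (sphere 0 1)) U" using neg unfolding U_def by (auto simp: openin_open_Int)
    have Usub: "U \<subseteq> f ` {0..real n}" unfolding U_def G_def using closure_subset by blast
    obtain g where g: "homeomorphism {0..real n} (f ` {0..real n}) f g"
      using homeomorphism_compact[of "{0..real n}" f] continuous_on_subset[OF f(1)] inj_on_subset[OF f(2)] by auto
    \<comment> \<open>The inverse of \<open>f\<close> is regarded as a map into the real axis of the
      plane. Invariance of domain would make the image of an open piece of the sphere open in the
      plane, which is impossible inside that axis.\<close>
    define h where "h = (\<lambda>x. complex_of_real (g x))"
    have "continuous_on U g" using homeomorphism_cont2[OF g] Usub by (rule continuous_on_subset)
    then have "continuous_on U h" unfolding h_def by (intro continuous_intros)
    moreover have "inj_on h U"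
    proof (rule inj_onI)
      fix x y assume "x \<in> U" "y \<in> U" "h x = h y"
      then show "x = y" using homeomorphism_apply2[OF g] Usub unfolding h_def by (metis of_real_eq_iff subsetD)
    qed
    moreover have "aff_dim (UNIV :: complex set) < int DIM(real^3)" by simp
    ultimately have "openin (top_of_set UNIV) (h ` U)"
      using invariance_of_domain_sphere_affine_set[of U h UNIV 1 0] U by auto
    then have "open (h ` U)" by simp
    moreover obtain x where x: "x \<in> U" using U by blast
    ultimately obtain e where e: "e > 0" "ball (h x) e \<subseteq> h ` U" by (meson imageI open_contains_ball)
    have "h x + \<i> * complex_of_real (e/2) \<in> ball (h x) e" using e by (simp add: dist_norm norm_mult)
    then have "h x + \<i> * complex_of_real (e/2) \<in> h ` U" using e by blast
    moreover have "Im w = 0" if "w \<in> h ` U" for w using that unfolding h_def by auto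
    ultimately have "Im (h x + \<i> * complex_of_real (e/2)) = 0" by blast
    then show False using e unfolding h_def by simp
  qed
  have "sphere 0 1 \<subseteq> closure (\<Inter>(range G))"
    by (rule Baire) (use op dense in auto)
  moreover have "f 0 \<in> sphere 0 1" using f(3) by blast
  ultimately have "\<Inter>(range G) \<noteq> {}" by (metis closure_empty empty_iff subsetD)
  then obtain q where q: "\<And>n. q \<in> G n" by auto
  have "q \<notin> f ` {0..}"
  proof
    assume "q \<in> f ` {0..}"
    then obtain t where t: "t \<ge> 0" "q = f t" by auto
    obtain n where "t \<le> real n" using real_arch_simple by blast
    then show False using q[of n] t unfolding G_def by auto
  qed
  then show ?thesis using that q[of 0] unfolding G_def by blast
qed

lemma sphere_punctured_plane:
  fixes q :: "real^3"
  assumes "q \<in> sphere 0 1"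
  obtains G :: "complex \<Rightarrow> real^3" and k where "homeomorphism (sphere 0 1 - {q}) UNIV k G"
proof -
  have "(sphere (0::real^3) 1 - {q}) homeomorphic (UNIV :: complex set)"
    using assms by (intro homeomorphic_punctured_sphere_affine) auto
  then show ?thesis using that unfolding homeomorphic_def by blast
qed

text \<open>\<open>k\<close> is only continuous on \<open>S\<close>, which in the application is a
  punctured sphere and not compact. Limits of the times in \<open>{0..M}\<close> lead to a single
  point \<open>f l\<close> of \<open>S\<close>, where continuity suffices.\<close>

lemma returns_compose:
  fixes f :: "real \<Rightarrow> 'a::metric_space" and k :: "'a \<Rightarrow> 'b::metric_space"
  assumes r: "returns f" and f: "continuous_on {0..} f" "\<And>t. 0 \<le> t \<Longrightarrow> f t \<in> S" and k: "continuous_on S k"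
  shows "returns (\<lambda>t. k (f t))"
  unfolding returns_def
proof (intro allI impI)
  fix e M :: real assume e: "e > 0"
  obtain t where t: "\<And>n. t n > real n" 
    "\<And>n \<tau>. 0 \<le> \<tau> \<Longrightarrow> \<tau> \<le> real n \<Longrightarrow> dist (f (t n + \<tau>)) (f \<tau>) < inverse (real (Suc n))"
    using returns_seq[OF r] by blast
  obtain N where N: "real N \<ge> M" using real_arch_simple by blast
  show "\<exists>t>M. \<forall>\<tau>\<in>{0..M}. dist (k (f (t + \<tau>))) (k (f \<tau>)) < e"
  proof (rule ccontr)
    assume neg: "\<not> ?thesis"
    have "\<exists>\<tau>\<in>{0..M}. \<not> dist (k (f (t (N + n) + \<tau>))) (k (f \<tau>)) < e" for n
      using neg N t(1)[of "N + n"] by (metis add.commute le_add2 less_le_trans of_nat_le_iff order_le_less_trans)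
    then obtain \<tau> where \<tau>: "\<And>n. \<tau> n \<in> {0..M}" "\<And>n. e \<le> dist (k (f (t (N + n) + \<tau> n))) (k (f (\<tau> n)))"
      by (metis not_less)
    obtain l r where l: "l \<in> {0..M}" "strict_mono (r :: nat \<Rightarrow> nat)" "(\<tau> \<circ> r) \<longlonglongrightarrow> l"
      using compact_Icc[of 0 M] \<tau>(1) unfolding compact_def by metis
    define a b where "a n = f (\<tau> (r n))" and "b n = f (t (N + r n) + \<tau> (r n))" for n
    have a: "a \<longlonglongrightarrow> f l" unfolding a_def
      by (rule continuous_on_tendsto_compose[OF f(1) l(3)[unfolded o_def]]) (use l \<tau> in auto)
    have "(\<lambda>n. dist (b n) (a n)) \<longlonglongrightarrow> 0"
    proof (rule tendsto_sandwich[OF _ _ tendsto_const])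
      show "(\<lambda>n. inverse (real (Suc n))) \<longlonglongrightarrow> 0" by (rule LIMSEQ_inverse_real_of_nat)
      show "\<forall>\<^sub>F n in sequentially. dist (b n) (a n) \<le> inverse (real (Suc n))"
      proof (intro always_eventually allI)
        fix n
        have "\<tau> (r n) \<le> real (N + r n)" using \<tau>(1)[of "r n"] N by auto
        then have "dist (b n) (a n) < inverse (real (Suc (N + r n)))"
          unfolding a_def b_def using t(2)[of "\<tau> (r n)" "N + r n"] \<tau>(1)[of "r n"] by simp
        also have "\<dots> \<le> inverse (real (Suc n))"
          using seq_suble[OF l(2), of n] by (intro le_imp_inverse_le) auto
        finally show "dist (b n) (a n) \<le> inverse (real (Suc n))" by simp
      qed
    qed auto
    then have lim0: "(\<lambda>n. dist (b n) (a n) + dist (a n) (f l)) \<longlonglongrightarrow> 0 + 0"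
      using a tendsto_dist_iff[of a "f l"] by (intro tendsto_add) auto
    have "(\<lambda>n. dist (b n) (f l)) \<longlonglongrightarrow> 0"
    proof (rule tendsto_sandwich[OF _ _ tendsto_const])
      show "\<forall>\<^sub>F n in sequentially. dist (b n) (f l) \<le> dist (b n) (a n) + dist (a n) (f l)"
        by (intro always_eventually allI dist_triangle)
    qed (use lim0 in simp_all)
    then have b: "b \<longlonglongrightarrow> f l" using tendsto_dist_iff by blast
    have "(\<lambda>n. k (a n)) \<longlonglongrightarrow> k (f l)"
      by (rule continuous_on_tendsto_compose[OF k a]) (use f(2) l \<tau> in \<open>auto simp: a_def\<close>)
    moreover have "0 \<le> t (N + r n) + \<tau> (r n)" for n using t(1)[of "N + r n"] \<tau>(1)[of "r n"] by auto
    then have "(\<lambda>n. k (b n)) \<longlonglongrightarrow> k (f l)"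
      by (intro continuous_on_tendsto_compose[OF k b]) (use f(2) l in \<open>auto simp: b_def\<close>)
    ultimately have "(\<lambda>n. dist (k (b n)) (k (a n))) \<longlonglongrightarrow> dist (k (f l)) (k (f l))" by (intro tendsto_dist)
    then have "(\<lambda>n. dist (k (b n)) (k (a n))) \<longlonglongrightarrow> 0" by simp
    moreover have "e \<le> dist (k (b n)) (k (a n))" for n unfolding a_def b_def using \<tau>(2) by simp
    ultimately have "e \<le> 0" using LIMSEQ_le_const by blast
    then show False using e by simp
  qed
qed

text \<open>The matrix \<open>x x\<^sup>T\<close> determines the unit vector \<open>x\<close> up to sign, so that the projective plane embeds into
  the space of matrices.\<close>

definition proj :: "real^3 \<Rightarrow> real^3^3" where
  "proj x = (\<chi> i j. x $ i * x $ j)"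

lemma proj_minus [simp]: "proj (- x) = proj x"
  by (simp add: proj_def vec_eq_iff)

lemma continuous_proj: "continuous_on S proj"
  unfolding proj_def by (intro continuous_on_vec_lambda continuous_intros)

lemma inner_proj: "inner (proj x) (proj y) = (inner x y)\<^sup>2"
proof -
  have "inner (proj x) (proj y) = (\<Sum>i\<in>UNIV. \<Sum>j\<in>UNIV. (x $ i * y $ i) * (x $ j * y $ j))"
    unfolding proj_def inner_vec_def by (simp add: mult_ac)
  also have "\<dots> = (inner x y)\<^sup>2" by (simp add: inner_vec_def power2_eq_square sum_product)
  finally show ?thesis .
qed

lemma dist_proj:
  assumes "norm x = 1" "norm y = 1"
  shows "(dist (proj x) (proj y))\<^sup>2 = 2 - 2 * (inner x y)\<^sup>2"
proof -
  have 1: "inner x x = 1" "inner y y = 1" using assms by (simp_all add: dot_square_norm)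
  have "(dist (proj x) (proj y))\<^sup>2 = inner (proj x - proj y) (proj x - proj y)"
    by (simp add: dist_norm dot_square_norm)
  also have "\<dots> = 2 - 2 * (inner x y)\<^sup>2"
    by (simp add: inner_diff_left inner_diff_right inner_proj 1 inner_commute)
  finally show ?thesis .
qed

text \<open>For an inner product \<open>i\<close> in \<open>[0,1]\<close> one has
  \<open>i\<^sup>2 \<le> i\<close>, and the squared distances are \<open>2 - 2 * i\<close> and
  \<open>2 - 2 * i\<^sup>2\<close>.\<close>

lemma dist_le_proj:
  fixes x y :: "real^3"
  assumes "norm x = 1" "norm y = 1" "inner x y \<ge> 0"
  shows "dist x y \<le> dist (proj x) (proj y)"
proof -
  have 1: "inner x x = 1" "inner y y = 1" using assms by (simp_all add: dot_square_norm)
  have "(dist x y)\<^sup>2 = inner (x - y) (x - y)" by (simp add: dist_norm dot_square_norm)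
  also have "\<dots> = 2 - 2 * inner x y" by (simp add: inner_diff_left inner_diff_right 1 inner_commute)
  also have "\<dots> \<le> 2 - 2 * (inner x y)\<^sup>2"
  proof -
    have "inner x y \<le> 1" using norm_cauchy_schwarz[of x y] assms by simp
    then have "inner x y * inner x y \<le> inner x y * 1" using assms by (intro mult_left_mono) auto
    then show ?thesis by (simp add: power2_eq_square)
  qed
  also have "\<dots> = (dist (proj x) (proj y))\<^sup>2" using dist_proj assms by simp
  finally show ?thesis using zero_le_dist power2_le_imp_le by blast
qed

text \<open>A return of the projected curve is a return of \<open>g\<close> either to itself or to its antipode; two successive
  returns of the second kind compose to one of the first kind.\<close>

lemma returns_proj_lift:
  assumes g: "continuous_on {0..} g" "\<And>t. 0 \<le> t \<Longrightarrow> norm (g t) = 1" and r: "returns (\<lambda>t. proj (g t))"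
  shows "returns g"
proof -
  have pm: "\<exists>t>M. (\<forall>\<tau>\<in>{0..M}. dist (g (t + \<tau>)) (g \<tau>) < e) \<or> (\<forall>\<tau>\<in>{0..M}. dist (g (t + \<tau>)) (- g \<tau>) < e)"
    if e: "e > 0" and M: "M \<ge> 0" for e M
  proof -
    \<comment> \<open>Orthogonal unit vectors have images at distance \<open>sqrt 2 > 1\<close>. The
      cap 1 therefore keeps the inner product nonzero, and its sign is constant on the
      window.\<close>
    obtain t where t: "t > M" "\<And>\<tau>. \<tau> \<in> {0..M} \<Longrightarrow> dist (proj (g (t + \<tau>))) (proj (g \<tau>)) < min e 1"
      using r[unfolded returns_def, rule_format, of "min e 1" M] e by auto
    define i where "i \<tau> = inner (g (t + \<tau>)) (g \<tau>)" for \<tau>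
    have n1: "norm (g (t + \<tau>)) = 1" "norm (g \<tau>) = 1" if "\<tau> \<in> {0..M}" for \<tau> using that t M g by auto
    have nz: "i \<tau> \<noteq> 0" if "\<tau> \<in> {0..M}" for \<tau>
    proof
      assume "i \<tau> = 0"
      then have "(dist (proj (g (t + \<tau>))) (proj (g \<tau>)))\<^sup>2 = 2" using dist_proj[OF n1[OF that]] unfolding i_def by simp
      moreover have "(dist (proj (g (t + \<tau>))) (proj (g \<tau>)))\<^sup>2 < 1\<^sup>2" 
        using t(2)[OF that] by (intro power_strict_mono) auto
      ultimately show False by simp
    qed
    have ci: "continuous_on {0..M} i" unfolding i_def
      by (intro continuous_intros continuous_on_compose2[OF g(1)]) (use t M in auto)
    have ivt: "\<not> (i 0 < 0 \<and> i \<tau> > 0)" "\<not> (i 0 > 0 \<and> i \<tau> < 0)" if "\<tau> \<in> {0..M}" for \<tau>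
    proof -
      have c: "continuous_on {0..\<tau>} i" using that by (intro continuous_on_subset[OF ci]) auto
      show "\<not> (i 0 < 0 \<and> i \<tau> > 0)" using IVT'[of i 0 0 \<tau>] c nz that by force
      show "\<not> (i 0 > 0 \<and> i \<tau> < 0)" using IVT2'[of i \<tau> 0 0] c nz that by force
    qed
    show ?thesis
    proof (cases "i 0 > 0")
      case True
      have "dist (g (t + \<tau>)) (g \<tau>) < e" if "\<tau> \<in> {0..M}" for \<tau>
      proof -
        have "i \<tau> \<ge> 0" using ivt(2)[OF that] True by linarith
        then show ?thesis using dist_le_proj[OF n1[OF that]] t(2)[OF that] unfolding i_def by simp
      qed
      then show ?thesis using t(1) by blast
    next
      case False
      then have neg: "i 0 < 0" using nz[of 0] M by force
      have "dist (g (t + \<tau>)) (- g \<tau>) < e" if "\<tau> \<in> {0..M}" for \<tau>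
      proof -
        have "i \<tau> \<le> 0" using ivt(1)[OF that] neg by linarith
        then show ?thesis using dist_le_proj[of "g (t + \<tau>)" "- g \<tau>"] n1[OF that] t(2)[OF that] unfolding i_def by simp
      qed
      then show ?thesis using t(1) by blast
    qed
  qed
  show ?thesis unfolding returns_def
  proof (intro allI impI)
    fix e M0 :: real assume e: "e > 0"
    define M where "M = max M0 0"
    obtain t1 where t1: "t1 > M" "(\<forall>\<tau>\<in>{0..M}. dist (g (t1 + \<tau>)) (g \<tau>) < e/2) \<or> (\<forall>\<tau>\<in>{0..M}. dist (g (t1 + \<tau>)) (- g \<tau>) < e/2)"
      using pm[of "e/2" M] e unfolding M_def by auto
    \<comment> \<open>The second window has length \<open>t1 + M\<close> so that it covers the times
      \<open>t1 + \<tau>\<close> when both returns are antipodal.\<close>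
    obtain t2 where t2: "t2 > t1 + M" "(\<forall>\<tau>\<in>{0..t1 + M}. dist (g (t2 + \<tau>)) (g \<tau>) < e/2) \<or> (\<forall>\<tau>\<in>{0..t1 + M}. dist (g (t2 + \<tau>)) (- g \<tau>) < e/2)"
      using pm[of "e/2" "t1 + M"] e t1 unfolding M_def by auto
    have M0: "M0 \<le> M" "0 \<le> M" unfolding M_def by auto
    consider "\<forall>\<tau>\<in>{0..M}. dist (g (t1 + \<tau>)) (g \<tau>) < e/2" | "\<forall>\<tau>\<in>{0..t1 + M}. dist (g (t2 + \<tau>)) (g \<tau>) < e/2"
      | "\<forall>\<tau>\<in>{0..M}. dist (g (t1 + \<tau>)) (- g \<tau>) < e/2" "\<forall>\<tau>\<in>{0..t1 + M}. dist (g (t2 + \<tau>)) (- g \<tau>) < e/2"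
      using t1(2) t2(2) by blast
    then show "\<exists>t>M0. \<forall>\<tau>\<in>{0..M0}. dist (g (t + \<tau>)) (g \<tau>) < e"
    proof cases
      case 1
      have "dist (g (t1 + \<tau>)) (g \<tau>) < e" if "\<tau> \<in> {0..M0}" for \<tau>
        using 1[rule_format, of \<tau>] that M0 e by simp
      then show ?thesis using t1(1) M0 by (intro exI[of _ t1]) simp
    next
      case 2
      have "dist (g (t2 + \<tau>)) (g \<tau>) < e" if "\<tau> \<in> {0..M0}" for \<tau>
        using 2[rule_format, of \<tau>] that M0 t1(1) e by simp
      then show ?thesis using t1(1) t2(1) M0 by (intro exI[of _ t2]) simp
    next
      case 3
      have "dist (g (t1 + t2 + \<tau>)) (g \<tau>) < e" if "\<tau> \<in> {0..M0}" for \<tau>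
      proof -
        have "dist (g (t2 + (t1 + \<tau>))) (- g (t1 + \<tau>)) < e/2" using 3(2) that M0 t1 by auto
        moreover have "dist (- g (t1 + \<tau>)) (g \<tau>) = dist (g (t1 + \<tau>)) (- g \<tau>)"
          by (metis dist_minus minus_minus)
        moreover have "dist (g (t1 + \<tau>)) (- g \<tau>) < e/2" using 3(1) that M0 by auto
        ultimately have "dist (g (t2 + (t1 + \<tau>))) (g \<tau>) < e" 
          using dist_triangle[of "g (t2 + (t1 + \<tau>))" "g \<tau>" "- g (t1 + \<tau>)"] by linarith
        then show ?thesis by (simp add: ac_simps)
      qed
      then show ?thesis using t1 t2 M0 by (intro exI[of _ "t1 + t2"]) simp
    qed
  qed
qed


text \<open>Over the lines not orthogonal to \<open>x\<close> the two inverse branches are explicit: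
  they pick the representative in the open hemisphere around \<open>x\<close> or around
  \<open>- x\<close>.\<close>

lemma covering_space_proj: "covering_space (sphere 0 1) proj (proj ` sphere 0 1)"
  unfolding covering_space_def
proof (intro conjI ballI)
  show "continuous_on (sphere 0 1) proj" by (rule continuous_proj)
next
  let ?S = "sphere (0::real^3) 1" and ?P = "proj ` sphere 0 1"
  fix y assume "y \<in> ?P"
  then obtain x where x: "x \<in> ?S" "y = proj x" by blast
  have nx: "inner x x = 1" using x by (simp add: dot_square_norm)
  \<comment> \<open>The product of the matrix \<open>M\<close> with \<open>x\<close>. At
    \<open>proj z\<close> it is a multiple of \<open>z\<close>, so it recovers the line.\<close>
  define h where "h M = (\<chi> i. inner (M $ i) x)" for M :: "real^3^3"
  have hp: "h (proj z) = inner z x *\<^sub>R z" for z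
    unfolding h_def proj_def by (simp add: vec_eq_iff inner_vec_def sum_distrib_left mult_ac)
  have hc: "continuous_on T h" for T unfolding h_def by (intro continuous_on_vec_lambda continuous_intros)
  have hi: "inner x (h (proj z)) = (inner z x)\<^sup>2" for z by (simp add: hp power2_eq_square inner_commute)
  define T where "T = ?P \<inter> {M. inner x (h M) > 0}"
  have "open {M. inner x (h M) > 0}"
    by (intro open_Collect_less continuous_intros hc)
  then have oT: "openin (top_of_set ?P) T" unfolding T_def by (simp add: openin_open_Int)
  have yT: "y \<in> T" unfolding T_def using x by (simp add: hi nx)
  define A where "A \<sigma> = ?S \<inter> {z. \<sigma> * inner z x > 0}" for \<sigma> :: real
  \<comment> \<open>For \<open>M = proj z\<close> the square root is the absolute value of
    \<open>inner z x\<close>, so the quotient is \<open>z\<close> up to sign.\<close>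
  define q where "q \<sigma> M = (\<sigma> / sqrt (inner x (h M))) *\<^sub>R h M" for \<sigma> M
  have oA: "openin (top_of_set ?S) (A \<sigma>)" for \<sigma>
  proof -
    have "open {z. \<sigma> * inner z x > 0}" by (intro open_Collect_less continuous_intros)
    then show ?thesis unfolding A_def by (simp add: openin_open_Int)
  qed
  have qA: "q \<sigma> (proj z) = z" if "z \<in> A \<sigma>" "\<sigma> = 1 \<or> \<sigma> = -1" for z \<sigma>
  proof -
    have "sqrt (inner x (h (proj z))) = \<sigma> * inner z x" using that unfolding hi A_def by auto
    then show ?thesis using that unfolding q_def hp A_def by auto
  qed
  have hom: "homeomorphism (A \<sigma>) T proj (q \<sigma>)" if \<sigma>: "\<sigma> = 1 \<or> \<sigma> = -1" for \<sigma>
  proof (rule homeomorphismI)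
    show "continuous_on (A \<sigma>) proj" by (rule continuous_proj)
    show "continuous_on T (q \<sigma>)" unfolding q_def
      by (intro continuous_intros hc) (auto simp: T_def)
    show "proj ` A \<sigma> \<subseteq> T" unfolding A_def T_def using \<sigma> by (auto simp: hi)
    have pre: "\<exists>z\<in>A \<sigma>. M = proj z" if "M \<in> T" for M
    proof -
      obtain z where z: "z \<in> ?S" "M = proj z" "inner z x \<noteq> 0" using \<open>M \<in> T\<close> unfolding T_def by (auto simp: hi)
      show ?thesis
      proof (cases "\<sigma> * inner z x > 0")
        case True
        then show ?thesis using z unfolding A_def by blast
      next
        case False
        then have "\<sigma> * inner (- z) x > 0" using z(3) \<sigma> by auto
        then show ?thesis using z unfolding A_def by (intro bexI[of _ "- z"]) auto
      qed
    qed
    show "q \<sigma> ` T \<subseteq> A \<sigma>" using pre qA[OF _ \<sigma>] by fastforce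
    show "q \<sigma> (proj z) = z" if "z \<in> A \<sigma>" for z using qA that \<sigma> by blast
    show "proj (q \<sigma> M) = M" if "M \<in> T" for M using pre[OF that] qA[OF _ \<sigma>] by auto
  qed
  show "\<exists>T. y \<in> T \<and> openin (top_of_set ?P) T \<and> (\<exists>v. \<Union>v = ?S \<inter> proj -` T \<and>
    (\<forall>u\<in>v. openin (top_of_set ?S) u) \<and> pairwise disjnt v \<and> (\<forall>u\<in>v. \<exists>q. homeomorphism u T proj q))"
  proof (intro exI[of _ T] conjI yT oT exI[of _ "{A 1, A (-1)}"])
    show "\<Union>{A 1, A (-1)} = ?S \<inter> proj -` T" unfolding A_def T_def by (auto simp: hi)
    show "\<forall>u\<in>{A 1, A (-1)}. openin (top_of_set ?S) u" using oA by blast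
    show "pairwise disjnt {A 1, A (-1)}" unfolding pairwise_def disjnt_def A_def by auto
    show "\<forall>u\<in>{A 1, A (-1)}. \<exists>q. homeomorphism u T proj q" using hom by blast
  qed
qed simp

lemma proj_lift:
  assumes "continuous_on {0..} f" "\<And>t. 0 \<le> t \<Longrightarrow> f t \<in> proj ` sphere 0 1"
  obtains g where "continuous_on {0..} g" "\<And>t. 0 \<le> t \<Longrightarrow> norm (g t) = 1" "\<And>t::real. 0 \<le> t \<Longrightarrow> proj (g t) = f t"
proof -
  have "convex {0::real..}" by simp
  then have "simply_connected {0::real..}" "locally path_connected {0::real..}"
    by (simp_all add: convex_imp_simply_connected convex_imp_locally_path_connected)
  moreover have "f \<in> {0..} \<rightarrow> proj ` sphere 0 1" using assms(2) by auto
  ultimately obtain g where "continuous_on {0..} g" "g \<in> {0..} \<rightarrow> sphere 0 1" "\<And>y. y \<in> {0..} \<Longrightarrow> proj (g y) = f y"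
    using covering_space_lift[OF covering_space_proj _ _ assms(1)] by metis
  then show ?thesis using that[of g] by (auto simp: Pi_iff)
qed

lemma planar_coordinates:
  fixes g :: "real \<Rightarrow> real^3"
  assumes "continuous_on {0..} g" "inj_on g {0..}" "\<And>t. 0 \<le> t \<Longrightarrow> norm (g t) = 1" "returns g"
  obtains G :: "complex \<Rightarrow> real^3" and \<psi> where "continuous_on UNIV G" "range G \<subseteq> sphere 0 1" "continuous_on {0..} \<psi>" "returns \<psi>" 
    "\<And>t. 0 \<le> t \<Longrightarrow> G (\<psi> t) = g t"
proof -
  obtain q where q: "q \<in> sphere 0 1" "q \<notin> g ` {0..}" using sphere_not_covered[of g] assms by auto
  obtain G :: "complex \<Rightarrow> real^3" and k where h: "homeomorphism (sphere 0 1 - {q}) UNIV k G"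
    using sphere_punctured_plane[OF q(1)] by blast
  have k: "continuous_on (sphere 0 1 - {q}) k" using h by (rule homeomorphism_cont1)
  have gS: "g t \<in> sphere 0 1 - {q}" if "0 \<le> t" for t using assms(3) q(2) that by auto
  show ?thesis
  proof (rule that[of G "\<lambda>t. k (g t)"])
    show "continuous_on UNIV G" using h by (rule homeomorphism_cont2)
    show "range G \<subseteq> sphere 0 1" using homeomorphism_image2[OF h] by auto
    show "continuous_on {0..} (\<lambda>t. k (g t))" using gS by (intro continuous_on_compose2[OF k assms(1)]) auto
    show "returns (\<lambda>t. k (g t))" by (rule returns_compose[OF assms(4,1) gS k])
    show "G (k (g t)) = g t" if "0 \<le> t" for t using homeomorphism_apply1[OF h] gS that by blast
  qed
qed

section \<open>The compact-open topology and the theorem\<close>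

text \<open>If every point of \<open>X\<close> had a neighbourhood that is eventually avoided, a
  finite subcover would force \<open>F = bot\<close>. The finer filter is \<open>F\<close> refined
  by the preimages of the neighbourhoods of \<open>g\<close>.\<close>

lemma compactin_cluster:
  assumes X: "compactin T X" and f: "\<And>n. f n \<in> X" and "F \<noteq> bot"
  obtains g F' where "g \<in> X" "F' \<le> F" "F' \<noteq> bot" "limitin T f g F'"
proof -
  have XT: "X \<subseteq> topspace T" using X compactin_subset_topspace by blast
  have "\<exists>g\<in>X. \<forall>U. openin T U \<longrightarrow> g \<in> U \<longrightarrow> \<not> eventually (\<lambda>n. f n \<notin> U) F"
  proof (rule ccontr)
    assume "\<not> ?thesis"
    then have "\<forall>g\<in>X. \<exists>U. openin T U \<and> g \<in> U \<and> eventually (\<lambda>n. f n \<notin> U) F" by blast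
    then obtain U where U: "\<And>g. g \<in> X \<Longrightarrow> openin T (U g) \<and> g \<in> U g \<and> eventually (\<lambda>n. f n \<notin> U g) F"
      by metis
    then have "(\<forall>u\<in>U ` X. openin T u) \<and> X \<subseteq> \<Union>(U ` X)" by blast
    then obtain V where V: "finite V" "V \<subseteq> U ` X" "X \<subseteq> \<Union>V"
      using X unfolding compactin_def by meson
    have "eventually (\<lambda>n. \<forall>u\<in>V. f n \<notin> u) F"
      using V U by (intro eventually_ball_finite) auto
    then have "eventually (\<lambda>n. False) F" by eventually_elim (use V f in blast)
    then show False using \<open>F \<noteq> bot\<close> by (simp add: eventually_False)
  qed
  then obtain g where g: "g \<in> X" "\<And>U. openin T U \<Longrightarrow> g \<in> U \<Longrightarrow> \<not> eventually (\<lambda>n. f n \<notin> U) F" by blast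
  define F' where "F' = inf F (filtercomap f (nhdsin T g))"
  have gT: "g \<in> topspace T" using g XT by blast
  show ?thesis
  proof (rule that[OF g(1)])
    show "F' \<le> F" unfolding F'_def by simp
    show "F' \<noteq> bot"
    proof
      assume "F' = bot"
      then have "eventually (\<lambda>n. False) F'" by simp
      then obtain Q R where QR: "eventually Q F" "eventually R (filtercomap f (nhdsin T g))" "\<And>n. Q n \<Longrightarrow> R n \<Longrightarrow> False"
        unfolding F'_def eventually_inf by blast
      then obtain S where S: "eventually S (nhdsin T g)" "\<And>n. S (f n) \<Longrightarrow> R n"
        unfolding eventually_filtercomap by blast
      then obtain U where U: "openin T U" "g \<in> U" "\<forall>x\<in>U. S x" using gT unfolding eventually_nhdsin by blast
      have "eventually (\<lambda>n. f n \<notin> U) F" using QR(1) by eventually_elim (use QR(3) S(2) U(3) in blast)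
      then show False using g(2) U by blast
    qed
    show "limitin T f g F'" unfolding limitin_def
    proof (intro conjI gT allI impI)
      fix U assume "openin T U \<and> g \<in> U"
      then have "eventually (\<lambda>x. x \<in> U) (nhdsin T g)" unfolding eventually_nhdsin by blast
      then have "eventually (\<lambda>n. f n \<in> U) (filtercomap f (nhdsin T g))" by (rule eventually_filtercomapI)
      then show "eventually (\<lambda>n. f n \<in> U) F'" unfolding F'_def using filter_leD inf_le2 by blast
    qed
  qed
qed

lemma Cpos_continuous:
  assumes "f \<in> Cpos Z" "continuous_map Z euclidean e"
  shows "continuous_on {0..} (\<lambda>t. e (f t))" "\<And>t. 0 \<le> t \<Longrightarrow> f t \<in> topspace Z"
proof -
  have c: "continuous_map (top_of_set {0..}) Z f" using assms unfolding Cpos_def by blast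
  show "continuous_on {0..} (\<lambda>t. e (f t))"
    using continuous_map_compose[OF c assms(2)] by (simp add: o_def)
  show "\<And>t. 0 \<le> t \<Longrightarrow> f t \<in> topspace Z" using continuous_map_image_subset_topspace[OF c] by auto
qed

text \<open>By continuity \<open>g\<close> maps a compact interval around \<open>l\<close> into the
  given open set. The corresponding subbasic neighbourhood controls \<open>f n\<close> on the whole
  interval, hence also at the moving points \<open>\<tau> n\<close>.\<close>

lemma limitin_compact_open_conv_along:
  fixes e :: "'a \<Rightarrow> 'b::metric_space"
  assumes lim: "limitin (compact_open Z) f g F" and g: "g \<in> Cpos Z" and e: "continuous_map Z euclidean e"
  shows "conv_along (\<lambda>n t. e (f n t)) (\<lambda>t. e (g t)) F"
  unfolding conv_along_def
proof (intro allI impI)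
  fix F' and \<tau> :: "nat \<Rightarrow> real" and l
  assume F': "F' \<le> F" and \<tau>: "\<forall>n. 0 \<le> \<tau> n" and l: "(\<tau> \<longlongrightarrow> l) F'"
  show "((\<lambda>n. e (f n (\<tau> n))) \<longlongrightarrow> e (g l)) F'"
  proof (cases "F' = bot")
    case False
    then have l0: "0 \<le> l" using \<tau> l tendsto_lowerbound[of \<tau> l F' 0] by (simp add: always_eventually)
    show ?thesis
    proof (rule topological_tendstoI)
      fix V assume V: "open V" "e (g l) \<in> V"
      obtain r where r: "r > 0" "ball (e (g l)) r \<subseteq> V" using V open_contains_ball by blast
      have "\<exists>d>0. \<forall>t\<in>{0..}. dist t l < d \<longrightarrow> dist (e (g t)) (e (g l)) < r"
        using Cpos_continuous(1)[OF g e] l0 r(1) unfolding continuous_on_iff by simp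
      then obtain d where d: "d > 0" "\<And>t. 0 \<le> t \<Longrightarrow> dist t l < d \<Longrightarrow> dist (e (g t)) (e (g l)) < r" by auto
      define U where "U = {z \<in> topspace Z. e z \<in> V}"
      define K where "K = {0..} \<inter> cball l (d/2)"
      have U: "openin Z U" unfolding U_def using openin_continuous_map_preimage[OF e, of V] V by simp
      have K: "compact K" "K \<subseteq> {0..}" unfolding K_def by (auto simp: closed_Int_compact)
      define W where "W = {h. h ` K \<subseteq> U} \<inter> Cpos Z"
      have "openin (compact_open Z) W"
        unfolding W_def compact_open_def openin_subtopology
        by (intro exI[of _ "{h. h ` K \<subseteq> U}"] conjI refl topology_generated_by_Basis) (use K U in blast)
      moreover have "g \<in> W"
      proof -
        have "g t \<in> U" if "t \<in> K" for t
        proof -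
          have "0 \<le> t" "dist t l < d" using that d(1) unfolding K_def by (auto simp: dist_commute)
          then have "e (g t) \<in> V" using d(2)[of t] r(2) by (auto simp: dist_commute)
          then show ?thesis unfolding U_def using Cpos_continuous(2)[OF g e] \<open>0 \<le> t\<close> by simp
        qed
        then show ?thesis unfolding W_def using g by blast
      qed
      ultimately have "eventually (\<lambda>n. f n \<in> W) F" using lim limitinD by fastforce
      then have "eventually (\<lambda>n. f n \<in> W) F'" using F' filter_leD by blast
      moreover have "eventually (\<lambda>n. dist (\<tau> n) l < d/2) F'" using l d(1) tendstoD half_gt_zero by blast
      ultimately show "eventually (\<lambda>n. e (f n (\<tau> n)) \<in> V) F'"
      proof eventually_elim
        case (elim n)
        then have "\<tau> n \<in> K" unfolding K_def using \<tau> by (auto simp: dist_commute)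
        then show ?case using elim(1) unfolding W_def U_def by blast
      qed
    qed
  qed simp
qed

lemma recurrent_returns:
  fixes e :: "'a \<Rightarrow> 'b::metric_space"
  assumes rec: "recurrent Z f" and f: "f \<in> Cpos Z" and e: "continuous_map Z euclidean e"
  shows "returns (\<lambda>t. e (f t))"
proof (rule ccontr)
  assume "\<not> ?thesis"
  then obtain c M where c: "c > 0" "\<And>t. t > M \<Longrightarrow> \<exists>\<tau>\<in>{0..M}. \<not> dist (e (f (t + \<tau>))) (e (f \<tau>)) < c"
    unfolding returns_def by blast
  have M: "M \<ge> 0" using c(2)[of "M + 1"] by auto
  obtain t where t: "filterlim t at_top sequentially" "limitin (compact_open Z) (\<lambda>n. shift (t n) f) f sequentially"
    using rec unfolding recurrent_def by blast
  have conv: "conv_along (\<lambda>n s. e (shift (t n) f s)) (\<lambda>s. e (f s)) sequentially"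
    by (rule limitin_compact_open_conv_along[OF t(2) f e])
  have "\<exists>\<tau>. \<tau> \<in> {0..M} \<and> (t n > M \<longrightarrow> c \<le> dist (e (f (t n + \<tau>))) (e (f \<tau>)))" for n
    using c(2)[of "t n"] M by (cases "t n > M") (auto simp: not_less)
  then obtain \<tau> where \<tau>: "\<And>n. \<tau> n \<in> {0..M}" "\<And>n. t n > M \<Longrightarrow> c \<le> dist (e (f (t n + \<tau> n))) (e (f (\<tau> n)))"
    by metis
  obtain l r where l: "l \<in> {0..M}" "strict_mono (r :: nat \<Rightarrow> nat)" "(\<tau> \<circ> r) \<longlonglongrightarrow> l"
    using compact_Icc[of 0 M] \<tau>(1) unfolding compact_def by metis
  \<comment> \<open>The subsequence is encoded as a filter, the form in which
    \<open>conv_along\<close> accepts moving times.\<close>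
  define F where "F = filtermap r sequentially"
  have F: "F \<le> sequentially" "F \<noteq> bot"
    unfolding F_def using filterlim_subseq[OF l(2)] by (auto simp: filterlim_def filtermap_bot_iff)
  have lF: "(\<tau> \<longlongrightarrow> l) F" unfolding F_def filterlim_filtermap using l(3) by (simp add: o_def)
  have \<tau>0: "0 \<le> \<tau> n" for n using \<tau>(1)[of n] by simp
  have "((\<lambda>n. e (shift (t n) f (\<tau> n))) \<longlongrightarrow> e (f l)) F"
    by (rule conv_along_seq[OF conv_along_mono[OF conv F(1)] \<tau>0 lF])
  then have "((\<lambda>n. e (f (t n + \<tau> n))) \<longlongrightarrow> e (f l)) F" using \<tau>0 by (simp add: shift_def)
  moreover have "((\<lambda>n. e (f (\<tau> n))) \<longlongrightarrow> e (f l)) F"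
    using l(1) by (intro continuous_on_tendsto_compose[OF Cpos_continuous(1)[OF f e] lF] always_eventually) (auto simp: \<tau>0)
  ultimately have "((\<lambda>n. dist (e (f (t n + \<tau> n))) (e (f (\<tau> n)))) \<longlongrightarrow> dist (e (f l)) (e (f l))) F"
    by (rule tendsto_dist)
  moreover have "eventually (\<lambda>n. t n > M) sequentially" using t(1) unfolding filterlim_at_top_dense by blast
  then have "eventually (\<lambda>n. t n > M) F" using F(1) filter_leD by blast
  then have "eventually (\<lambda>n. c \<le> dist (e (f (t n + \<tau> n))) (e (f (\<tau> n)))) F"
    by eventually_elim (rule \<tau>(2))
  ultimately have "c \<le> dist (e (f l)) (e (f l))" by (rule tendsto_lowerbound[OF _ _ F(2)])
  then show False using c(1) by simp
qed

lemma switching_image: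
  fixes e :: "'a \<Rightarrow> 'b::metric_space"
  assumes X: "switched_bebutov_shift Z X" and e: "continuous_map Z euclidean e" "inj_on e (topspace Z)"
  shows "switching ((\<lambda>f t. e (f t)) ` X)"
proof
  let ?Y = "(\<lambda>f t. e (f t)) ` X"
  have XC: "X \<subseteq> Cpos Z" and cX: "compactin (compact_open Z) X" and sh: "\<And>f \<tau>. f \<in> X \<Longrightarrow> 0 \<le> \<tau> \<Longrightarrow> shift \<tau> f \<in> X"
    and sw: "\<And>f g \<tau>. f \<in> X \<Longrightarrow> g \<in> X \<Longrightarrow> 0 < \<tau> \<Longrightarrow> f \<tau> = g \<tau> \<Longrightarrow> concat_at \<tau> f g \<in> X"
    using X unfolding switched_bebutov_shift_def bebutov_shift_def by auto
  show "continuous_on {0..} k" if "k \<in> ?Y" for k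
    using that XC Cpos_continuous(1)[OF _ e(1)] by blast
  show "\<exists>g\<in>?Y. \<forall>t\<ge>0. g t = k (\<tau> + t)" if k: "k \<in> ?Y" "0 \<le> \<tau>" for k \<tau>
  proof -
    obtain f where f: "f \<in> X" "k = (\<lambda>t. e (f t))" using k by blast
    have "\<forall>t\<ge>0. e (shift \<tau> f t) = k (\<tau> + t)" using f by (simp add: shift_def)
    then show ?thesis using imageI[OF sh[OF f(1) k(2)], of "\<lambda>f t. e (f t)"] by (rule bexI)
  qed
  show "\<exists>h\<in>?Y. (\<forall>t. 0 \<le> t \<and> t \<le> \<tau> \<longrightarrow> h t = k t) \<and> (\<forall>t\<ge>\<tau>. h t = m t)"
    if km: "k \<in> ?Y" "m \<in> ?Y" "0 < \<tau>" "k \<tau> = m \<tau>" for k m \<tau>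
  proof -
    obtain f g where f: "f \<in> X" "k = (\<lambda>t. e (f t))" and g: "g \<in> X" "m = (\<lambda>t. e (g t))" using km by blast
    have "f \<tau> \<in> topspace Z" "g \<tau> \<in> topspace Z" using Cpos_continuous(2)[OF _ e(1)] f g XC km(3) by auto
    \<comment> \<open>Switching in \<open>X\<close> asks for equality in \<open>Z\<close>, which
      injectivity of \<open>e\<close> supplies.\<close>
    then have eq: "f \<tau> = g \<tau>" using km(4) f g e(2) unfolding inj_on_def by auto
    have 1: "e (concat_at \<tau> f g t) = k t" if "0 \<le> t \<and> t \<le> \<tau>" for t using that f by (simp add: concat_at_def)
    have 2: "e (concat_at \<tau> f g t) = m t" if "\<tau> \<le> t" for t 
      using that g f eq km(3) by (cases "t = \<tau>") (auto simp: concat_at_def)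
    show ?thesis
      by (rule bexI[OF _ imageI[OF sw[OF f(1) g(1) km(3) eq], of "\<lambda>f t. e (f t)"]]) (use 1 2 in blast)
  qed
  show "\<exists>k\<in>?Y. \<exists>F'\<le>F. F' \<noteq> bot \<and> conv_along fs k F'" if fs: "\<And>n. fs n \<in> ?Y" "F \<noteq> bot" for fs F
  proof -
    have "\<exists>p. \<forall>n. p n \<in> X \<and> fs n = (\<lambda>t. e (p n t))" using fs(1) by (intro choice) blast
    then obtain p where p: "\<And>n. p n \<in> X" "\<And>n. fs n = (\<lambda>t. e (p n t))" by blast
    obtain g F' where g: "g \<in> X" "F' \<le> F" "F' \<noteq> bot" "limitin (compact_open Z) p g F'"
      using compactin_cluster[of "compact_open Z" X p F] cX p(1) fs(2) by blast
    have "conv_along (\<lambda>n t. e (p n t)) (\<lambda>t. e (g t)) F'"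
      using limitin_compact_open_conv_along[OF g(4) _ e(1)] XC g(1) by blast
    then have "conv_along fs (\<lambda>t. e (g t)) F'" using p(2) by presburger
    then show ?thesis using g by blast
  qed
qed

text \<open>The common end of both cases: sphere and projective plane differ only in the embedding
  \<open>e\<close> and in how \<open>coord\<close> obtains planar coordinates.\<close>

lemma switched_shift_dichotomy:
  fixes e :: "'a \<Rightarrow> 'b::metric_space" and Z :: "'a topology"
  assumes X: "switched_bebutov_shift Z X" and e: "continuous_map Z euclidean e" "inj_on e (topspace Z)"
    and \<phi>: "\<phi> \<in> X" "recurrent Z \<phi>"
    and coord: "inj_on (\<lambda>t. e (\<phi> t)) {0..} \<Longrightarrow> continuous_on {0..} (\<lambda>t. e (\<phi> t)) \<Longrightarrow> returns (\<lambda>t. e (\<phi> t)) \<Longrightarrow> 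
      \<exists>(G :: complex \<Rightarrow> 'b) \<psi>. continuous_on UNIV G \<and> continuous_on {0..} \<psi> \<and> returns \<psi> \<and> (\<forall>t\<ge>0. G (\<psi> t) = e (\<phi> t))"
  shows "(\<exists>\<psi>\<in>X. preperiodic \<psi> \<and> \<psi> 0 = \<phi> 0) \<and>
         (inj_on \<phi> {0..} \<longrightarrow> (\<exists>\<psi>\<in>X. \<psi> 0 = \<phi> 0 \<and> (\<forall>s\<ge>0. \<psi> s = \<psi> 0)))"
proof -
  interpret switching "(\<lambda>f t. e (f t)) ` X" by (rule switching_image[OF X e])
  have XC: "X \<subseteq> Cpos Z" using X unfolding switched_bebutov_shift_def bebutov_shift_def by auto
  have \<phi>C: "\<phi> \<in> Cpos Z" using \<phi> XC by blast
  have inT: "f t \<in> topspace Z" if "f \<in> X" "0 \<le> t" for f t using Cpos_continuous(2)[OF _ e(1)] that XC by blast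
  have einj: "x = y" if "e x = e y" "x \<in> topspace Z" "y \<in> topspace Z" for x y using that e(2) unfolding inj_on_def by blast
  have ret: "returns (\<lambda>t. e (\<phi> t))" by (rule recurrent_returns[OF \<phi>(2) \<phi>C e(1)])
  have eY: "(\<lambda>t. e (\<phi> t)) \<in> (\<lambda>f t. e (f t)) ` X" using \<phi>(1) by blast
  show ?thesis
  proof (cases "inj_on \<phi> {0..}")
    case True
    have inj: "inj_on (\<lambda>t. e (\<phi> t)) {0..}"
    proof (rule inj_onI)
      fix s t :: real assume "s \<in> {0..}" "t \<in> {0..}" "e (\<phi> s) = e (\<phi> t)"
      then show "s = t" using einj inT[OF \<phi>(1)] True unfolding inj_on_def by auto
    qed
    obtain G :: "complex \<Rightarrow> 'b" and \<psi> where G: "continuous_on UNIV G" "continuous_on {0..} \<psi>" "returns \<psi>" "\<And>t. 0 \<le> t \<Longrightarrow> G (\<psi> t) = e (\<phi> t)"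
      using coord[OF inj Cpos_continuous(1)[OF \<phi>C e(1)] ret] by blast
    obtain g where g: "g \<in> (\<lambda>f t. e (f t)) ` X" "\<And>t. 0 \<le> t \<Longrightarrow> g t = e (\<phi> 0)"
      using injective_constant[OF eY ret inj G] by blast
    obtain f where f: "f \<in> X" "g = (\<lambda>t. e (f t))" using g(1) by blast
    have ft: "f t = \<phi> 0" if "0 \<le> t" for t 
      using g(2)[OF that] f einj inT[OF f(1) that] inT[OF \<phi>(1), of 0] by auto
    have "preperiodic f" unfolding preperiodic_def by (intro exI[of _ "0::real"] exI[of _ "1::real"] conjI) (simp_all add: ft)
    then show ?thesis using f(1) ft by (metis order_refl)
  next
    case False
    then obtain s1 s2 where s: "s1 \<ge> 0" "s2 \<ge> 0" "s1 \<noteq> s2" "\<phi> s1 = \<phi> s2" unfolding inj_on_def by auto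
    obtain t1 t2 where t: "0 \<le> t1" "t1 < t2" "\<phi> t1 = \<phi> t2"
    proof (cases "s1 < s2")
      case True
      then show ?thesis using s that by blast
    next
      case False
      then have "s2 < s1" using s by simp
      then show ?thesis using s that[of s2 s1] by simp
    qed
    have eqt: "e (\<phi> t1) = e (\<phi> t2)" using t(3) by simp
    obtain g T p where g: "g \<in> (\<lambda>f t. e (f t)) ` X" "g 0 = e (\<phi> 0)" "0 \<le> T" "0 < p" "\<And>t. T \<le> t \<Longrightarrow> g (t + p) = g t"
      using noninjective_preperiodic[OF returns_backward_ext[OF eY ret] t(1,2) eqt] by blast
    obtain f where f: "f \<in> X" "g = (\<lambda>t. e (f t))" using g(1) by blast
    have "f (t + p) = f t" if "T \<le> t" for t
      using g(3,4) g(5)[OF that] that f inT[OF f(1)] by (intro einj) auto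
    then have "preperiodic f" unfolding preperiodic_def using g(3,4) by blast
    moreover have "f 0 = \<phi> 0" using g(2) f inT[OF f(1), of 0] inT[OF \<phi>(1), of 0] by (intro einj) auto
    ultimately show ?thesis using f(1) False by blast
  qed
qed

section \<open>Embedding of the projective plane in the space of matrices\<close>

lemma openin_RP2: "openin RP2 U \<longleftrightarrow> U \<subseteq> RP2_points \<and> openin S2 (\<Union>U)"
  unfolding RP2_def topology_inverse'[OF istopology_RP2_open] RP2_open_def ..

lemma topspace_RP2: "topspace RP2 = RP2_points"
proof -
  have "\<Union>RP2_points = sphere 0 1"
  proof
    show "sphere 0 1 \<subseteq> \<Union>RP2_points"
    proof
      fix x :: "real^3" assume "x \<in> sphere 0 1"
      then have "{x, - x} \<in> RP2_points" unfolding RP2_points_def by blast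
      then show "x \<in> \<Union>RP2_points" by blast
    qed
  qed (auto simp: RP2_points_def)
  then have "openin RP2 RP2_points" unfolding openin_RP2 S2_def by simp
  then show ?thesis using openin_subset openin_RP2 openin_topspace by blast
qed

lemma proj_eq:
  assumes "norm x = 1" "norm y = 1" "proj x = proj y"
  shows "x = y \<or> x = - y"
  using dist_le_proj[of x y] dist_le_proj[of x "- y"] assms by (cases "inner x y \<ge> 0") auto

lemma RP2_embedding:
  obtains v where "continuous_map RP2 euclidean v" "inj_on v RP2_points" "v ` RP2_points \<subseteq> proj ` sphere 0 1"
proof -
  \<comment> \<open>Either representative gives the same value, since \<open>proj\<close> is
    even.\<close>
  define v where "v c = proj (SOME x. x \<in> c)" for c
  have v: "v {x, - x} = proj x" for x
  proof -
    have "(SOME y. y \<in> {x, - x}) \<in> {x, - x}" by (rule someI[of _ x]) simp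
    then have "(SOME y. y \<in> {x, - x}) = x \<or> (SOME y. y \<in> {x, - x}) = - x" by blast
    then show ?thesis unfolding v_def by (metis proj_minus)
  qed
  show ?thesis
  proof (rule that[of v])
    show "inj_on v RP2_points"
    proof (rule inj_onI)
      fix c d assume "c \<in> RP2_points" "d \<in> RP2_points" "v c = v d"
      then obtain x y where "norm x = 1" "norm y = 1" "c = {x, - x}" "d = {y, - y}" "proj x = proj y" 
        unfolding RP2_points_def using v by auto
      then show "c = d" using proj_eq[of x y] by auto
    qed
    show "v ` RP2_points \<subseteq> proj ` sphere 0 1" unfolding RP2_points_def using v by auto
    show "continuous_map RP2 euclidean v"
      unfolding continuous_map_def topspace_RP2
    proof (intro conjI allI impI)
      fix U :: "(real^3^3) set" assume "openin euclidean U"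
      then have "open (proj -` U)" using continuous_proj[of UNIV] open_vimage by auto
      \<comment> \<open>As openness in \<open>RP2\<close> refers to the union of the pairs,
        continuity of \<open>v\<close> reduces to that of \<open>proj\<close> on the sphere.\<close>
      moreover have "\<Union>{c \<in> RP2_points. v c \<in> U} = sphere 0 1 \<inter> proj -` U"
      proof
        show "\<Union>{c \<in> RP2_points. v c \<in> U} \<subseteq> sphere 0 1 \<inter> proj -` U"
          unfolding RP2_points_def using v by auto
        show "sphere 0 1 \<inter> proj -` U \<subseteq> \<Union>{c \<in> RP2_points. v c \<in> U}"
        proof
          fix x assume "x \<in> sphere 0 1 \<inter> proj -` U"
          then have "{x, - x} \<in> {c \<in> RP2_points. v c \<in> U}" unfolding RP2_points_def using v by auto
          then show "x \<in> \<Union>{c \<in> RP2_points. v c \<in> U}" by blast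
        qed
      qed
      ultimately show "openin RP2 {x \<in> RP2_points. v x \<in> U}" unfolding openin_RP2 S2_def by (auto simp: openin_open_Int)
    qed auto
  qed
qed

theorem theorem2p4:
  fixes Z :: "'a topology" and X :: "(real \<Rightarrow> 'a) set" and \<phi> :: "real \<Rightarrow> 'a"
  assumes "compact_space Z"
    and "(\<exists>A. A \<subseteq> topspace S2 \<and> Z homeomorphic_space subtopology S2 A) \<or>
         (\<exists>A. A \<subseteq> topspace RP2 \<and> Z homeomorphic_space subtopology RP2 A)"
    and "switched_bebutov_shift Z X"
    and "\<phi> \<in> X" and "recurrent Z \<phi>"
  shows "(\<exists>\<psi>\<in>X. preperiodic \<psi> \<and> \<psi> 0 = \<phi> 0) \<and>
         (inj_on \<phi> {0..} \<longrightarrow> (\<exists>\<psi>\<in>X. \<psi> 0 = \<phi> 0 \<and> (\<forall>s\<ge>0. \<psi> s = \<psi> 0)))"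
proof -
  have embed: "\<exists>h. continuous_map Z T h \<and> inj_on h (topspace Z) \<and> h ` topspace Z \<subseteq> topspace T"
    if "Z homeomorphic_space subtopology T A" for T :: "'c topology" and A
  proof -
    obtain h where h: "homeomorphic_map Z (subtopology T A) h"
      using \<open>Z homeomorphic_space subtopology T A\<close> unfolding homeomorphic_space by blast
    then have "continuous_map Z (subtopology T A) h" by (rule homeomorphic_imp_continuous_map)
    then have c: "continuous_map Z T h" by (rule continuous_map_into_fulltopology)
    then show ?thesis using homeomorphic_imp_injective_map[OF h] continuous_map_image_subset_topspace[OF c] by blast
  qed
  have "\<phi> \<in> Cpos Z" using assms(3,4) unfolding switched_bebutov_shift_def bebutov_shift_def by blast
  then have \<phi>T: "\<phi> t \<in> topspace Z" if "0 \<le> t" for t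
    using that continuous_map_image_subset_topspace[of "top_of_set {0..}" Z \<phi>] unfolding Cpos_def by auto
  consider A where "Z homeomorphic_space subtopology S2 A" | A where "Z homeomorphic_space subtopology RP2 A"
    using assms(2) by blast
  then show ?thesis
  proof cases
    case 1
    obtain h where h: "continuous_map Z S2 h" "inj_on h (topspace Z)" "h ` topspace Z \<subseteq> topspace S2" 
      using embed[OF 1] by blast
    have e: "continuous_map Z euclidean h" using h(1) unfolding S2_def by (rule continuous_map_into_fulltopology)
    have n: "norm (h (\<phi> t)) = 1" if "0 \<le> t" for t using h(3) \<phi>T[OF that] unfolding S2_def by auto
    show ?thesis
    proof (rule switched_shift_dichotomy[OF assms(3) e h(2) assms(4,5)])
      assume "inj_on (\<lambda>t. h (\<phi> t)) {0..}" "continuous_on {0..} (\<lambda>t. h (\<phi> t))" "returns (\<lambda>t. h (\<phi> t))"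
      then show "\<exists>(G :: complex \<Rightarrow> real^3) \<psi>. continuous_on UNIV G \<and> continuous_on {0..} \<psi> \<and> returns \<psi> \<and> (\<forall>t\<ge>0. G (\<psi> t) = h (\<phi> t))"
        using planar_coordinates[of "\<lambda>t. h (\<phi> t)"] n by metis
    qed
  next
    case 2
    obtain h where h: "continuous_map Z RP2 h" "inj_on h (topspace Z)" "h ` topspace Z \<subseteq> RP2_points" 
      using embed[OF 2] unfolding topspace_RP2 by blast
    obtain v where v: "continuous_map RP2 euclidean v" "inj_on v RP2_points" "v ` RP2_points \<subseteq> proj ` sphere 0 1"
      using RP2_embedding by blast
    define e where "e = v \<circ> h"
    have e: "continuous_map Z euclidean e" unfolding e_def by (rule continuous_map_compose[OF h(1) v(1)])
    have ei: "inj_on e (topspace Z)" unfolding e_def by (rule comp_inj_on[OF h(2) inj_on_subset[OF v(2) h(3)]])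
    have im: "e (\<phi> t) \<in> proj ` sphere 0 1" if "0 \<le> t" for t unfolding e_def using h(3) v(3) \<phi>T[OF that] by auto
    show ?thesis
    proof (rule switched_shift_dichotomy[OF assms(3) e ei assms(4,5)])
      assume *: "inj_on (\<lambda>t. e (\<phi> t)) {0..}" "continuous_on {0..} (\<lambda>t. e (\<phi> t))" "returns (\<lambda>t. e (\<phi> t))"
      \<comment> \<open>The projective plane minus a point is a Moebius band and does not embed in
        the plane. So the coordinates are taken for a lift to the sphere, and \<open>proj\<close> is
        composed with \<open>G\<close> afterwards.\<close>
      obtain g where g: "continuous_on {0..} g" "\<And>t. 0 \<le> t \<Longrightarrow> norm (g t) = 1" "\<And>t. 0 \<le> t \<Longrightarrow> proj (g t) = e (\<phi> t)"
        using proj_lift[OF *(2) im] by blast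
      have "inj_on g {0..}"
      proof (rule inj_onI)
        fix s t :: real assume "s \<in> {0..}" "t \<in> {0..}" "g s = g t"
        then show "s = t" using g(3)[of s] g(3)[of t] *(1) unfolding inj_on_def by auto
      qed
      moreover have "returns (\<lambda>t. proj (g t))"
        using *(3) g(3) unfolding returns_def by (smt (verit) atLeastAtMost_iff)
      then have "returns g" using returns_proj_lift g(1,2) by blast
      ultimately obtain G :: "complex \<Rightarrow> real^3" and \<psi> where G: "continuous_on UNIV G" "continuous_on {0..} \<psi>" "returns \<psi>" 
        "\<And>t. 0 \<le> t \<Longrightarrow> G (\<psi> t) = g t" using planar_coordinates[of g] g(1,2) by metis
      have "continuous_on UNIV (\<lambda>z. proj (G z))" by (rule continuous_on_compose2[OF continuous_proj[of UNIV] G(1)]) simp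
      moreover have "\<forall>t\<ge>0. proj (G (\<psi> t)) = e (\<phi> t)" using G(4) g(3) by simp
      ultimately show "\<exists>(G :: complex \<Rightarrow> real^3^3) \<psi>. continuous_on UNIV G \<and> continuous_on {0..} \<psi> \<and> returns \<psi> \<and> (\<forall>t\<ge>0. G (\<psi> t) = e (\<phi> t))"
        using G(2,3) by blast
    qed
  qed
qed

end
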